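(* Let $\ell\ge3$ be an integer, let $w_3,\dots,w_\ell\ge0$ be real numbers at least one of which is positive, and set $$r=\min\{k\in\{3,\dots,\ell\}:w_k>0\},\qquad q=r-1.$$ For each $n\in\mathbb N$ let $\mathsf G_n^{\mathrm{mc}}$ be a random graph with distribution $\mathbb P_n^{\mathrm{mc}}$. Then the following hold. (i) $\displaystyle\lim_{n\to\infty}F_n^{\mathrm{mc}}=\frac{\ln2}{2}\left(1-\frac1{r-1}\right)$. (ii) For every $\varepsilon>0$ there are constants $c=c(\varepsilon,r)>0$ and $N=N(\varepsilon,r,w_r)$ such that, for every $n\ge N$, $$\mathbb P\left(\delta_\square(W_{\mathsf G_n^{\mathrm{mc}}},B_q^\star)\ge\varepsilon\right)\le e^{-cn^2}.$$ (iii) For every $\varepsilon>0$ there are constants $c=c(\varepsilon,r)>0$ and $N=N(\varepsilon,r,w_r)$ such that, for every $n\ge N$, with probability at least $1-e^{-cn^2}$, there is a partition $[n]=V_1\sqcup\cdots\sqcup V_q$ with the following properties: (a) $\bigl||V_i|-n/q\bigr|\le\varepsilon n$ for every $i\in[q]$; (b) $\left|\dfrac{e_{\mathsf G_n^{\mathrm{mc}}}(V_i,V_j)}{|V_i||V_j|}-\dfrac12\right|\le\varepsilon$ for all distinct $i,j\in[q]$; (c) $\displaystyle\sum_{i=1}^q e_{\mathsf G_n^{\mathrm{mc}}}(V_i)\le\frac{\varepsilon n^2}{10q}$; (d) $\displaystyle\frac{\sum_{i=1}^q e_{\mathsf G_n^{\mathrm{mc}}}(V_i)}{\sum_{i=1}^q\binom{|V_i|}2}\le\varepsilon$.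 If $\mathsf G_n'$ is obtained from $\mathsf G_n^{\mathrm{mc}}$ by deleting all edges whose endpoints lie in the same part, then $\mathsf G_n'$ is $q$-partite and $$d_{\mathrm{edit}}(\mathsf G_n^{\mathrm{mc}},\mathsf G_n')\le\frac{\varepsilon}{10q}\le\frac\varepsilon2.$$ In particular, the reduced free-energy limit and the cut-distance limit depend on the weight vector $(w_3,\dots,w_\ell)$ only through $r$; and, once $r$ and $w_r$ are fixed, the constants $c,N$ in parts (ii) and (iii) can be chosen independently of $\ell$ and of the weights $w_{r+1},\dots,w_\ell$ (with $c$ depending only on $\varepsilon,r$ and $N$ only on $\varepsilon,r,w_r$).
   Context: $[n]=\{1,\dots,n\}$, and $\mathbf G_n$ is the set of all simple graphs with vertex set $[n]$. $K_k(G)$ denotes the number of (unordered) copies of the complete graph $K_k$ in $G$. The model. For $k\in\{3,\dots,\ell\}$ and $G\in\mathbf G_n$ let $N_k(G)=n^k-k!\,K_k(G)$; each $G$ gets unnormalized mass $\exp(\sum_{k=3}^\ell w_kN_k(G))$. After removing the factor independent of $G$, the reduced mass is $$M_n^{\mathrm{mc}}(G)=\exp\left(-\sum_{k=r}^{\ell}k!\,w_k\,K_k(G)\right),$$ and one sets $\widetilde Z_n^{\mathrm{mc}}=\sum_{G\in\mathbf G_n}M_n^{\mathrm{mc}}(G)$, $\mathbb P_n^{\mathrm{mc}}(A)=\frac1{\widetilde Z_n^{\mathrm{mc}}}\sum_{G\in A}M_n^{\mathrm{mc}}(G)$ for $A\subseteq\mathbf G_n$, and $F_n^{\mathrm{mc}}=\frac1{n^2}\ln\widetilde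 Z_n^{\mathrm{mc}}$. Graphs. For $A\subseteq[n]$, $e_G(A)$ is the number of edges of $G$ with both endpoints in $A$; for disjoint $A,B\subseteq[n]$, $e_G(A,B)$ is the number of edges with one endpoint in $A$ and the other in $B$. For $G,H\in\mathbf G_n$, $d_{\mathrm{edit}}(G,H)=\frac1{n^2}|E(G)\triangle E(H)|$. Graphons. $\lambda$ is Lebesgue measure on $[0,1]$. A graphon is a measurable $W:[0,1]^2\to[0,1]$ with $W(x,y)=W(y,x)$ for almost every $(x,y)$. The empirical graphon $W_G$ of $G\in\mathbf G_n$ is defined as follows: let $I_i=[\frac{i-1}n,\frac in)$ for $i<n$ and $I_n=[\frac{n-1}n,1]$; for $x\in I_i$, $y\in I_j$ put $W_G(x,y)=1$ if $\{i,j\}\in E(G)$ and $W_G(x,y)=0$ otherwise. The cut norm of an integrable $U:[0,1]^2\to\mathbb R$ is $\|U\|_\square=\sup_{S,T}\left|\int_{S\times T}U\,dx\,dy\right|$ over measurable $S,T\subseteq[0,1]$. The cut distance of graphons is $\delta_\square(W_1,W_2)=\inf_\phi\|W_1-W_2^\phi\|_\square$, where $W^\phi(x,y)=W(\phi(x),\phi(y))$ and $\phi$ ranges over bijections of $[0,1]$ such that $\phi,\phi^{-1}$ are Lebesgue-measurable and $\phi$ preserves $\lambda$. For a nonempty family $\mathcal F$ of graphons, $\delta_\square(W,\mathcal F)=\inf_{V\in\mathcal F}\delta_\square(W,V)$. For $q\ge2$, $B_q^\star$ is the family of all graphons $W$ for which there is a measurable partition $[0,1]=A_1\sqcup\cdots\sqcup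 A_q$ with $\lambda(A_i)=1/q$ for every $i$, such that $W=0$ almost everywhere on each $A_i\times A_i$ and $W=\frac12$ almost everywhere on $A_i\times A_j$ for all distinct $i,j\in[q]$. "Cut-distance limit" refers to the convergence to $B_q^\star$ expressed in (ii). *)

theory Defs
  imports "HOL-Analysis.Analysis"
begin

section \<open>Graphs on the vertex set \<open>{1..n}\<close>\<close>

text \<open>A simple graph on \<open>{1..n}\<close> is identified with its edge set, a set of two-element
  subsets of \<open>{1..n}\<close>.\<close>

type_synonym graph = "nat set set"

definition graphs :: "nat \<Rightarrow> graph set" where
  "graphs n = Pow {e. e \<subseteq> {1..n} \<and> card e = 2}"

definition clique_count :: "nat \<Rightarrow> nat \<Rightarrow> graph \<Rightarrow> nat" where
  "clique_count n k G =
     card {S. S \<subseteq> {1..n} \<and> card S = k \<and> (\<forall>u\<in>S. \<forall>v\<in>S. u \<noteq> v \<longrightarrow> {u, v} \<in> G)}"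

definition edges_in :: "graph \<Rightarrow> nat set \<Rightarrow> nat" where
  "edges_in G A = card {e \<in> G. e \<subseteq> A}"

definition edges_between :: "graph \<Rightarrow> nat set \<Rightarrow> nat set \<Rightarrow> nat" where
  "edges_between G A B = card {e \<in> G. \<exists>a\<in>A. \<exists>b\<in>B. e = {a, b}}"

definition edit_dist :: "nat \<Rightarrow> graph \<Rightarrow> graph \<Rightarrow> real" where
  "edit_dist n G H = real (card ((G - H) \<union> (H - G))) / (real n)\<^sup>2"

text \<open>The parts are required to be nonempty, so that the bipartite densities
  \<open>edges_between G (V i) (V j) / (card (V i) * card (V j))\<close> have nonzero denominators.\<close>

definition vertex_partition :: "nat \<Rightarrow> nat \<Rightarrow> (nat \<Rightarrow> nat set) \<Rightarrow> bool" where
  "vertex_partition n q V \<longleftrightarrow>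
     (\<Union>i\<in>{1..q}. V i) = {1..n} \<and> disjoint_family_on V {1..q} \<and> (\<forall>i\<in>{1..q}. V i \<noteq> {})"

definition delete_inner_edges :: "nat \<Rightarrow> (nat \<Rightarrow> nat set) \<Rightarrow> graph \<Rightarrow> graph" where
  "delete_inner_edges q V G = {e \<in> G. \<not> (\<exists>i\<in>{1..q}. e \<subseteq> V i)}"

text \<open>Colour classes may be empty here, as is usual for \<open>q\<close>-partite graphs.\<close>

definition partite :: "nat \<Rightarrow> nat \<Rightarrow> graph \<Rightarrow> bool" where
  "partite n q G \<longleftrightarrow>
     (\<exists>f. f ` {1..n} \<subseteq> {1..q} \<and> (\<forall>u\<in>{1..n}. \<forall>v\<in>{1..n}. {u, v} \<in> G \<longrightarrow> f u \<noteq> f v))"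


section \<open>The clique-weighted random graph model\<close>

text \<open>A weight vector \<open>(w\<^sub>3, \<dots>, w\<^sub>l)\<close> is a function \<open>w\<close>, only whose values on \<open>{3..l}\<close> matter.\<close>

definition weight_vector :: "nat \<Rightarrow> (nat \<Rightarrow> real) \<Rightarrow> bool" where
  "weight_vector l w \<longleftrightarrow> l \<ge> 3 \<and> (\<forall>k\<in>{3..l}. w k \<ge> 0) \<and> (\<exists>k\<in>{3..l}. w k > 0)"

definition min_index :: "nat \<Rightarrow> (nat \<Rightarrow> real) \<Rightarrow> nat" where
  "min_index l w = Min {k \<in> {3..l}. w k > 0}"

definition mc_mass :: "nat \<Rightarrow> (nat \<Rightarrow> real) \<Rightarrow> nat \<Rightarrow> graph \<Rightarrow> real" where
  "mc_mass l w n G =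
     exp (- (\<Sum>k = min_index l w..l. fact k * w k * real (clique_count n k G)))"

definition mc_Z :: "nat \<Rightarrow> (nat \<Rightarrow> real) \<Rightarrow> nat \<Rightarrow> real" where
  "mc_Z l w n = (\<Sum>G\<in>graphs n. mc_mass l w n G)"

definition mc_prob :: "nat \<Rightarrow> (nat \<Rightarrow> real) \<Rightarrow> nat \<Rightarrow> graph set \<Rightarrow> real" where
  "mc_prob l w n A = (\<Sum>G\<in>A. mc_mass l w n G) / mc_Z l w n"

definition mc_free_energy :: "nat \<Rightarrow> (nat \<Rightarrow> real) \<Rightarrow> nat \<Rightarrow> real" where
  "mc_free_energy l w n = ln (mc_Z l w n) / (real n)\<^sup>2"


section \<open>Graphons and the cut distance\<close>

text \<open>Functions on the unit square are represented by functions on the whole plane; their values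
  outside the square are irrelevant. Measurability is Lebesgue measurability throughout.\<close>

abbreviation unit_lebesgue :: "real measure" where
  "unit_lebesgue \<equiv> lebesgue_on {0..1}"

abbreviation unit_square :: "(real \<times> real) set" where
  "unit_square \<equiv> {0..1} \<times> {0..1}"

definition graphon :: "(real \<times> real \<Rightarrow> real) \<Rightarrow> bool" where
  "graphon W \<longleftrightarrow>
     W \<in> borel_measurable (lebesgue_on unit_square) \<and>
     (\<forall>p\<in>unit_square. 0 \<le> W p \<and> W p \<le> 1) \<and>
     (AE p in lebesgue_on unit_square. W (fst p, snd p) = W (snd p, fst p))"

definition cell :: "nat \<Rightarrow> nat \<Rightarrow> real set" where
  "cell n i = (if i < n then {(real i - 1) / real n..<real i / real n}
                        else {(real n - 1) / real n..1})"

definition empirical_graphon :: "nat \<Rightarrow> graph \<Rightarrow> real \<times> real \<Rightarrow> real" where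
  "empirical_graphon n G = (\<lambda>(x, y).
     if \<exists>i\<in>{1..n}. \<exists>j\<in>{1..n}. x \<in> cell n i \<and> y \<in> cell n j \<and> {i, j} \<in> G then 1 else 0)"

text \<open>The supremum is a supremum of reals, meaningful for \<open>U\<close> integrable on the unit square.\<close>

definition cut_norm :: "(real \<times> real \<Rightarrow> real) \<Rightarrow> real" where
  "cut_norm U =
     (SUP (S, T) \<in> sets unit_lebesgue \<times> sets unit_lebesgue. \<bar>LINT p:S \<times> T|lebesgue. U p\<bar>)"

definition unit_automorphism :: "(real \<Rightarrow> real) \<Rightarrow> bool" where
  "unit_automorphism \<phi> \<longleftrightarrow>
     bij_betw \<phi> {0..1} {0..1} \<and>
     \<phi> \<in> measurable unit_lebesgue unit_lebesgue \<and>
     inv_into {0..1} \<phi> \<in> measurable unit_lebesgue unit_lebesgue \<and>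
     distr unit_lebesgue unit_lebesgue \<phi> = unit_lebesgue"

definition cut_dist :: "(real \<times> real \<Rightarrow> real) \<Rightarrow> (real \<times> real \<Rightarrow> real) \<Rightarrow> real" where
  "cut_dist W1 W2 =
     (INF \<phi> \<in> Collect unit_automorphism. cut_norm (\<lambda>(x, y). W1 (x, y) - W2 (\<phi> x, \<phi> y)))"

definition cut_dist_set :: "(real \<times> real \<Rightarrow> real) \<Rightarrow> (real \<times> real \<Rightarrow> real) set \<Rightarrow> real" where
  "cut_dist_set W F = (INF V\<in>F. cut_dist W V)"

definition B_star :: "nat \<Rightarrow> (real \<times> real \<Rightarrow> real) set" where
  "B_star q = {W. graphon W \<and>
     (\<exists>A :: nat \<Rightarrow> real set.
        (\<Union>i\<in>{1..q}. A i) = {0..1} \<and> disjoint_family_on A {1..q} \<and>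
        (\<forall>i\<in>{1..q}. A i \<in> sets lebesgue \<and> measure lebesgue (A i) = 1 / real q) \<and>
        (\<forall>i\<in>{1..q}. AE p in lebesgue_on (A i \<times> A i). W p = 0) \<and>
        (\<forall>i\<in>{1..q}. \<forall>j\<in>{1..q}. i \<noteq> j \<longrightarrow>
           (AE p in lebesgue_on (A i \<times> A j). W p = 1 / 2)))}"

end

theory Submission
  imports Defs
begin

text \<open>
  Every graph with few copies of \<open>K\<^sub>r\<close> is close in cut norm to one of \<open>exp (O(n))\<close> functions
  \<open>g : [n]\<^sup>2 \<rightarrow> [0, 1]\<close> (weak regularity), and up to few edges it lies in the graph \<open>{g \<ge> \<gamma>}\<close>,
  which again has few copies of \<open>K\<^sub>r\<close> by the counting lemma. A robust form of Fueredi's stability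
  theorem shows that such a container either has noticeably fewer edges than the Turan graph, so that
  it has too few subgraphs to matter, or is almost \<open>q\<close>-partite with balanced classes. Since the
  graphs with many copies of \<open>K\<^sub>r\<close> have total mass at most
  \<open>2 ^ (n\<^sup>2 / 2) exp (- \<Omega>(n\<^sup>3))\<close> and the subgraphs of one Turan graph already give
  \<open>Z \<ge> 2 ^ ((1 - 1 / q) n\<^sup>2 / 2 - n)\<close>, a random graph is almost \<open>q\<close>-partite, and
  by a Chernoff bound its bipartite pieces are quasirandom of density \<open>1 / 2\<close>. This yields the
  partition; splitting each of the \<open>n\<close> cells into \<open>q\<close> subcells and moving few of them makes
  the classes exactly equal in measure, which gives the nearby member of \<open>B_star\<close>.
\<close>

section \<open>Cut norm and the counting lemma\<close>

text \<open>Weak regularity is used because it yields only exp(O(n)) containers, a number that is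
  lost in exp(c n^2), and because its cut-norm error is enough for counting copies of K_r. Stability
  is proved for few instead of no copies, so no removal lemma intervenes. The dependence of the
  constants dictates the division of labour. Being far from q-partite is penalised by counting
  alone, with all masses bounded by 1, so the rate c comes from \<epsilon> and r. The weight w_r
  acts only against graphs with many copies of K_r; there n^r with r >= 3 beats every multiple of
  n^2, so w_r moves the threshold N but never c. Weights beyond r are dropped from upper bounds and
  are invisible in the lower bound for Z, whose graphs contain no K_k with k >= r. Edges are mostly
  counted as ordered pairs (\<open>arcs\<close>), which also admits the loops that a thresholded
  approximant may have.\<close>

lemma linear_le_subset_sum:
  fixes \<phi> a :: "'a \<Rightarrow> real"
  assumes "finite X" "\<And>x. x \<in> X \<Longrightarrow> 0 \<le> a x \<and> a x \<le> 1"
  shows "(\<Sum>x\<in>X. a x * \<phi> x) \<le> (\<Sum>x\<in>{x\<in>X. \<phi> x > 0}. \<phi> x)"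
proof -
  have "(\<Sum>x\<in>X. a x * \<phi> x) \<le> (\<Sum>x\<in>X. if \<phi> x > 0 then \<phi> x else 0)"
  proof (rule sum_mono)
    fix x assume "x \<in> X"
    then have "0 \<le> a x" "a x \<le> 1" using assms(2) by auto
    then show "a x * \<phi> x \<le> (if \<phi> x > 0 then \<phi> x else 0)"
      by (auto simp: mult_left_le_one_le mult_nonneg_nonpos)
  qed
  also have "\<dots> = (\<Sum>x\<in>{x\<in>X. \<phi> x > 0}. \<phi> x)"
    using assms(1) by (simp add: sum.inter_filter)
  finally show ?thesis .
qed

text \<open>For fixed \<open>b\<close> the form is linear in \<open>a\<close>, hence maximised by
  the indicator of a set; then the same applies to \<open>b\<close>. Thus a cut bound, which speaks
  of sets only, controls all weights in the unit interval.\<close>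

lemma bilinear_le:
  fixes d :: "'a \<Rightarrow> 'b \<Rightarrow> real"
  assumes fin: "finite X" "finite Y"
    and d: "\<And>S T. S \<subseteq> X \<Longrightarrow> T \<subseteq> Y \<Longrightarrow> (\<Sum>x\<in>S. \<Sum>y\<in>T. d x y) \<le> K"
    and a: "\<And>x. x \<in> X \<Longrightarrow> 0 \<le> a x \<and> a x \<le> 1"
    and b: "\<And>y. y \<in> Y \<Longrightarrow> 0 \<le> b y \<and> b y \<le> 1"
  shows "(\<Sum>x\<in>X. \<Sum>y\<in>Y. a x * b y * d x y) \<le> K"
proof -
  define S where "S = {x\<in>X. (\<Sum>y\<in>Y. b y * d x y) > 0}"
  define T where "T = {y\<in>Y. (\<Sum>x\<in>S. d x y) > 0}"
  have "(\<Sum>x\<in>X. \<Sum>y\<in>Y. a x * b y * d x y) = (\<Sum>x\<in>X. a x * (\<Sum>y\<in>Y. b y * d x y))"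
    by (simp add: sum_distrib_left mult.assoc)
  also have "\<dots> \<le> (\<Sum>x\<in>S. \<Sum>y\<in>Y. b y * d x y)"
    unfolding S_def by (rule linear_le_subset_sum) (use fin a in auto)
  also have "\<dots> = (\<Sum>y\<in>Y. b y * (\<Sum>x\<in>S. d x y))"
    by (subst sum.swap) (simp add: sum_distrib_left)
  also have "\<dots> \<le> (\<Sum>y\<in>T. \<Sum>x\<in>S. d x y)"
    unfolding T_def by (rule linear_le_subset_sum) (use fin b in auto)
  also have "\<dots> = (\<Sum>x\<in>S. \<Sum>y\<in>T. d x y)" by (rule sum.swap)
  also have "\<dots> \<le> K" by (rule d) (auto simp: S_def T_def)
  finally show ?thesis .
qed

lemma bilinear_abs_le:
  fixes d :: "'a \<Rightarrow> 'b \<Rightarrow> real"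
  assumes fin: "finite X" "finite Y"
    and d: "\<And>S T. S \<subseteq> X \<Longrightarrow> T \<subseteq> Y \<Longrightarrow> \<bar>\<Sum>x\<in>S. \<Sum>y\<in>T. d x y\<bar> \<le> K"
    and a: "\<And>x. x \<in> X \<Longrightarrow> 0 \<le> a x \<and> a x \<le> 1"
    and b: "\<And>y. y \<in> Y \<Longrightarrow> 0 \<le> b y \<and> b y \<le> 1"
  shows "\<bar>\<Sum>x\<in>X. \<Sum>y\<in>Y. a x * b y * d x y\<bar> \<le> K"
proof -
  have 1: "(\<Sum>x\<in>X. \<Sum>y\<in>Y. a x * b y * d x y) \<le> K"
    by (rule bilinear_le[OF fin _ a b]) (use d in \<open>fastforce simp: abs_le_iff\<close>)+
  have 2: "(\<Sum>x\<in>X. \<Sum>y\<in>Y. a x * b y * (- d x y)) \<le> K"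
    by (rule bilinear_le[OF fin _ a b])
      (use d in \<open>fastforce simp: abs_le_iff sum_negf\<close>)+
  then have "- (\<Sum>x\<in>X. \<Sum>y\<in>Y. a x * b y * d x y) \<le> K"
    by (simp add: sum_negf)
  with 1 show ?thesis by linarith
qed

text \<open>For fixed \<open>i\<close> the map from \<open>(x, u)\<close> to
  \<open>x(i := u)\<close> hits every function exactly \<open>card V\<close> times. Resampling a
  coordinate in this way isolates it without splitting the product space.\<close>

lemma sum_PiE_upd:
  fixes D :: "('i \<Rightarrow> 'a) \<Rightarrow> real"
  assumes I: "finite I" "i \<in> I" and V: "finite V"
  shows "(\<Sum>x\<in>PiE I (\<lambda>_. V). \<Sum>u\<in>V. D (x(i := u))) = real (card V) * (\<Sum>x\<in>PiE I (\<lambda>_. V). D x)"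
proof -
  define J where "J = I - {i}"
  have Ieq: "I = insert i J" and iJ: "i \<notin> J" using I by (auto simp: J_def)
  have inj: "inj_on (\<lambda>(y, g). g(i := y)) (V \<times> PiE J (\<lambda>_. V))"
    using inj_combinator[OF iJ, of "\<lambda>_. V"] .
  have reindex: "(\<Sum>x\<in>PiE I (\<lambda>_. V). E x) = (\<Sum>y\<in>V. \<Sum>g\<in>PiE J (\<lambda>_. V). E (g(i := y)))" for E :: "_ \<Rightarrow> real"
  proof -
    have "(\<Sum>x\<in>PiE I (\<lambda>_. V). E x) = (\<Sum>(y, g)\<in>V \<times> PiE J (\<lambda>_. V). E (g(i := y)))"
      unfolding Ieq PiE_insert_eq
      by (subst sum.reindex[OF inj]) (simp add: case_prod_unfold)
    then show ?thesis by (simp add: sum.cartesian_product)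
  qed
  show ?thesis
    by (simp add: reindex) (simp add: sum.swap[of _ "PiE J (\<lambda>_. V)" V])
qed

section \<open>Homomorphism sums and the counting lemma\<close>

definition index_pairs :: "nat \<Rightarrow> (nat \<times> nat) set" where
  "index_pairs r = {(i, j). j < i \<and> i < r}"

lemma finite_index_pairs [simp]: "finite (index_pairs r)"
proof -
  have "index_pairs r \<subseteq> {..<r} \<times> {..<r}" by (auto simp: index_pairs_def)
  then show ?thesis by (rule finite_subset) simp
qed

lemma card_index_pairs: "card (index_pairs r) \<le> r ^ 2"
proof -
  have "index_pairs r \<subseteq> {..<r} \<times> {..<r}" by (auto simp: index_pairs_def)
  then have "card (index_pairs r) \<le> card ({..<r} \<times> {..<r})" by (intro card_mono) auto
  then show ?thesis by (simp add: power2_eq_square)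
qed

text \<open>Weighted homomorphism count of \<open>K_r\<close>. Every edge \<open>p\<close> carries
  its own weight function, so that edges can be exchanged one at a time.\<close>

definition hom_sum :: "nat \<Rightarrow> nat set \<Rightarrow> (nat \<times> nat \<Rightarrow> nat \<Rightarrow> nat \<Rightarrow> real) \<Rightarrow> real" where
  "hom_sum r V F = (\<Sum>x\<in>PiE {..<r} (\<lambda>_. V). \<Prod>p\<in>index_pairs r. F p (x (fst p)) (x (snd p)))"

text \<open>Once all coordinates except the two ends of \<open>p\<close> are frozen, every other
  edge meets at most one of these ends. The remaining factors split into a function of one end, a
  function of the other and a constant, and the difference becomes a bilinear form controlled by the
  cut bound.\<close>

lemma hom_sum_upd_le:
  fixes F :: "nat \<times> nat \<Rightarrow> nat \<Rightarrow> nat \<Rightarrow> real"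
  assumes V: "finite V" and p: "p \<in> index_pairs r"
    and F: "\<And>p x y. p \<in> index_pairs r \<Longrightarrow> x \<in> V \<Longrightarrow> y \<in> V \<Longrightarrow> 0 \<le> F p x y \<and> F p x y \<le> 1"
    and cut: "\<And>S T. S \<subseteq> V \<Longrightarrow> T \<subseteq> V \<Longrightarrow> \<bar>\<Sum>x\<in>S. \<Sum>y\<in>T. F p x y - g x y\<bar> \<le> K"
  shows "real (card V) ^ 2 * \<bar>hom_sum r V F - hom_sum r V (F(p := g))\<bar> \<le> real (card V) ^ r * K"
proof -
  obtain i j where ij: "p = (i, j)" "j < i" "i < r" using p by (auto simp: index_pairs_def)
  define P where "P = index_pairs r - {p}"
  have finP: "finite P" by (simp add: P_def)
  define R where "R x = (\<Prod>p\<in>P. F p (x (fst p)) (x (snd p)))" for x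
  define D where "D x = R x * (F p (x i) (x j) - g (x i) (x j))" for x
  have split: "(\<Prod>k\<in>index_pairs r. H k (x (fst k)) (x (snd k))) = H p (x i) (x j) * (\<Prod>k\<in>P. H k (x (fst k)) (x (snd k)))"
    for H :: "nat \<times> nat \<Rightarrow> nat \<Rightarrow> nat \<Rightarrow> real" and x
    unfolding P_def using prod.remove[OF finite_index_pairs p, of "\<lambda>k. H k (x (fst k)) (x (snd k))"] ij by simp
  have upd: "(\<Prod>k\<in>P. (F(p := g)) k (x (fst k)) (x (snd k))) = R x" for x
    unfolding R_def by (rule prod.cong) (auto simp: P_def)
  have diff: "hom_sum r V F - hom_sum r V (F(p := g)) = (\<Sum>x\<in>PiE {..<r} (\<lambda>_. V). D x)"
    unfolding hom_sum_def sum_subtractf[symmetric] split upd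
    by (rule sum.cong) (auto simp: D_def R_def algebra_simps)
  \<comment> \<open>Other edges at \<open>i\<close>, those at \<open>j\<close> but not at
    \<open>i\<close>, and those at neither; the only edge at both is \<open>p\<close>, which is not
    in \<open>P\<close>.\<close>
  define Pi where "Pi = {k\<in>P. fst k = i \<or> snd k = i}"
  define Pj where "Pj = {k\<in>P. k \<notin> Pi \<and> (fst k = j \<or> snd k = j)}"
  define P0 where "P0 = {k\<in>P. k \<notin> Pi \<and> k \<notin> Pj}"
  have part: "P = Pi \<union> Pj \<union> P0" "Pi \<inter> Pj = {}" "(Pi \<union> Pj) \<inter> P0 = {}"
    by (auto simp: Pi_def Pj_def P0_def)
  have finp: "finite Pi" "finite Pj" "finite P0" using finP by (auto simp: Pi_def Pj_def P0_def)
  have Dbound: "\<bar>\<Sum>u\<in>V. \<Sum>v\<in>V. D (x(i := u, j := v))\<bar> \<le> K" if x: "x \<in> PiE {..<r} (\<lambda>_. V)" for x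
  proof -
    define a where "a u = (\<Prod>k\<in>Pi. F k ((x(i := u)) (fst k)) ((x(i := u)) (snd k)))" for u
    define b where "b v = (\<Prod>k\<in>Pj. F k ((x(j := v)) (fst k)) ((x(j := v)) (snd k)))" for v
    define c where "c = (\<Prod>k\<in>P0. F k (x (fst k)) (x (snd k)))"
    have inV: "x k \<in> V" if "k < r" for k using x that by (auto simp: PiE_def Pi_iff)
    have idx: "fst k < r" "snd k < r" "k \<in> index_pairs r" "snd k < fst k" if "k \<in> P" for k
      using that by (auto simp: P_def index_pairs_def)
    have Req: "R (x(i := u, j := v)) = a u * b v * c" for u v
    proof -
      have nj: "fst k \<noteq> j \<and> snd k \<noteq> j" if "k \<in> Pi" for k
        using that idx(4)[of k] ij by (cases k) (auto simp: Pi_def P_def)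
      have ni: "fst k \<noteq> i \<and> snd k \<noteq> i" if "k \<in> Pj" for k
        using that by (auto simp: Pi_def Pj_def)
      have n0: "fst k \<noteq> i \<and> snd k \<noteq> i \<and> fst k \<noteq> j \<and> snd k \<noteq> j" if "k \<in> P0" for k
        using that by (auto simp: Pi_def Pj_def P0_def)
      have "R (x(i := u, j := v)) =
          (\<Prod>k\<in>Pi. F k ((x(i := u, j := v)) (fst k)) ((x(i := u, j := v)) (snd k))) *
          (\<Prod>k\<in>Pj. F k ((x(i := u, j := v)) (fst k)) ((x(i := u, j := v)) (snd k))) *
          (\<Prod>k\<in>P0. F k ((x(i := u, j := v)) (fst k)) ((x(i := u, j := v)) (snd k)))"
        unfolding R_def part(1) using part(2,3) finp
        by (subst prod.union_disjoint, simp, simp, simp, subst prod.union_disjoint) auto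
      also have "(\<Prod>k\<in>Pi. F k ((x(i := u, j := v)) (fst k)) ((x(i := u, j := v)) (snd k))) = a u"
        unfolding a_def by (rule prod.cong) (use nj in auto)
      also have "(\<Prod>k\<in>Pj. F k ((x(i := u, j := v)) (fst k)) ((x(i := u, j := v)) (snd k))) = b v"
        unfolding b_def by (rule prod.cong) (use ni in auto)
      also have "(\<Prod>k\<in>P0. F k ((x(i := u, j := v)) (fst k)) ((x(i := u, j := v)) (snd k))) = c"
        unfolding c_def by (rule prod.cong) (use n0 in auto)
      finally show ?thesis .
    qed
    have Fb: "0 \<le> F k ((x(l := u)) (fst k)) ((x(l := u)) (snd k)) \<and> F k ((x(l := u)) (fst k)) ((x(l := u)) (snd k)) \<le> 1"
      if "k \<in> P" "u \<in> V" for k u l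
      using F[OF idx(3)[OF that(1)], of "(x(l := u)) (fst k)" "(x(l := u)) (snd k)"] inV idx(1,2)[OF that(1)] that(2)
      by auto
    have a: "0 \<le> a u \<and> a u \<le> 1" if "u \<in> V" for u
      unfolding a_def using Fb that by (auto intro!: prod_nonneg prod_le_1 simp: Pi_def simp del: fun_upd_apply)
    have b: "0 \<le> b u \<and> b u \<le> 1" if "u \<in> V" for u
      unfolding b_def using Fb that by (auto intro!: prod_nonneg prod_le_1 simp: Pj_def simp del: fun_upd_apply)
    have c: "0 \<le> c \<and> c \<le> 1"
    proof -
      have "0 \<le> F k (x (fst k)) (x (snd k)) \<and> F k (x (fst k)) (x (snd k)) \<le> 1" if "k \<in> P0" for k
        using that F[OF idx(3)] inV idx(1,2) by (auto simp: P0_def)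
      then show ?thesis unfolding c_def by (auto intro!: prod_nonneg prod_le_1)
    qed
    have K: "K \<ge> 0" using cut[of "{}" "{}"] by simp
    have "(\<Sum>u\<in>V. \<Sum>v\<in>V. D (x(i := u, j := v))) = c * (\<Sum>u\<in>V. \<Sum>v\<in>V. a u * b v * (F p u v - g u v))"
      using ij by (simp add: D_def Req sum_distrib_left ac_simps)
    then have "\<bar>\<Sum>u\<in>V. \<Sum>v\<in>V. D (x(i := u, j := v))\<bar> = c * \<bar>\<Sum>u\<in>V. \<Sum>v\<in>V. a u * b v * (F p u v - g u v)\<bar>"
      using c by (simp add: abs_mult)
    also have "\<dots> \<le> 1 * K"
      by (intro mult_mono bilinear_abs_le[OF V V cut a b]) (use c in auto)
    finally show ?thesis by simp
  qed
  \<comment> \<open>Resampling both coordinates repeats every tuple \<open>card V ^ 2\<close> times,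
    hence this factor in the claim.\<close>
  have "real (card V) ^ 2 * (hom_sum r V F - hom_sum r V (F(p := g))) =
      real (card V) * (\<Sum>x\<in>PiE {..<r} (\<lambda>_. V). \<Sum>v\<in>V. D (x(j := v)))"
    unfolding diff using sum_PiE_upd[of "{..<r}" j V D] ij V by (simp add: power2_eq_square)
  also have "\<dots> = (\<Sum>x\<in>PiE {..<r} (\<lambda>_. V). \<Sum>u\<in>V. \<Sum>v\<in>V. D (x(i := u, j := v)))"
    using sum_PiE_upd[of "{..<r}" i V "\<lambda>x. \<Sum>v\<in>V. D (x(j := v))"] ij V by simp
  finally have "real (card V) ^ 2 * \<bar>hom_sum r V F - hom_sum r V (F(p := g))\<bar> =
      \<bar>\<Sum>x\<in>PiE {..<r} (\<lambda>_. V). \<Sum>u\<in>V. \<Sum>v\<in>V. D (x(i := u, j := v))\<bar>"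
    by (metis abs_mult abs_of_nat power_abs)
  also have "\<dots> \<le> (\<Sum>x\<in>PiE {..<r} (\<lambda>_. V). K)"
    by (rule order_trans[OF sum_abs sum_mono]) (rule Dbound)
  also have "\<dots> = real (card V) ^ r * K"
    by (simp add: card_PiE)
  finally show ?thesis .
qed

text \<open>Hybrid argument: \<open>f\<close> is replaced by \<open>g\<close> on one edge after
  another, each replacement costing at most \<open>\<eta> * card V ^ r\<close>; \<open>r ^ 2\<close>
  bounds the number of edges.\<close>

lemma hom_sum_cut_le:
  fixes f g :: "nat \<Rightarrow> nat \<Rightarrow> real"
  assumes V: "finite V"
    and f: "\<And>x y. 0 \<le> f x y \<and> f x y \<le> 1" and g: "\<And>x y. 0 \<le> g x y \<and> g x y \<le> 1"
    and cut: "\<And>S T. S \<subseteq> V \<Longrightarrow> T \<subseteq> V \<Longrightarrow> \<bar>\<Sum>x\<in>S. \<Sum>y\<in>T. f x y - g x y\<bar> \<le> \<eta> * real (card V) ^ 2"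
    and Vne: "V \<noteq> {}"
  shows "\<bar>hom_sum r V (\<lambda>_. f) - hom_sum r V (\<lambda>_. g)\<bar> \<le> real r ^ 2 * \<eta> * real (card V) ^ r"
proof -
  have n: "real (card V) > 0" using V Vne by (simp add: card_gt_0_iff)
  have "0 \<le> \<eta> * real (card V) ^ 2" using cut[of "{}" "{}"] by simp
  then have eta: "\<eta> \<ge> 0" using n by (simp add: zero_le_mult_iff)
  have hyb: "\<bar>hom_sum r V (\<lambda>_. f) - hom_sum r V (\<lambda>p. if p \<in> Q then g else f)\<bar> \<le> real (card Q) * \<eta> * real (card V) ^ r"
    if "finite Q" "Q \<subseteq> index_pairs r" for Q
    using that
  proof (induction Q rule: finite_induct)
    case empty
    then show ?case by simp
  next
    case (insert p Q)
    define F where "F = (\<lambda>k. if k \<in> Q then g else f)"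
    have upd: "(\<lambda>k. if k \<in> insert p Q then g else f) = F(p := g)" by (auto simp: F_def)
    have Fp: "F p = f" using insert by (auto simp: F_def)
    have "real (card V) ^ 2 * \<bar>hom_sum r V F - hom_sum r V (F(p := g))\<bar> \<le> real (card V) ^ r * (\<eta> * real (card V) ^ 2)"
      by (rule hom_sum_upd_le[OF V]) (use insert.prems f g cut Fp in \<open>auto simp: F_def\<close>)
    then have "\<bar>hom_sum r V F - hom_sum r V (F(p := g))\<bar> \<le> \<eta> * real (card V) ^ r"
      using n by (simp add: mult.commute mult.left_commute)
    moreover have "\<bar>hom_sum r V (\<lambda>_. f) - hom_sum r V F\<bar> \<le> real (card Q) * \<eta> * real (card V) ^ r"
      using insert by (simp add: F_def)
    ultimately show ?case
      using insert(1,2) unfolding upd by (simp add: algebra_simps)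
  qed
  have "hom_sum r V (\<lambda>p. if p \<in> index_pairs r then g else f) = hom_sum r V (\<lambda>_. g)"
    unfolding hom_sum_def by (intro sum.cong prod.cong) auto
  then have "\<bar>hom_sum r V (\<lambda>_. f) - hom_sum r V (\<lambda>_. g)\<bar> \<le> real (card (index_pairs r)) * \<eta> * real (card V) ^ r"
    using hyb[of "index_pairs r"] by simp
  also have "\<dots> \<le> real r ^ 2 * \<eta> * real (card V) ^ r"
    using card_index_pairs[of r] eta by (intro mult_right_mono) (auto simp flip: of_nat_power)
  finally show ?thesis .
qed

section \<open>Weak regularity\<close>

definition clip :: "real \<Rightarrow> real" where
  "clip t = max 0 (min 1 t)"

text \<open>Symmetrised so that symmetric approximants stay symmetric; where the two rectangles
  overlap the value is 2.\<close>

definition sym_rect :: "nat set \<Rightarrow> nat set \<Rightarrow> nat \<Rightarrow> nat \<Rightarrow> real" where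
  "sym_rect S T x y = of_bool (x \<in> S \<and> y \<in> T) + of_bool (x \<in> T \<and> y \<in> S)"

definition step :: "real \<Rightarrow> (nat \<Rightarrow> nat \<Rightarrow> real) \<Rightarrow> (nat \<Rightarrow> nat \<Rightarrow> real) \<Rightarrow> nat \<Rightarrow> nat \<Rightarrow> real" where
  "step c M g = (\<lambda>x y. clip (g x y + c * M x y))"

definition below :: "real \<Rightarrow> (nat \<Rightarrow> nat \<Rightarrow> real) \<Rightarrow> nat \<Rightarrow> nat \<Rightarrow> real" where
  "below \<gamma> g = (\<lambda>x y. of_bool (g x y < \<gamma>))"

text \<open>The approximants are generated without reference to the graph to be approximated, which
  allows counting them once for all graphs. Steps along rectangles repair the cut distance; steps
  along \<open>below\<close> repair an excess of edges where \<open>g\<close> is under the threshold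
  \<open>\<gamma>\<close>.\<close>

primrec approximants :: "nat set \<Rightarrow> real \<Rightarrow> real \<Rightarrow> nat \<Rightarrow> (nat \<Rightarrow> nat \<Rightarrow> real) set" where
  "approximants V \<gamma> \<eta> 0 = {\<lambda>_ _. 0}"
| "approximants V \<gamma> \<eta> (Suc t) = approximants V \<gamma> \<eta> t \<union>
     (\<lambda>(c, S, T, g). step c (sym_rect S T) g) ` ({\<eta>, - \<eta>} \<times> Pow V \<times> Pow V \<times> approximants V \<gamma> \<eta> t) \<union>
     (\<lambda>g. step \<eta> (below \<gamma> g) g) ` approximants V \<gamma> \<eta> t"

lemma finite_approximants:
  assumes "finite V"
  shows "finite (approximants V \<gamma> \<eta> t)"
  by (induction t) (use assms in auto)

text \<open>One round offers 2 signs times \<open>4 ^ card V\<close> pairs of sets, the threshold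
  step and standing still, that is, at most \<open>2 + 2 * 4 ^ card V\<close> choices.\<close>

lemma card_approximants:
  assumes V: "finite V"
  shows "card (approximants V \<gamma> \<eta> t) \<le> 4 ^ (t * (card V + 1))"
proof (induction t)
  case 0
  then show ?case by simp
next
  case (Suc t)
  let ?A = "approximants V \<gamma> \<eta> t"
  have fin: "finite ?A" using finite_approximants[OF V] .
  have "card ({\<eta>, - \<eta>} \<times> Pow V \<times> Pow V \<times> ?A) \<le> 2 * (2 ^ card V * (2 ^ card V * card ?A))"
    using V by (simp add: card_cartesian_product card_Pow card_insert_if)
  also have "\<dots> = 2 * 4 ^ card V * card ?A"
    by (simp flip: power_mult_distrib mult.assoc)
  finally have 1: "card ((\<lambda>(c, S, T, g). step c (sym_rect S T) g) ` ({\<eta>, - \<eta>} \<times> Pow V \<times> Pow V \<times> ?A)) \<le> 2 * 4 ^ card V * card ?A"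
    by (intro order_trans[OF card_image_le]) (use V fin in auto)
  have 2: "card ((\<lambda>g. step \<eta> (below \<gamma> g) g) ` ?A) \<le> card ?A"
    by (rule card_image_le[OF fin])
  have "card (approximants V \<gamma> \<eta> (Suc t)) \<le> card ?A + 2 * 4 ^ card V * card ?A + card ?A"
    unfolding approximants.simps using 1 2
    by (meson add_mono card_Un_le le_refl le_trans)
  also have "\<dots> = (2 + 2 * 4 ^ card V) * card ?A" by (simp add: algebra_simps)
  also have "\<dots> \<le> 4 ^ (card V + 1) * card ?A"
    by (intro mult_right_mono) auto
  also have "\<dots> \<le> 4 ^ (card V + 1) * 4 ^ (t * (card V + 1))"
    by (intro mult_left_mono Suc) auto
  finally show ?case by (simp add: power_add mult_ac)
qed

lemma approximants_range:
  "g \<in> approximants V \<gamma> \<eta> t \<Longrightarrow> 0 \<le> g x y \<and> g x y \<le> 1"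
  by (induction t arbitrary: g x y) (auto simp: step_def clip_def)

lemma approximants_sym:
  "g \<in> approximants V \<gamma> \<eta> t \<Longrightarrow> g x y = g y x"
proof (induction t arbitrary: g x y)
  case (Suc t)
  have "step c M h x y = step c M h y x"
    if "h \<in> approximants V \<gamma> \<eta> t" "M x y = M y x" for h c M
    using Suc.IH[OF that(1), of x y] that(2) by (simp add: step_def)
  moreover have "sym_rect S T x y = sym_rect S T y x" for S T
    by (auto simp: sym_rect_def)
  moreover have "below \<gamma> h x y = below \<gamma> h y x" if "h \<in> approximants V \<gamma> \<eta> t" for h
    using Suc.IH[OF that, of x y] by (simp add: below_def)
  ultimately show ?case using Suc.prems Suc.IH by auto
qed auto

text \<open>Clipping projects onto the interval in which \<open>f\<close> takes its values, so it
  cannot increase the distance; what remains is the expansion of a square.\<close>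

lemma step_energy:
  fixes f g M :: "nat \<Rightarrow> nat \<Rightarrow> real"
  assumes f: "\<And>x y. 0 \<le> f x y \<and> f x y \<le> 1"
  shows "(\<Sum>x\<in>V. \<Sum>y\<in>V. (f x y - step c M g x y)\<^sup>2) \<le>
     (\<Sum>x\<in>V. \<Sum>y\<in>V. (f x y - g x y)\<^sup>2) - 2 * c * (\<Sum>x\<in>V. \<Sum>y\<in>V. (f x y - g x y) * M x y)
     + c\<^sup>2 * (\<Sum>x\<in>V. \<Sum>y\<in>V. (M x y)\<^sup>2)"
proof -
  have clip: "(a - clip t)\<^sup>2 \<le> (a - t)\<^sup>2" if "0 \<le> a \<and> a \<le> 1" for a t :: real
  proof -
    have "\<bar>a - clip t\<bar> \<le> \<bar>a - t\<bar>" using that by (auto simp: clip_def)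
    then show ?thesis by (simp add: abs_le_square_iff)
  qed
  have "(f x y - step c M g x y)\<^sup>2 \<le> (f x y - g x y)\<^sup>2 - 2 * c * ((f x y - g x y) * M x y) + c\<^sup>2 * (M x y)\<^sup>2" for x y
    using clip[OF f[of x y], of "g x y + c * M x y"]
    by (simp add: step_def power2_eq_square algebra_simps)
  then have "(\<Sum>x\<in>V. \<Sum>y\<in>V. (f x y - step c M g x y)\<^sup>2) \<le>
    (\<Sum>x\<in>V. \<Sum>y\<in>V. (f x y - g x y)\<^sup>2 - 2 * c * ((f x y - g x y) * M x y) + c\<^sup>2 * (M x y)\<^sup>2)"
    by (intro sum_mono)
  then show ?thesis by (simp add: sum.distrib sum_subtractf sum_distrib_left)
qed

definition cut_close :: "nat set \<Rightarrow> real \<Rightarrow> (nat \<Rightarrow> nat \<Rightarrow> real) \<Rightarrow> (nat \<Rightarrow> nat \<Rightarrow> real) \<Rightarrow> bool" where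
  "cut_close V \<eta> f g \<longleftrightarrow>
    (\<forall>S\<subseteq>V. \<forall>T\<subseteq>V. \<bar>\<Sum>x\<in>S. \<Sum>y\<in>T. f x y - g x y\<bar> \<le> \<eta> * real (card V) ^ 2)"

lemma sum_sum_of_bool:
  assumes "finite V" "S \<subseteq> V" "T \<subseteq> V"
  shows "(\<Sum>x\<in>V. \<Sum>y\<in>V. h x y * of_bool (x \<in> S \<and> y \<in> T)) = (\<Sum>x\<in>S. \<Sum>y\<in>T. h x y :: real)"
proof -
  have "(\<Sum>x\<in>V. \<Sum>y\<in>V. h x y * of_bool (x \<in> S \<and> y \<in> T)) =
      (\<Sum>x\<in>V. of_bool (x \<in> S) * (\<Sum>y\<in>V. of_bool (y \<in> T) * h x y))"
    by (simp add: sum_distrib_left of_bool_conj mult_ac)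
  also have "\<dots> = (\<Sum>x\<in>V \<inter> S. \<Sum>y\<in>V \<inter> T. h x y)"
    using assms by simp
  finally show ?thesis using assms by (simp add: Int_absorb1)
qed

text \<open>If the current approximant is not good enough, then one of the two kinds of steps lowers the
  squared distance to \<open>f\<close>, which is at most \<open>n\<^sup>2\<close> initially, by \<open>\<eta>\<^sup>2 n\<^sup>2\<close>.\<close>

lemma weak_regularity_step:
  fixes f :: "nat \<Rightarrow> nat \<Rightarrow> real"
  assumes V: "finite V" and eta: "0 < \<eta>" "\<eta> \<le> \<gamma>"
    and f: "\<And>x y. 0 \<le> f x y \<and> f x y \<le> 1" and fsym: "\<And>x y. f x y = f y x"
  shows "\<exists>g\<in>approximants V \<gamma> \<eta> t.
     (cut_close V (2 * \<eta>) f g \<and> (\<Sum>x\<in>V. \<Sum>y\<in>V. f x y * below \<gamma> g x y) \<le> 2 * \<gamma> * real (card V) ^ 2) \<or>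
     (\<Sum>x\<in>V. \<Sum>y\<in>V. (f x y - g x y)\<^sup>2) \<le> real (card V) ^ 2 - real t * \<eta>\<^sup>2 * real (card V) ^ 2"
proof (induction t)
  case 0
  have "(f x y)\<^sup>2 \<le> 1" for x y using f[of x y] by (simp add: power_le_one)
  then have "(\<Sum>x\<in>V. \<Sum>y\<in>V. (f x y)\<^sup>2) \<le> (\<Sum>x\<in>V. \<Sum>y\<in>V. 1)" by (intro sum_mono)
  then show ?case by (simp add: power2_eq_square)
next
  case (Suc t)
  define n where "n = real (card V)"
  define En where "En g = (\<Sum>x\<in>V. \<Sum>y\<in>V. (f x y - g x y)\<^sup>2)" for g
  from Suc obtain g where g: "g \<in> approximants V \<gamma> \<eta> t"
    and alt: "(cut_close V (2 * \<eta>) f g \<and> (\<Sum>x\<in>V. \<Sum>y\<in>V. f x y * below \<gamma> g x y) \<le> 2 * \<gamma> * n ^ 2) \<or>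
     En g \<le> n ^ 2 - real t * \<eta>\<^sup>2 * n ^ 2"
    by (auto simp: n_def En_def)
  have good: "\<exists>h\<in>approximants V \<gamma> \<eta> (Suc t). En h \<le> n\<^sup>2 - real (Suc t) * \<eta>\<^sup>2 * n\<^sup>2"
    if nc: "\<not> (cut_close V (2 * \<eta>) f g \<and> (\<Sum>x\<in>V. \<Sum>y\<in>V. f x y * below \<gamma> g x y) \<le> 2 * \<gamma> * n ^ 2)"
  proof -
    have En: "En g \<le> n ^ 2 - real t * \<eta>\<^sup>2 * n ^ 2" using alt nc by blast
    show ?thesis
    proof (cases "cut_close V (2 * \<eta>) f g")
      case False
      then obtain S T where ST: "S \<subseteq> V" "T \<subseteq> V" and gt: "\<bar>\<Sum>x\<in>S. \<Sum>y\<in>T. f x y - g x y\<bar> > 2 * \<eta> * n ^ 2"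
        by (auto simp: cut_close_def n_def not_le)
      define X where "X = (\<Sum>x\<in>S. \<Sum>y\<in>T. f x y - g x y)"
      \<comment> \<open>The step goes in the direction of the discrepancy, so that the linear term
        becomes \<open>- 4 * \<eta> * \<bar>X\<bar>\<close>.\<close>
      define c where "c = (if X \<ge> 0 then \<eta> else - \<eta>)"
      have cX: "c * X = \<eta> * \<bar>X\<bar>" by (auto simp: c_def)
      have gsym: "g x y = g y x" for x y using approximants_sym[OF g] .
      have "(\<Sum>x\<in>V. \<Sum>y\<in>V. (f x y - g x y) * sym_rect S T x y) =
          (\<Sum>x\<in>V. \<Sum>y\<in>V. (f x y - g x y) * of_bool (x \<in> S \<and> y \<in> T)) +
          (\<Sum>x\<in>V. \<Sum>y\<in>V. (f x y - g x y) * of_bool (x \<in> T \<and> y \<in> S))"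
        by (simp add: sym_rect_def distrib_left sum.distrib)
      also have "\<dots> = X + (\<Sum>x\<in>T. \<Sum>y\<in>S. f x y - g x y)"
        by (simp add: sum_sum_of_bool[OF V] ST X_def)
      also have "(\<Sum>x\<in>T. \<Sum>y\<in>S. f x y - g x y) = X"
        unfolding X_def by (subst sum.swap, rule sum.cong[OF refl], rule sum.cong[OF refl], rule arg_cong2[of _ _ _ _ "(-)"], rule fsym, rule gsym)
      finally have inner: "(\<Sum>x\<in>V. \<Sum>y\<in>V. (f x y - g x y) * sym_rect S T x y) = 2 * X" by simp
      have "(sym_rect S T x y)\<^sup>2 \<le> 4" for x y by (auto simp: sym_rect_def)
      then have "(\<Sum>x\<in>V. \<Sum>y\<in>V. (sym_rect S T x y)\<^sup>2) \<le> (\<Sum>x\<in>V. \<Sum>y\<in>V. 4)" by (intro sum_mono)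
      then have norm: "(\<Sum>x\<in>V. \<Sum>y\<in>V. (sym_rect S T x y)\<^sup>2) \<le> 4 * n\<^sup>2" by (simp add: n_def power2_eq_square)
      have "En (step c (sym_rect S T) g) \<le> En g - 2 * c * (2 * X) + c\<^sup>2 * (\<Sum>x\<in>V. \<Sum>y\<in>V. (sym_rect S T x y)\<^sup>2)"
        unfolding En_def using step_energy[of f c "sym_rect S T" g V, OF f] inner by simp
      also have "\<dots> \<le> En g - 4 * \<eta> * \<bar>X\<bar> + \<eta>\<^sup>2 * (4 * n\<^sup>2)"
        using mult_left_mono[OF norm, of "c\<^sup>2"] cX by (auto simp: c_def split: if_splits)
      \<comment> \<open>The gain \<open>8 * \<eta>\<^sup>2 * n\<^sup>2\<close> outweighs the
        quadratic cost \<open>4 * \<eta>\<^sup>2 * n\<^sup>2\<close>, which stems from the value 2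
        of \<open>sym_rect\<close> on overlaps.\<close>
      also have "\<dots> \<le> En g - 4 * \<eta> * (2 * \<eta> * n\<^sup>2) + \<eta>\<^sup>2 * (4 * n\<^sup>2)"
        using mult_left_mono[of "2 * \<eta> * n\<^sup>2" "\<bar>X\<bar>" "4 * \<eta>"] gt eta by (simp add: X_def)
      also have "\<dots> = En g - 4 * (\<eta>\<^sup>2 * n\<^sup>2)" by (simp add: power2_eq_square)
      also have "\<dots> \<le> En g - \<eta>\<^sup>2 * n\<^sup>2" by simp
      also have "\<dots> \<le> n\<^sup>2 - real (Suc t) * \<eta>\<^sup>2 * n\<^sup>2" using En by (simp add: algebra_simps)
      finally have "En (step c (sym_rect S T) g) \<le> n\<^sup>2 - real (Suc t) * \<eta>\<^sup>2 * n\<^sup>2" .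
      moreover have "step c (sym_rect S T) g \<in> approximants V \<gamma> \<eta> (Suc t)"
      proof -
        have "(c, S, T, g) \<in> {\<eta>, - \<eta>} \<times> Pow V \<times> Pow V \<times> approximants V \<gamma> \<eta> t"
          using g ST by (auto simp: c_def)
        from imageI[OF this, of "\<lambda>(c, S, T, g). step c (sym_rect S T) g"]
        show ?thesis unfolding approximants.simps prod.case by blast
      qed
      ultimately show ?thesis by blast
    next
      case True
      with nc have gt: "(\<Sum>x\<in>V. \<Sum>y\<in>V. f x y * below \<gamma> g x y) > 2 * \<gamma> * n ^ 2" by simp
      \<comment> \<open>Where \<open>g < \<gamma>\<close>, the sum of \<open>g\<close> is at most
        \<open>\<gamma> * n\<^sup>2\<close>, half of what \<open>f\<close> exceeds there, so
        \<open>f - g\<close> correlates with this set.\<close>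
      have "g x y * below \<gamma> g x y \<le> \<gamma>" for x y using eta by (auto simp: below_def)
      then have "(\<Sum>x\<in>V. \<Sum>y\<in>V. g x y * below \<gamma> g x y) \<le> (\<Sum>x\<in>V. \<Sum>y\<in>V. \<gamma>)" by (intro sum_mono)
      then have inner: "(\<Sum>x\<in>V. \<Sum>y\<in>V. (f x y - g x y) * below \<gamma> g x y) \<ge> \<gamma> * n\<^sup>2"
        using gt unfolding left_diff_distrib sum_subtractf by (simp add: n_def power2_eq_square algebra_simps)
      have "(\<Sum>x\<in>V. \<Sum>y\<in>V. (below \<gamma> g x y)\<^sup>2) \<le> (\<Sum>x\<in>V. \<Sum>y\<in>V. 1)" by (intro sum_mono) (auto simp: below_def)
      then have norm: "(\<Sum>x\<in>V. \<Sum>y\<in>V. (below \<gamma> g x y)\<^sup>2) \<le> n\<^sup>2" by (simp add: n_def power2_eq_square)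
      have "En (step \<eta> (below \<gamma> g) g) \<le> En g - 2 * \<eta> * (\<Sum>x\<in>V. \<Sum>y\<in>V. (f x y - g x y) * below \<gamma> g x y)
          + \<eta>\<^sup>2 * (\<Sum>x\<in>V. \<Sum>y\<in>V. (below \<gamma> g x y)\<^sup>2)"
        unfolding En_def using step_energy[of f \<eta> "below \<gamma> g" g V, OF f] by simp
      also have "\<dots> \<le> En g - 2 * \<eta> * (\<gamma> * n\<^sup>2) + \<eta>\<^sup>2 * n\<^sup>2"
        by (intro add_mono diff_left_mono mult_left_mono norm inner) (use eta in auto)
      also have "\<dots> \<le> En g - \<eta>\<^sup>2 * n\<^sup>2"
      proof -
        have "\<eta> * (\<eta> * n\<^sup>2) \<le> \<eta> * (\<gamma> * n\<^sup>2)"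
          using eta by (intro mult_left_mono mult_right_mono) auto
        then show ?thesis by (simp add: power2_eq_square)
      qed
      also have "\<dots> \<le> n\<^sup>2 - real (Suc t) * \<eta>\<^sup>2 * n\<^sup>2" using En by (simp add: algebra_simps)
      finally have "En (step \<eta> (below \<gamma> g) g) \<le> n\<^sup>2 - real (Suc t) * \<eta>\<^sup>2 * n\<^sup>2" .
      moreover have "step \<eta> (below \<gamma> g) g \<in> approximants V \<gamma> \<eta> (Suc t)" using g by simp
      ultimately show ?thesis by blast
    qed
  qed
  have "g \<in> approximants V \<gamma> \<eta> (Suc t)" using g by simp
  with good show ?case unfolding En_def n_def by blast
qed

text \<open>With \<open>t * \<eta>\<^sup>2 > 1\<close> the energy alternative of the step lemma
  would make a sum of squares negative, so the first alternative holds.\<close>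

lemma weak_regularity:
  fixes f :: "nat \<Rightarrow> nat \<Rightarrow> real"
  assumes V: "finite V" "V \<noteq> {}" and eta: "0 < \<eta>" "\<eta> \<le> \<gamma>" and t: "real t * \<eta>\<^sup>2 > 1"
    and f: "\<And>x y. 0 \<le> f x y \<and> f x y \<le> 1" and fsym: "\<And>x y. f x y = f y x"
  obtains g where "g \<in> approximants V \<gamma> \<eta> t" "cut_close V (2 * \<eta>) f g"
    "(\<Sum>x\<in>V. \<Sum>y\<in>V. f x y * below \<gamma> g x y) \<le> 2 * \<gamma> * real (card V) ^ 2"
proof -
  have n: "real (card V) > 0" using V by (simp add: card_gt_0_iff)
  have "\<not> (\<Sum>x\<in>V. \<Sum>y\<in>V. (f x y - g x y)\<^sup>2) \<le> real (card V) ^ 2 - real t * \<eta>\<^sup>2 * real (card V) ^ 2" for g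
  proof -
    have "1 * real (card V) ^ 2 < real t * \<eta>\<^sup>2 * real (card V) ^ 2"
      using n t by (intro mult_strict_right_mono) auto
    moreover have "0 \<le> (\<Sum>x\<in>V. \<Sum>y\<in>V. (f x y - g x y)\<^sup>2)" by (intro sum_nonneg) auto
    ultimately show ?thesis by linarith
  qed
  with weak_regularity_step[of V \<eta> \<gamma> f t, OF V(1) eta f fsym] that show thesis by blast
qed

section \<open>Robust stability\<close>

definition cliques :: "('a \<Rightarrow> 'a \<Rightarrow> bool) \<Rightarrow> nat \<Rightarrow> 'a set \<Rightarrow> (nat \<Rightarrow> 'a) set" where
  "cliques E r A = {x \<in> PiE {..<r} (\<lambda>_. A). \<forall>i<r. \<forall>j<i. E (x i) (x j)}"

lemma finite_cliques: "finite A \<Longrightarrow> finite (cliques E r A)"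
  unfolding cliques_def by (rule finite_subset[OF _ finite_PiE[of "{..<r}" "\<lambda>_. A"]]) auto

text \<open>The last coordinate \<open>v\<close> is split off; the others form a clique inside the
  neighbourhood of \<open>v\<close>. This is the recursion on which the stability induction
  runs.\<close>

lemma card_cliques_Suc:
  assumes A: "finite A" and sym: "\<And>x y. E x y = E y x"
  shows "card (cliques E (Suc r) A) = (\<Sum>v\<in>A. card (cliques E r {u\<in>A. E v u}))"
proof -
  have eq: "cliques E (Suc r) A = (\<lambda>(v, x). x(r := v)) ` (SIGMA v:A. cliques E r {u\<in>A. E v u})"
  proof (intro equalityI subsetI)
    fix x assume x: "x \<in> cliques E (Suc r) A"
    define y where "y = restrict x {..<r}"
    have "x = y(r := x r)"
      using x by (auto simp: y_def cliques_def PiE_def extensional_def fun_eq_iff)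
    moreover have "x r \<in> A" using x by (auto simp: cliques_def)
    moreover have "y \<in> cliques E r {u\<in>A. E (x r) u}"
      using x by (auto simp: cliques_def y_def PiE_def Pi_iff)
    ultimately show "x \<in> (\<lambda>(v, x). x(r := v)) ` (SIGMA v:A. cliques E r {u\<in>A. E v u})"
      by (intro image_eqI[of _ _ "(x r, y)"]) auto
  next
    fix x assume "x \<in> (\<lambda>(v, x). x(r := v)) ` (SIGMA v:A. cliques E r {u\<in>A. E v u})"
    then obtain v y where x: "x = y(r := v)" "v \<in> A" and y: "y \<in> cliques E r {u\<in>A. E v u}" by auto
    have "x \<in> PiE {..<Suc r} (\<lambda>_. A)"
      using x y by (auto simp: cliques_def PiE_def Pi_iff extensional_def less_Suc_eq)
    moreover have "E (x i) (x j)" if "i < Suc r" "j < i" for i j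
    proof (cases "i = r")
      case True
      have "y j \<in> {u\<in>A. E v u}" using y that True by (auto simp: cliques_def PiE_def Pi_iff)
      then show ?thesis using True that x(1) by simp
    next
      case False
      then show ?thesis using that x(1) y by (auto simp: cliques_def less_Suc_eq)
    qed
    ultimately show "x \<in> cliques E (Suc r) A" by (auto simp: cliques_def)
  qed
  have inj: "inj_on (\<lambda>(v, x). x(r := v)) (SIGMA v:A. cliques E r {u\<in>A. E v u})"
  proof (rule inj_onI, clarify)
    fix v x w y
    assume xy: "x \<in> cliques E r {u\<in>A. E v u}" "y \<in> cliques E r {u\<in>A. E w u}" and eq: "x(r := v) = y(r := w)"
    have "v = w" using fun_cong[OF eq, of r] by simp
    moreover have "x i = y i" for i
    proof (cases "i = r")
      case True
      then show ?thesis using xy by (auto simp: cliques_def PiE_def extensional_def)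
    next
      case False
      then show ?thesis using fun_cong[OF eq, of i] by simp
    qed
    ultimately show "v = w \<and> x = y" by auto
  qed
  show ?thesis
    unfolding eq card_image[OF inj] using A by (subst card_SigmaI) (auto simp: finite_cliques)
qed

lemma cliques_1: "card (cliques E 1 A) = card A"
proof -
  have "cliques E 1 A = PiE {..<1} (\<lambda>_. A)" by (auto simp: cliques_def)
  then show ?thesis by (simp add: card_PiE)
qed

definition nbrs :: "('a \<Rightarrow> 'a \<Rightarrow> bool) \<Rightarrow> 'a set \<Rightarrow> 'a \<Rightarrow> nat" where
  "nbrs E A v = card {u\<in>A. E v u}"

text \<open>Ordered adjacent pairs: a proper edge inside \<open>A\<close> counts twice in
  \<open>arcs E A A\<close>, an edge between disjoint sets once.\<close>

definition arcs :: "('a \<Rightarrow> 'a \<Rightarrow> bool) \<Rightarrow> 'a set \<Rightarrow> 'a set \<Rightarrow> nat" where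
  "arcs E A B = (\<Sum>v\<in>A. nbrs E B v)"

lemma arcs_Un_left:
  "finite A \<Longrightarrow> finite B \<Longrightarrow> A \<inter> B = {} \<Longrightarrow> arcs E (A \<union> B) C = arcs E A C + arcs E B C"
  by (simp add: arcs_def sum.union_disjoint)

lemma arcs_commute:
  assumes "finite A" "finite B" "\<And>x y. E x y = E y x"
  shows "arcs E A B = arcs E B A"
proof -
  have eq: "arcs E X Y = (\<Sum>v\<in>X. \<Sum>u\<in>Y. of_bool (E v u))" if "finite Y" for X Y
    using that by (simp add: arcs_def nbrs_def Int_def)
  have "arcs E A B = (\<Sum>v\<in>B. \<Sum>u\<in>A. of_bool (E u v))"
    unfolding eq[OF assms(2)] by (rule sum.swap)
  also have "\<dots> = arcs E B A"
    unfolding eq[OF assms(1)] by (rule sum.cong[OF refl], rule sum.cong[OF refl], rule arg_cong[of _ _ of_bool], rule assms(3))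
  finally show ?thesis .
qed

lemma arcs_Un_right:
  assumes "finite A" "finite B" "A \<inter> B = {}"
  shows "arcs E C (A \<union> B) = arcs E C A + arcs E C B"
proof -
  have "nbrs E (A \<union> B) v = nbrs E A v + nbrs E B v" for v
  proof -
    have "{u \<in> A \<union> B. E v u} = {u\<in>A. E v u} \<union> {u\<in>B. E v u}" by auto
    moreover have "{u\<in>A. E v u} \<inter> {u\<in>B. E v u} = {}" using assms by auto
    ultimately show ?thesis using assms unfolding nbrs_def by (simp add: card_Un_disjoint)
  qed
  then show ?thesis by (simp add: arcs_def sum.distrib)
qed

lemma arcs_le: "finite A \<Longrightarrow> finite B \<Longrightarrow> arcs E A B \<le> card A * card B"
  unfolding arcs_def nbrs_def using sum_bounded_above[of A "\<lambda>v. card {u\<in>B. E v u}" "card B"]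
  by (auto intro: card_mono)

text \<open>Fueredi's proof of the stability theorem, made robust: the classes are the successive
  non-neighbourhoods of vertices of maximum degree, where only vertices lying in few cliques are
  eligible. Edges are counted as ordered pairs.\<close>

theorem robust_stability:
  assumes "q \<ge> 1" "\<eta> > 0"
  shows "\<exists>\<delta>>0. \<forall>n A (E :: 'a \<Rightarrow> 'a \<Rightarrow> bool). finite A \<longrightarrow> real (card A) \<le> n \<longrightarrow> (\<forall>x y. E x y = E y x) \<longrightarrow>
    real (card (cliques E (Suc q) A)) \<le> \<delta> * n ^ Suc q \<longrightarrow>
    (\<exists>p. p ` A \<subseteq> {1..q} \<and>
       real (arcs E A A) + (\<Sum>i=1..q. real (arcs E {v\<in>A. p v = i} {v\<in>A. p v = i})) \<le>
         real (card A) ^ 2 - (\<Sum>i=1..q. real (card {v\<in>A. p v = i}) ^ 2) + \<eta> * n ^ 2)"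
  using assms
proof (induction q arbitrary: \<eta> rule: nat_induct_at_least)
  case base
  show ?case
  \<comment> \<open>With the single class \<open>A\<close> the left side is
    \<open>2 * arcs E A A\<close>, and \<open>arcs E A A\<close> is the number of 2-cliques.\<close>
  proof (intro exI[of _ "\<eta> / 2"] conjI allI impI)
    show "0 < \<eta> / 2" using base by simp
    fix n A and E :: "'a \<Rightarrow> 'a \<Rightarrow> bool"
    assume A: "finite A" "real (card A) \<le> n" "\<forall>x y. E x y = E y x"
      and c: "real (card (cliques E (Suc 1) A)) \<le> \<eta> / 2 * n ^ Suc 1"
    have "card (cliques E (Suc 1) A) = arcs E A A"
      using A by (subst card_cliques_Suc) (auto simp: cliques_1 arcs_def nbrs_def simp del: One_nat_def)
    then have "2 * real (arcs E A A) \<le> \<eta> * n ^ 2" using c by (simp add: power2_eq_square)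
    then show "\<exists>p. p ` A \<subseteq> {1..1::nat} \<and>
       real (arcs E A A) + (\<Sum>i=1..1. real (arcs E {v\<in>A. p v = i} {v\<in>A. p v = i})) \<le>
         real (card A) ^ 2 - (\<Sum>i=1..1. real (card {v\<in>A. p v = i}) ^ 2) + \<eta> * n ^ 2"
      by (intro exI[of _ "\<lambda>_. 1::nat"]) auto
  qed
next
  case (Suc q)
  obtain \<delta>' where d': "\<delta>' > 0" and IH: "\<And>n A (E :: 'a \<Rightarrow> 'a \<Rightarrow> bool). finite A \<Longrightarrow> real (card A) \<le> n \<Longrightarrow> (\<forall>x y. E x y = E y x) \<Longrightarrow>
    real (card (cliques E (Suc q) A)) \<le> \<delta>' * n ^ Suc q \<Longrightarrow>
    (\<exists>p. p ` A \<subseteq> {1..q} \<and>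
       real (arcs E A A) + (\<Sum>i=1..q. real (arcs E {v\<in>A. p v = i} {v\<in>A. p v = i})) \<le>
         real (card A) ^ 2 - (\<Sum>i=1..q. real (card {v\<in>A. p v = i}) ^ 2) + \<eta> / 2 * n ^ 2)"
    using Suc.IH[of "\<eta> / 2"] Suc.prems by auto
  \<comment> \<open>Exceptional vertices cost \<open>\<sigma> * n * n\<close> twice; the other half
    of \<open>\<eta>\<close> goes to the induction hypothesis.\<close>
  define \<sigma> where "\<sigma> = \<eta> / 4"
  have sg: "\<sigma> > 0" using Suc.prems by (simp add: \<sigma>_def)
  show ?case
  proof (intro exI[of _ "\<delta>' * \<sigma>"] conjI allI impI)
    show "0 < \<delta>' * \<sigma>" using d' sg by simp
    fix n A and E :: "'a \<Rightarrow> 'a \<Rightarrow> bool"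
    assume A: "finite A" and n: "real (card A) \<le> n" and "\<forall>x y. E x y = E y x"
      and c: "real (card (cliques E (Suc (Suc q)) A)) \<le> \<delta>' * \<sigma> * n ^ Suc (Suc q)"
    then have sym: "E x y = E y x" for x y by blast
    have n0: "n \<ge> 0" using n by linarith
    define deg where "deg = nbrs E A"
    \<comment> \<open>The vertices whose neighbourhood has too many cliques for the induction
      hypothesis; by double counting there are few of them.\<close>
    define B where "B = {v\<in>A. real (card (cliques E (Suc q) {u\<in>A. E v u})) > \<delta>' * n ^ Suc q}"
    have B: "B \<subseteq> A" "finite B" using A by (auto simp: B_def)
    have Bcard: "real (card B) \<le> \<sigma> * n"
    proof (cases "n = 0")
      case True
      then have "A = {}" using n A by simp
      then show ?thesis using True B by simp
    next
      case False
      then have np: "n > 0" using n0 by simp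
      have "real (card B) * (\<delta>' * n ^ Suc q) \<le> (\<Sum>v\<in>B. real (card (cliques E (Suc q) {u\<in>A. E v u})))"
        using sum_bounded_below[of B "\<delta>' * n ^ Suc q" "\<lambda>v. real (card (cliques E (Suc q) {u\<in>A. E v u}))"]
        by (force simp: B_def)
      also have "\<dots> \<le> (\<Sum>v\<in>A. real (card (cliques E (Suc q) {u\<in>A. E v u})))"
        using A B by (intro sum_mono2) auto
      also have "\<dots> = real (card (cliques E (Suc (Suc q)) A))"
        by (simp add: card_cliques_Suc[of A E "Suc q", OF A sym])
      also have "\<dots> \<le> (\<sigma> * n) * (\<delta>' * n ^ Suc q)" using c by (simp add: mult_ac)
      finally show ?thesis using np d' by (simp add: mult_le_cancel_right)
    qed
    show "\<exists>p. p ` A \<subseteq> {1..Suc q} \<and>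
       real (arcs E A A) + (\<Sum>i=1..Suc q. real (arcs E {v\<in>A. p v = i} {v\<in>A. p v = i})) \<le>
         real (card A) ^ 2 - (\<Sum>i=1..Suc q. real (card {v\<in>A. p v = i}) ^ 2) + \<eta> * n ^ 2"
    proof (cases "A = B")
      case True
      \<comment> \<open>If every vertex is exceptional, then \<open>A\<close> is so small that a
        single class works.\<close>
      have a: "real (arcs E A A) \<le> \<sigma> * n * n"
      proof -
        have "real (arcs E A A) \<le> real (card A) * real (card A)"
          using arcs_le[OF A A, of E] by (metis of_nat_le_iff of_nat_mult)
        also have "\<dots> \<le> \<sigma> * n * n" using n Bcard True by (intro mult_mono) auto
        finally show ?thesis .
      qed
      have e: "{v\<in>A. 1 = i} = (if i = 1 then A else {})" for i :: nat by auto
      have z: "arcs E {} {} = 0" by (simp add: arcs_def)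
      have s1: "(\<Sum>i=1..Suc q. real (arcs E {v\<in>A. 1 = i} {v\<in>A. 1 = i})) = real (arcs E A A)"
        by (subst sum.remove[of _ 1]) (auto simp: z intro!: sum.neutral)
      have s2: "(\<Sum>i=1..Suc q. real (card {v\<in>A. 1 = i}) ^ 2) = real (card A) ^ 2"
        by (subst sum.remove[of _ 1]) (auto intro!: sum.neutral)
      have "0 \<le> n * n" using n0 by simp
      then have "2 * (\<sigma> * n * n) \<le> \<eta> * n ^ 2" using Suc.prems by (simp add: \<sigma>_def power2_eq_square)
      with a s1 s2 show ?thesis by (intro exI[of _ "\<lambda>_. 1"]) auto
    next
      case False
      then have "A - B \<noteq> {}" using B by auto
      then have "Max (deg ` (A - B)) \<in> deg ` (A - B)" using A by (intro Max_in) auto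
      then obtain x where x: "x \<in> A - B" and mx: "Max (deg ` (A - B)) = deg x" by blast
      have max: "deg y \<le> deg x" if "y \<in> A - B" for y
        unfolding mx[symmetric] using that A by (intro Max_ge) auto
      define A' where "A' = {u\<in>A. E x u}"
      define V where "V = A - A'"
      have A': "finite A'" "A' \<subseteq> A" using A by (auto simp: A'_def)
      have V: "finite V" "V \<subseteq> A" "A = V \<union> A'" "V \<inter> A' = {}" using A A' by (auto simp: V_def)
      have cA': "card A' = deg x" by (simp add: A'_def deg_def nbrs_def)
      have leA': "real (card A') \<le> n" using card_mono[OF A A'(2)] n by linarith
      have fewA': "real (card (cliques E (Suc q) A')) \<le> \<delta>' * n ^ Suc q"
        using x by (auto simp: B_def A'_def)
      obtain p where p: "p ` A' \<subseteq> {1..q}" and pb: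
        "real (arcs E A' A') + (\<Sum>i=1..q. real (arcs E {v\<in>A'. p v = i} {v\<in>A'. p v = i})) \<le>
         real (card A') ^ 2 - (\<Sum>i=1..q. real (card {v\<in>A'. p v = i}) ^ 2) + \<eta> / 2 * n ^ 2"
        using IH[OF A'(1) leA' _ fewA'] sym by blast
      define p' where "p' v = (if v \<in> A' then p v else Suc q)" for v
      have p'A: "p' ` A \<subseteq> {1..Suc q}" using p by (auto simp: p'_def image_subset_iff)
      have cls: "{v\<in>A. p' v = i} = {v\<in>A'. p v = i}" if "i \<in> {1..q}" for i
        using that A' by (auto simp: p'_def)
      have clsq: "{v\<in>A. p' v = Suc q} = V"
      proof -
        have "p v \<noteq> Suc q" if "v \<in> A'" for v
        proof -
          have "p v \<in> {1..q}" using p that by blast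
          then show ?thesis by simp
        qed
        then show ?thesis by (auto simp: p'_def V_def)
      qed
      \<comment> \<open>By maximality a non-exceptional vertex of \<open>V\<close> has degree at
        most \<open>deg x = card A'\<close>; an exceptional one has degree at most
        \<open>n\<close>.\<close>
      have degsum: "real (arcs E V A) \<le> real (card V) * real (card A') + \<sigma> * n * n"
      proof -
        have "real (deg v) \<le> real (card A') + of_bool (v \<in> B) * n" if "v \<in> V" for v
        proof (cases "v \<in> B")
          case True
          have "deg v \<le> card A" unfolding deg_def nbrs_def using A by (intro card_mono) auto
          then show ?thesis using True n by simp
        next
          case False
          then show ?thesis using max[of v] that V cA' by auto
        qed
        then have "real (arcs E V A) \<le> (\<Sum>v\<in>V. real (card A') + of_bool (v \<in> B) * n)"
          unfolding arcs_def of_nat_sum deg_def by (intro sum_mono) auto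
        also have "\<dots> = real (card V) * real (card A') + real (card (V \<inter> B)) * n"
          using V(1) by (simp add: sum.distrib flip: sum_distrib_right)
        also have "real (card (V \<inter> B)) * n \<le> \<sigma> * n * n"
        proof -
          have "card (V \<inter> B) \<le> card B" using B by (intro card_mono) auto
          then show ?thesis using Bcard n0 by (intro mult_right_mono) auto
        qed
        finally show ?thesis by simp
      qed
      have split1: "arcs E A A = arcs E V A + (arcs E V A' + arcs E A' A')"
        using arcs_Un_left[OF V(1) A'(1) V(4), of E A] arcs_Un_right[OF V(1) A'(1) V(4), of E A']
          arcs_commute[OF A'(1) V(1) sym] V(3) by simp
      have split2: "arcs E V A = arcs E V V + arcs E V A'"
        using arcs_Un_right[OF V(1) A'(1) V(4), of E V] V(3) by simp
      have cA: "real (card A) = real (card V) + real (card A')"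
        using card_Un_disjoint[OF V(1) A'(1) V(4)] V(3) by simp
      have sumE: "(\<Sum>i=1..Suc q. real (arcs E {v\<in>A. p' v = i} {v\<in>A. p' v = i})) =
          (\<Sum>i=1..q. real (arcs E {v\<in>A'. p v = i} {v\<in>A'. p v = i})) + real (arcs E V V)"
        using clsq cls by simp
      have sumC: "(\<Sum>i=1..Suc q. real (card {v\<in>A. p' v = i}) ^ 2) =
          (\<Sum>i=1..q. real (card {v\<in>A'. p v = i}) ^ 2) + real (card V) ^ 2"
        using clsq cls by simp
      \<comment> \<open>\<open>arcs E A A + arcs E V V = 2 * arcs E V A + arcs E A' A'\<close>,
        because pairs between \<open>V\<close> and \<open>A'\<close> occur in both orders.\<close>
      have "real (arcs E A A) + (\<Sum>i=1..Suc q. real (arcs E {v\<in>A. p' v = i} {v\<in>A. p' v = i}))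
          = 2 * real (arcs E V A) + (real (arcs E A' A') + (\<Sum>i=1..q. real (arcs E {v\<in>A'. p v = i} {v\<in>A'. p v = i})))"
        unfolding sumE using split1 split2 by linarith
      also have "\<dots> \<le> 2 * (real (card V) * real (card A') + \<sigma> * n * n) +
         (real (card A') ^ 2 - (\<Sum>i=1..q. real (card {v\<in>A'. p v = i}) ^ 2) + \<eta> / 2 * n ^ 2)"
        by (rule add_mono[OF mult_left_mono[OF degsum] pb]) simp
      also have "\<dots> = real (card A) ^ 2 - (\<Sum>i=1..Suc q. real (card {v\<in>A. p' v = i}) ^ 2) + \<eta> * n ^ 2"
      proof -
        have "2 * (v * a + \<eta> / 4 * n * n) + (a\<^sup>2 - s + \<eta> / 2 * n\<^sup>2) = (v + a)\<^sup>2 - (s + v\<^sup>2) + \<eta> * n\<^sup>2"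
          for v a s :: real by (simp add: power2_eq_square algebra_simps)
        then show ?thesis unfolding sumC cA \<sigma>_def .
      qed
      finally show ?thesis using p'A by (intro exI[of _ p'] conjI)
    qed
  qed
qed

section \<open>Binomial estimates\<close>

text \<open>Markov's inequality for the uniform distribution on subsets, with an exponential
  weight.\<close>

lemma card_le_exp_weight:
  fixes \<phi> :: "'a set \<Rightarrow> real"
  assumes "finite P" "\<And>B. B \<subseteq> P \<Longrightarrow> R B \<Longrightarrow> s \<le> \<phi> B"
  shows "real (card {B. B \<subseteq> P \<and> R B}) * exp s \<le> (\<Sum>B\<in>Pow P. exp (\<phi> B))"
proof -
  have "real (card {B. B \<subseteq> P \<and> R B}) * exp s = (\<Sum>B\<in>{B. B \<subseteq> P \<and> R B}. exp s)" by simp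
  also have "\<dots> \<le> (\<Sum>B\<in>{B. B \<subseteq> P \<and> R B}. exp (\<phi> B))" using assms by (intro sum_mono) auto
  also have "\<dots> \<le> (\<Sum>B\<in>Pow P. exp (\<phi> B))" using assms by (intro sum_mono2) auto
  finally show ?thesis .
qed

text \<open>Exponential moment with weight \<open>t ^ card B\<close>: the sum over all subsets
  factorises into \<open>(1 + t) ^ card P\<close>, which is at most
  \<open>exp (t * M)\<close>.\<close>

lemma card_small_subsets:
  assumes P: "finite P" "real (card P) \<le> M" and t: "0 < t" "t \<le> 1"
  shows "real (card {B. B \<subseteq> P \<and> real (card B) \<le> \<kappa> * M}) \<le> exp ((t - \<kappa> * ln t) * M)"
proof -
  have "real (card {B. B \<subseteq> P \<and> real (card B) \<le> \<kappa> * M}) * exp (\<kappa> * M * ln t) \<le> (\<Sum>B\<in>Pow P. exp (real (card B) * ln t))"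
    using t by (intro card_le_exp_weight P) (auto intro!: mult_right_mono_neg)
  also have "\<dots> = (\<Sum>B\<in>Pow P. (\<Prod>x\<in>B. t) * (\<Prod>x\<in>P - B. 1))"
    using t by (intro sum.cong) (auto simp: exp_of_nat_mult)
  also have "\<dots> = (\<Prod>x\<in>P. t + 1)" by (rule prod_add[OF P(1), symmetric])
  also have "\<dots> \<le> (\<Prod>x\<in>P. exp t)" using t by (intro prod_mono) (auto simp: add.commute)
  also have "\<dots> = exp (t * real (card P))" by (simp add: exp_of_nat_mult[symmetric] mult.commute)
  also have "\<dots> \<le> exp (t * M)" using P t by simp
  finally have "real (card {B. B \<subseteq> P \<and> real (card B) \<le> \<kappa> * M}) \<le> exp (t * M) / exp (\<kappa> * M * ln t)"
    by (simp add: pos_le_divide_eq)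
  also have "\<dots> = exp ((t - \<kappa> * ln t) * M)" by (simp add: exp_diff[symmetric] algebra_simps)
  finally show ?thesis .
qed

lemma small_subsets_rate:
  assumes "h > (0 :: real)"
  obtains \<kappa> where "\<kappa> > 0"
    "\<And>(P :: 'a set) M. finite P \<Longrightarrow> real (card P) \<le> M \<Longrightarrow>
       real (card {B. B \<subseteq> P \<and> real (card B) \<le> \<kappa> * M}) \<le> exp (h * M)"
proof -
  define t where "t = min 1 (h / 2)"
  have t: "0 < t" "t \<le> 1" "t \<le> h / 2" using assms by (auto simp: t_def)
  \<comment> \<open>Then \<open>\<kappa> * (1 - ln t) = h / 2\<close>; the summand 1 keeps the
    denominator positive when \<open>t = 1\<close>.\<close>
  define \<kappa> where "\<kappa> = h / (2 * (1 - ln t))"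
  have l: "1 - ln t > 0" using t ln_le_zero_iff[of t] by linarith
  have k: "\<kappa> > 0" using l assms by (simp add: \<kappa>_def)
  have "\<kappa> * (1 - ln t) = h / 2" using l by (simp add: \<kappa>_def field_simps)
  then have r: "t - \<kappa> * ln t \<le> h" using t k by (simp add: algebra_simps)
  show thesis
  proof (rule that[OF k])
    fix P :: "'a set" and M assume P: "finite P" "real (card P) \<le> M"
    then have "M \<ge> 0" by (meson of_nat_0_le_iff order_trans)
    then have "(t - \<kappa> * ln t) * M \<le> h * M" using r by (intro mult_right_mono)
    then show "real (card {B. B \<subseteq> P \<and> real (card B) \<le> \<kappa> * M}) \<le> exp (h * M)"
      using card_small_subsets[OF P t(1,2), of \<kappa>] by (meson exp_le_cancel_iff order_trans)
  qed
qed

lemma cosh_le_exp_sq: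
  fixes x :: real
  assumes "0 \<le> x" "x \<le> 1"
  shows "exp x + exp (- x) \<le> 2 * exp (x\<^sup>2)"
proof -
  have "(1 + x) * exp (- x) \<le> 1"
    using exp_ge_add_one_self[of x] by (simp add: exp_minus field_simps)
  \<comment> \<open>The product equals \<open>1 + x ^ 3\<close>.\<close>
  also have "1 \<le> (1 + x) * (1 - x + x\<^sup>2)"
    using assms by (simp add: algebra_simps power2_eq_square)
  finally have "exp (- x) \<le> 1 - x + x\<^sup>2" using assms by (simp add: mult_le_cancel_left)
  moreover have "exp x \<le> 1 + x + x\<^sup>2" by (rule exp_bound) (use assms in auto)
  moreover have "1 + x\<^sup>2 \<le> exp (x\<^sup>2)" by (rule exp_ge_add_one_self)
  ultimately show ?thesis by linarith
qed

text \<open>Exponential moment of the number of elements of \<open>Q\<close> in a uniformly random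
  subset of \<open>P\<close>. The elements are independent, so the sum is a product over
  \<open>P\<close> in which each element of \<open>Q\<close> contributes twice a hyperbolic
  cosine.\<close>

lemma sum_exp_deviation:
  assumes P: "finite P" "Q \<subseteq> P" and x: "0 \<le> x" "x \<le> (1 :: real)" and s: "s \<in> {1, -1}"
  shows "(\<Sum>B\<in>Pow P. exp (x * (s * (2 * real (card (B \<inter> Q)) - real (card Q))))) \<le> 2 ^ card P * exp (x\<^sup>2 * real (card Q))"
proof -
  define f where "f y = (if y \<in> Q then exp (s * x) else 1)" for y
  define g where "g y = (if y \<in> Q then exp (- s * x) else 1)" for y
  have Q: "finite Q" using P finite_subset by blast
  have "exp (x * (s * (2 * real (card (B \<inter> Q)) - real (card Q)))) = (\<Prod>y\<in>B. f y) * (\<Prod>y\<in>P - B. g y)" if "B \<subseteq> P" for B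
  proof -
    have B: "finite B" using that P finite_subset by blast
    have "(\<Prod>y\<in>B. f y) = (\<Prod>y\<in>B \<inter> Q. exp (s * x))"
      unfolding f_def using B by (subst prod.inter_restrict) auto
    moreover have "(\<Prod>y\<in>P - B. g y) = (\<Prod>y\<in>(P - B) \<inter> Q. exp (- s * x))"
      unfolding g_def using P by (subst prod.inter_restrict) auto
    moreover have "(P - B) \<inter> Q = Q - B \<inter> Q" using P by auto
    moreover have "real (card (Q - B \<inter> Q)) = real (card Q) - real (card (B \<inter> Q))"
      using Q by (subst card_Diff_subset) (auto simp: of_nat_diff card_mono)
    ultimately have "(\<Prod>y\<in>B. f y) * (\<Prod>y\<in>P - B. g y) =
        exp (real (card (B \<inter> Q)) * (s * x)) * exp ((real (card Q) - real (card (B \<inter> Q))) * (- s * x))"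
      by (simp flip: exp_of_nat_mult)
    also have "\<dots> = exp (x * (s * (2 * real (card (B \<inter> Q)) - real (card Q))))"
      by (simp add: exp_add[symmetric] algebra_simps)
    finally show ?thesis by simp
  qed
  then have "(\<Sum>B\<in>Pow P. exp (x * (s * (2 * real (card (B \<inter> Q)) - real (card Q))))) =
      (\<Sum>B\<in>Pow P. (\<Prod>y\<in>B. f y) * (\<Prod>y\<in>P - B. g y))" by (intro sum.cong) auto
  also have "\<dots> = (\<Prod>y\<in>P. f y + g y)" by (rule prod_add[OF P(1), symmetric])
  also have "\<dots> \<le> (\<Prod>y\<in>P. 2 * (if y \<in> Q then exp (x\<^sup>2) else 1))"
    using cosh_le_exp_sq[OF x] s by (intro prod_mono) (auto simp: f_def g_def add.commute intro: add_nonneg_nonneg)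
  also have "\<dots> = 2 ^ card P * (\<Prod>y\<in>P. if y \<in> Q then exp (x\<^sup>2) else 1)"
    by (simp add: prod.distrib)
  also have "(\<Prod>y\<in>P. if y \<in> Q then exp (x\<^sup>2) else 1) = (\<Prod>y\<in>P \<inter> Q. exp (x\<^sup>2))"
    using P by (subst prod.inter_restrict) auto
  also have "\<dots> = exp (x\<^sup>2 * real (card Q))"
    using P by (simp add: Int_absorb1 exp_of_nat_mult[symmetric] mult.commute)
  finally show ?thesis .
qed

text \<open>Chernoff bound with parameter \<open>x = \<epsilon>\<close> for both signs of the
  deviation: the moment gives \<open>\<epsilon>\<^sup>2 * M\<close>, the threshold takes away
  \<open>2 * \<epsilon>\<^sup>2 * M\<close>.\<close>

lemma card_deviating_subsets:
  assumes P: "finite P" "Q \<subseteq> P" and M: "real (card Q) \<le> M" and e: "0 \<le> \<epsilon>" "\<epsilon> \<le> 1"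
  shows "real (card {B. B \<subseteq> P \<and> \<bar>real (card (B \<inter> Q)) - real (card Q) / 2\<bar> > \<epsilon> * M}) \<le> 2 * (2 ^ card P * exp (- \<epsilon>\<^sup>2 * M))"
proof -
  define D where "D s = {B. B \<subseteq> P \<and> s * (2 * real (card (B \<inter> Q)) - real (card Q)) \<ge> 2 * \<epsilon> * M}" for s
  have D: "real (card (D s)) \<le> 2 ^ card P * exp (- \<epsilon>\<^sup>2 * M)" if s: "s \<in> {1, - 1}" for s
  proof -
    have "real (card (D s)) * exp (\<epsilon> * (2 * \<epsilon> * M)) \<le> (\<Sum>B\<in>Pow P. exp (\<epsilon> * (s * (2 * real (card (B \<inter> Q)) - real (card Q)))))"
      unfolding D_def by (rule card_le_exp_weight[OF P(1)]) (rule mult_left_mono[OF _ e(1)])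
    also have "\<dots> \<le> 2 ^ card P * exp (\<epsilon>\<^sup>2 * real (card Q))" by (rule sum_exp_deviation[OF P e s])
    also have "\<dots> \<le> 2 ^ card P * exp (\<epsilon>\<^sup>2 * M)" using M by (simp add: mult_left_mono)
    finally have "real (card (D s)) \<le> 2 ^ card P * (exp (\<epsilon>\<^sup>2 * M) / exp (\<epsilon> * (2 * \<epsilon> * M)))"
      by (simp add: pos_le_divide_eq)
    also have "exp (\<epsilon>\<^sup>2 * M) / exp (\<epsilon> * (2 * \<epsilon> * M)) = exp (- \<epsilon>\<^sup>2 * M)"
      by (simp add: exp_diff[symmetric] power2_eq_square algebra_simps)
    finally show ?thesis .
  qed
  have fin: "finite (D s)" for s
    unfolding D_def by (rule finite_subset[of _ "Pow P"]) (use P in auto)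
  have "card {B. B \<subseteq> P \<and> \<bar>real (card (B \<inter> Q)) - real (card Q) / 2\<bar> > \<epsilon> * M} \<le> card (D 1 \<union> D (- 1))"
  proof (rule card_mono)
    show "finite (D 1 \<union> D (- 1))" by (simp add: fin)
  qed (auto simp: D_def abs_if split: if_splits)
  also have "\<dots> \<le> card (D 1) + card (D (- 1))" by (rule card_Un_le)
  finally have "real (card {B. B \<subseteq> P \<and> \<bar>real (card (B \<inter> Q)) - real (card Q) / 2\<bar> > \<epsilon> * M}) \<le> real (card (D 1)) + real (card (D (- 1)))"
    by linarith
  then show ?thesis using D[of 1] D[of "- 1"] by simp
qed

lemma card_le_split:
  assumes inj: "\<And>G. G \<in> F \<Longrightarrow> G \<inter> P \<in> X \<and> G - P \<in> Y" and fin: "finite X" "finite Y"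
  shows "card F \<le> card X * card Y"
proof -
  have "inj_on (\<lambda>G. (G \<inter> P, G - P)) F"
  proof (rule inj_onI)
    fix G H assume "(G \<inter> P, G - P) = (H \<inter> P, H - P)"
    then show "G = H" by (metis Int_Diff_Un Pair_inject)
  qed
  moreover have "(\<lambda>G. (G \<inter> P, G - P)) ` F \<subseteq> X \<times> Y" using inj by auto
  ultimately have "card F \<le> card (X \<times> Y)" using fin by (intro card_inj_on_le) auto
  then show ?thesis by (simp add: card_cartesian_product)
qed

section \<open>Graphs, colourings and the partition function\<close>

definition all_edges :: "nat \<Rightarrow> nat set set" where
  "all_edges n = {e. e \<subseteq> {1..n} \<and> card e = 2}"

lemma graphs_eq: "graphs n = Pow (all_edges n)"
  by (simp add: graphs_def all_edges_def)

lemma finite_all_edges: "finite (all_edges n)"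
  unfolding all_edges_def by (rule finite_subset[of _ "Pow {1..n}"]) auto

lemma finite_graphs: "finite (graphs n)"
  by (simp add: graphs_eq finite_all_edges)

abbreviation adj :: "graph \<Rightarrow> nat \<Rightarrow> nat \<Rightarrow> bool" where
  "adj G u v \<equiv> {u, v} \<in> G"

lemma adj_sym: "adj G u v = adj G v u"
  by (simp add: insert_commute)

lemma adj_imp_neq: "G \<in> graphs n \<Longrightarrow> adj G u v \<Longrightarrow> u \<noteq> v"
  by (auto simp: graphs_eq all_edges_def)

lemma arcs_eq_card:
  assumes "finite A" "finite B"
  shows "arcs E A B = card {(u, v). u \<in> A \<and> v \<in> B \<and> E u v}"
proof -
  have "{(u, v). u \<in> A \<and> v \<in> B \<and> E u v} = (SIGMA u:A. {v\<in>B. E u v})" by auto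
  then show ?thesis using assms by (simp add: arcs_def nbrs_def card_SigmaI)
qed

lemma card_disjoint_edges:
  assumes "A \<inter> B = {}"
  shows "card {e. \<exists>a\<in>A. \<exists>b\<in>B. e = {a, b} \<and> D a b} = card {(u, v). u \<in> A \<and> v \<in> B \<and> D u v}"
proof -
  have "{e. \<exists>a\<in>A. \<exists>b\<in>B. e = {a, b} \<and> D a b} = (\<lambda>(u, v). {u, v}) ` {(u, v). u \<in> A \<and> v \<in> B \<and> D u v}"
    by (auto simp: image_iff)
  moreover have "inj_on (\<lambda>(u, v). {u, v}) {(u, v). u \<in> A \<and> v \<in> B \<and> D u v}"
    using assms by (auto simp: inj_on_def doubleton_eq_iff)
  ultimately show ?thesis by (simp add: card_image)
qed

lemma edges_between_eq_arcs:
  assumes "A \<inter> B = {}" "finite A" "finite B"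
  shows "edges_between G A B = arcs (adj G) A B"
proof -
  have "{e \<in> G. \<exists>a\<in>A. \<exists>b\<in>B. e = {a, b}} = {e. \<exists>a\<in>A. \<exists>b\<in>B. e = {a, b} \<and> {a, b} \<in> G}" by auto
  then show ?thesis
    using card_disjoint_edges[OF assms(1), of "adj G"] assms by (simp add: edges_between_def arcs_eq_card)
qed

definition edge_set :: "(nat \<Rightarrow> nat \<Rightarrow> bool) \<Rightarrow> nat set \<Rightarrow> nat set set" where
  "edge_set D V = {e. \<exists>u\<in>V. \<exists>v\<in>V. u \<noteq> v \<and> e = {u, v} \<and> D u v}"

lemma edge_set_subset: "V \<subseteq> {1..n} \<Longrightarrow> edge_set D V \<subseteq> all_edges n"
  by (auto simp: edge_set_def all_edges_def)

lemma finite_edge_set: "finite V \<Longrightarrow> finite (edge_set D V)"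
  by (rule finite_subset[of _ "Pow V"]) (auto simp: edge_set_def)

lemma edge_set_mem:
  assumes "\<And>u v. D u v = D v u" "u \<in> V" "v \<in> V" "u \<noteq> v"
  shows "{u, v} \<in> edge_set D V \<longleftrightarrow> D u v"
  using assms by (auto simp: edge_set_def doubleton_eq_iff)

lemma card_edge_set:
  assumes V: "finite V" and sym: "\<And>u v. D u v = D v u"
  shows "2 * card (edge_set D V) = arcs (\<lambda>u v. u \<noteq> v \<and> D u v) V V"
proof -
  define L where "L = {(u, v). u \<in> V \<and> v \<in> V \<and> u < v \<and> D u v}"
  define R where "R = {(u, v). u \<in> V \<and> v \<in> V \<and> v < u \<and> D u v}"
  have fin: "finite L" "finite R"
    by (rule finite_subset[of _ "V \<times> V"]; use V in \<open>auto simp: L_def R_def\<close>)+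
  have "edge_set D V = (\<lambda>(u, v). {u, v}) ` L"
  proof (intro equalityI subsetI)
    fix e assume "e \<in> edge_set D V"
    then obtain u v where uv: "u \<in> V" "v \<in> V" "u \<noteq> v" "e = {u, v}" "D u v" by (auto simp: edge_set_def)
    show "e \<in> (\<lambda>(u, v). {u, v}) ` L"
    proof (cases "u < v")
      case True
      then show ?thesis using uv by (intro image_eqI[of _ _ "(u, v)"]) (auto simp: L_def)
    next
      case False
      then show ?thesis using uv sym[of u v] by (intro image_eqI[of _ _ "(v, u)"]) (auto simp: L_def)
    qed
  next
    fix e assume "e \<in> (\<lambda>(u, v). {u, v}) ` L"
    then obtain u v where "u \<in> V" "v \<in> V" "u < v" "D u v" "e = {u, v}" by (auto simp: L_def)
    moreover from this have "u \<noteq> v" by simp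
    ultimately show "e \<in> edge_set D V" unfolding edge_set_def by blast
  qed
  moreover have "inj_on (\<lambda>(u, v). {u, v}) L"
    by (auto simp: inj_on_def doubleton_eq_iff L_def)
  ultimately have cL: "card (edge_set D V) = card L" by (simp add: card_image)
  have "R = prod.swap ` L"
    using sym by (auto simp: L_def R_def image_iff)
  then have cR: "card R = card L" by (simp add: card_image)
  have "{(u, v). u \<in> V \<and> v \<in> V \<and> u \<noteq> v \<and> D u v} = L \<union> R" "L \<inter> R = {}"
    by (auto simp: L_def R_def)
  then have "arcs (\<lambda>u v. u \<noteq> v \<and> D u v) V V = card L + card R"
    using V fin by (simp add: arcs_eq_card card_Un_disjoint)
  then show ?thesis using cL cR by simp
qed

lemma edge_set_adj:
  assumes "G \<in> graphs n"
  shows "edge_set (adj G) A = {e \<in> G. e \<subseteq> A}"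
proof (intro equalityI subsetI)
  fix e assume "e \<in> {e \<in> G. e \<subseteq> A}"
  moreover from this assms have "card e = 2" by (auto simp: graphs_eq all_edges_def)
  ultimately show "e \<in> edge_set (adj G) A" by (auto simp: card_2_iff edge_set_def)
qed (auto simp: edge_set_def)

lemma edges_in_eq_arcs:
  assumes "G \<in> graphs n" "finite A"
  shows "2 * edges_in G A = arcs (adj G) A A"
proof -
  have "(u \<noteq> v \<and> adj G u v) = adj G u v" for u v using adj_imp_neq[OF assms(1)] by blast
  then show ?thesis
    using card_edge_set[OF assms(2), of "adj G"] adj_sym[of _ _ G] edge_set_adj[OF assms(1), of A]
    by (simp add: edges_in_def)
qed

lemma card_all_edges: "real (card (all_edges n)) \<le> real n ^ 2"
proof -
  have "all_edges n = edge_set (\<lambda>_ _. True) {1..n}"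
    by (auto simp: all_edges_def edge_set_def card_2_iff)
  then have "2 * card (all_edges n) = arcs (\<lambda>u v. u \<noteq> v \<and> True) {1..n} {1..n}"
    using card_edge_set[of "{1..n}" "\<lambda>_ _. True"] by simp
  also have "\<dots> \<le> n * n" using arcs_le[of "{1..n}" "{1..n}"] by simp
  finally have "card (all_edges n) \<le> n * n" by simp
  then show ?thesis by (metis of_nat_le_iff of_nat_power power2_eq_square)
qed

text \<open>Without loops the entries of a tuple are distinct and span an \<open>r\<close>-clique.
  All maps into this clique are counted, so \<open>r ^ r\<close> is a crude substitute for
  \<open>fact r\<close> that affects constants only.\<close>

lemma card_cliques_le_clique_count:
  assumes G: "G \<in> graphs n"
  shows "card (cliques (adj G) r {1..n}) \<le> r ^ r * clique_count n r G"
proof -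
  define K where "K = {S. S \<subseteq> {1..n} \<and> card S = r \<and> (\<forall>u\<in>S. \<forall>v\<in>S. u \<noteq> v \<longrightarrow> {u, v} \<in> G)}"
  have finK: "finite K" unfolding K_def by (rule finite_subset[of _ "Pow {1..n}"]) auto
  have finS: "finite S" if "S \<in> K" for S using that finite_subset[of S "{1..n}"] by (auto simp: K_def)
  have "cliques (adj G) r {1..n} \<subseteq> (\<Union>S\<in>K. PiE {..<r} (\<lambda>_. S))"
  proof
    fix x assume x: "x \<in> cliques (adj G) r {1..n}"
    have adj: "adj G (x i) (x j)" if "i < r" "j < r" "i \<noteq> j" for i j
      using x that adj_sym[of "x i" "x j" G] by (cases "j < i") (auto simp: cliques_def)
    have "inj_on x {..<r}"
      using adj adj_imp_neq[OF G] by (auto simp: inj_on_def)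
    then have "card (x ` {..<r}) = r" by (simp add: card_image)
    then have "x ` {..<r} \<in> K"
      using x adj by (auto simp: K_def cliques_def PiE_def Pi_iff)
    moreover have "x \<in> PiE {..<r} (\<lambda>_. x ` {..<r})" using x by (auto simp: cliques_def PiE_def)
    ultimately show "x \<in> (\<Union>S\<in>K. PiE {..<r} (\<lambda>_. S))" by blast
  qed
  then have "card (cliques (adj G) r {1..n}) \<le> card (\<Union>S\<in>K. PiE {..<r} (\<lambda>_. S))"
    using finK finS by (intro card_mono) (auto intro!: finite_PiE)
  also have "\<dots> \<le> (\<Sum>S\<in>K. card (PiE {..<r} (\<lambda>_. S)))" by (rule card_UN_le[OF finK])
  also have "\<dots> = (\<Sum>S\<in>K. r ^ r)" by (intro sum.cong refl) (auto simp: K_def card_PiE)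
  also have "\<dots> = r ^ r * clique_count n r G" by (simp add: K_def clique_count_def)
  finally show ?thesis .
qed

section \<open>Colourings and complete multipartite graphs\<close>

definition color_class :: "nat \<Rightarrow> (nat \<Rightarrow> nat) \<Rightarrow> nat \<Rightarrow> nat set" where
  "color_class n p i = {v\<in>{1..n}. p v = i}"

lemma finite_color_class [simp]: "finite (color_class n p i)"
  by (simp add: color_class_def)

abbreviation inner_arcs :: "nat \<Rightarrow> nat \<Rightarrow> (nat \<Rightarrow> nat) \<Rightarrow> (nat \<Rightarrow> nat \<Rightarrow> bool) \<Rightarrow> real" where
  "inner_arcs n q p E \<equiv> (\<Sum>i=1..q. real (arcs E (color_class n p i) (color_class n p i)))"

abbreviation imbalance :: "nat \<Rightarrow> nat \<Rightarrow> (nat \<Rightarrow> nat) \<Rightarrow> real" where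
  "imbalance n q p \<equiv> (\<Sum>i=1..q. (real (card (color_class n p i)) - real n / real q) ^ 2)"

text \<open>The complete multipartite graph whose parts are the classes of \<open>p\<close>.\<close>

definition cross :: "nat \<Rightarrow> (nat \<Rightarrow> nat) \<Rightarrow> nat set set" where
  "cross n p = edge_set (\<lambda>u v. p u \<noteq> p v) {1..n}"

lemma sum_card_color_class:
  assumes "p ` {1..n} \<subseteq> {1..q}"
  shows "(\<Sum>i=1..q. card (color_class n p i)) = n"
proof -
  have "(\<Sum>i=1..q. card (color_class n p i)) = card (\<Union>i\<in>{1..q}. color_class n p i)"
    by (rule card_UN_disjoint[symmetric]) (auto simp: color_class_def)
  also have "(\<Union>i\<in>{1..q}. color_class n p i) = {1..n}"
    using assms by (auto simp: color_class_def)
  finally show ?thesis by simp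
qed

lemma card_cross:
  assumes "p ` {1..n} \<subseteq> {1..q}"
  shows "2 * real (card (cross n p)) = real n ^ 2 - (\<Sum>i=1..q. real (card (color_class n p i)) ^ 2)"
proof -
  have "2 * card (cross n p) = arcs (\<lambda>u v. u \<noteq> v \<and> p u \<noteq> p v) {1..n} {1..n}"
    unfolding cross_def by (rule card_edge_set) auto
  also have "(\<lambda>u v. u \<noteq> v \<and> p u \<noteq> p v) = (\<lambda>u v. p u \<noteq> p v)" by auto
  finally have 1: "2 * card (cross n p) = (\<Sum>u\<in>{1..n}. card {v\<in>{1..n}. p u \<noteq> p v})"
    by (simp add: arcs_def nbrs_def)
  have 2: "real (card {v\<in>{1..n}. p u \<noteq> p v}) = real n - real (card (color_class n p (p u)))" for u
  proof -
    have "{v\<in>{1..n}. p u \<noteq> p v} = {1..n} - color_class n p (p u)" by (auto simp: color_class_def)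
    moreover have "color_class n p (p u) \<subseteq> {1..n}" by (auto simp: color_class_def)
    moreover from this have "card (color_class n p (p u)) \<le> card {1..n}" by (intro card_mono) auto
    ultimately show ?thesis by (simp add: card_Diff_subset of_nat_diff)
  qed
  have "(\<Sum>u\<in>{1..n}. real (card (color_class n p (p u)))) =
      (\<Sum>u\<in>(\<Union>i\<in>{1..q}. color_class n p i). real (card (color_class n p (p u))))"
    using assms by (intro sum.cong) (auto simp: color_class_def)
  also have "\<dots> = (\<Sum>i=1..q. \<Sum>u\<in>color_class n p i. real (card (color_class n p (p u))))"
    by (rule sum.UNION_disjoint) (auto simp: color_class_def)
  also have "\<dots> = (\<Sum>i=1..q. \<Sum>u\<in>color_class n p i. real (card (color_class n p i)))"
    by (intro sum.cong) (auto simp: color_class_def)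
  finally have 3: "(\<Sum>u\<in>{1..n}. real (card (color_class n p (p u)))) = (\<Sum>i=1..q. real (card (color_class n p i)) ^ 2)"
    by (simp add: power2_eq_square)
  have "2 * real (card (cross n p)) = (\<Sum>u\<in>{1..n}. real (card {v\<in>{1..n}. p u \<noteq> p v}))"
    using arg_cong[OF 1, of real] by simp
  then show ?thesis unfolding 2 sum_subtractf 3 by (simp add: power2_eq_square)
qed

text \<open>Variance identity. Together with \<open>card_cross\<close> it shows that
  \<open>imbalance\<close> is exactly twice the number of edges by which \<open>cross n p\<close>
  falls short of \<open>(1 - 1 / q) * n ^ 2 / 2\<close>.\<close>

lemma sum_sq_color_class:
  assumes "p ` {1..n} \<subseteq> {1..q}" "q \<ge> 1"
  shows "(\<Sum>i=1..q. real (card (color_class n p i)) ^ 2) =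
    real n ^ 2 / real q + imbalance n q p"
proof -
  have s: "(\<Sum>i=1..q. real (card (color_class n p i))) = real n"
    using arg_cong[OF sum_card_color_class[OF assms(1)], of real] by simp
  have "imbalance n q p =
    (\<Sum>i=1..q. real (card (color_class n p i)) ^ 2 - 2 * (real n / real q) * real (card (color_class n p i)) + (real n / real q) ^ 2)"
    by (intro sum.cong) (auto simp: power2_diff)
  also have "\<dots> = (\<Sum>i=1..q. real (card (color_class n p i)) ^ 2) - 2 * (real n / real q) * real n + real q * (real n / real q) ^ 2"
    unfolding sum.distrib sum_subtractf sum_distrib_left[symmetric] s by simp
  also have "\<dots> = (\<Sum>i=1..q. real (card (color_class n p i)) ^ 2) - real n ^ 2 / real q"
    using assms(2) by (simp add: power2_eq_square field_simps)
  finally show ?thesis by simp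
qed

lemma card_cross_le:
  assumes "p ` {1..n} \<subseteq> {1..q}" "q \<ge> 1"
  shows "real (card (cross n p)) \<le> (1 - 1 / real q) / 2 * real n ^ 2"
proof -
  have "0 \<le> imbalance n q p" by (intro sum_nonneg) auto
  then show ?thesis using card_cross[OF assms(1)] sum_sq_color_class[OF assms] by (simp add: algebra_simps)
qed

text \<open>Colour by residues modulo \<open>q\<close>: the quotients \<open>v div q\<close>
  separate the elements of a class and lie in \<open>{..n div q}\<close>, so no class exceeds
  \<open>n / q + 1\<close>.\<close>

lemma balanced_coloring:
  assumes "q \<ge> 1"
  shows "\<exists>p. p ` {1..n} \<subseteq> {1..q} \<and> real (card (cross n p)) \<ge> (1 - 1 / real q) / 2 * real n ^ 2 - real n"
proof (intro exI conjI)
  define p where "p v = v mod q + 1" for v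
  show im: "p ` {1..n} \<subseteq> {1..q}" using assms by (auto simp: p_def Suc_le_eq)
  have c: "real (card (color_class n p i)) \<le> real n / real q + 1" for i
  proof -
    have "inj_on (\<lambda>v. v div q) (color_class n p i)"
    proof (rule inj_onI)
      fix u v assume "u \<in> color_class n p i" "v \<in> color_class n p i" "u div q = v div q"
      then have "u mod q = v mod q" "u div q = v div q" by (auto simp: color_class_def p_def)
      then show "u = v" by (metis div_mult_mod_eq)
    qed
    moreover have "(\<lambda>v. v div q) ` color_class n p i \<subseteq> {..n div q}"
      by (auto simp: color_class_def div_le_mono)
    ultimately have "card (color_class n p i) \<le> card {..n div q}" by (intro card_inj_on_le) auto
    then have "real (card (color_class n p i)) \<le> real (n div q) + 1" by simp
    also have "real (n div q) \<le> real n / real q" by (rule of_nat_div_le_of_nat)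
    finally show ?thesis by simp
  qed
  have "(\<Sum>i=1..q. real (card (color_class n p i)) ^ 2) \<le> (\<Sum>i=1..q. real (card (color_class n p i)) * (real n / real q + 1))"
    unfolding power2_eq_square by (intro sum_mono mult_left_mono c) auto
  also have "\<dots> = real n * (real n / real q + 1)"
    using arg_cong[OF sum_card_color_class[OF im], of real] by (simp flip: sum_distrib_right)
  finally have "2 * real (card (cross n p)) \<ge> real n ^ 2 - real n * (real n / real q + 1)"
    using card_cross[OF im] by linarith
  then show "real (card (cross n p)) \<ge> (1 - 1 / real q) / 2 * real n ^ 2 - real n"
    by (simp add: algebra_simps power2_eq_square)
qed

text \<open>Pigeonhole: \<open>p\<close> is injective on every clique of a subgraph of
  \<open>cross n p\<close>.\<close>

lemma clique_count_partite:
  assumes p: "p ` {1..n} \<subseteq> {1..q}" and G: "G \<subseteq> cross n p" and k: "k > q"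
  shows "clique_count n k G = 0"
proof -
  have "\<not> (S \<subseteq> {1..n} \<and> card S = k \<and> (\<forall>u\<in>S. \<forall>v\<in>S. u \<noteq> v \<longrightarrow> {u, v} \<in> G))" for S
  proof
    assume S: "S \<subseteq> {1..n} \<and> card S = k \<and> (\<forall>u\<in>S. \<forall>v\<in>S. u \<noteq> v \<longrightarrow> {u, v} \<in> G)"
    have "p u \<noteq> p v" if "u \<in> S" "v \<in> S" "u \<noteq> v" for u v
    proof -
      have "{u, v} \<in> cross n p" using S that G by blast
      then show ?thesis by (auto simp: cross_def edge_set_def doubleton_eq_iff)
    qed
    then have "inj_on p S" by (auto simp: inj_on_def)
    moreover have "p ` S \<subseteq> {1..q}" using S p by blast
    ultimately have "card S \<le> card {1..q}" by (intro card_inj_on_le) auto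
    then show False using S k by simp
  qed
  then have "{S. S \<subseteq> {1..n} \<and> card S = k \<and> (\<forall>u\<in>S. \<forall>v\<in>S. u \<noteq> v \<longrightarrow> {u, v} \<in> G)} = {}" by auto
  then show ?thesis unfolding clique_count_def by simp
qed

section \<open>Masses and the partition function\<close>

lemma min_index:
  assumes "weight_vector l w"
  shows "min_index l w \<in> {3..l}" "w (min_index l w) > 0"
proof -
  have "min_index l w \<in> {k \<in> {3..l}. w k > 0}"
    unfolding min_index_def by (rule Min_in) (use assms in \<open>auto simp: weight_vector_def\<close>)
  then show "min_index l w \<in> {3..l}" "w (min_index l w) > 0" by auto
qed

text \<open>All summands of the exponent are nonnegative, so only the one for \<open>k = r\<close>
  is kept. Every later upper bound on the mass goes through this estimate, which is why
  \<open>l\<close> and the weights beyond \<open>r\<close> leave no trace in the constants.\<close>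

lemma mc_mass_le:
  assumes w: "weight_vector l w" and r: "r = min_index l w"
  shows "mc_mass l w n G \<le> exp (- w r * real (clique_count n r G))"
proof -
  have rl: "r \<in> {3..l}" "w r > 0" using min_index[OF w] r by auto
  have "w r * real (clique_count n r G) \<le> fact r * w r * real (clique_count n r G)"
    using rl by (intro mult_right_mono) (auto intro: mult_right_mono[of 1 "fact r" "w r", simplified])
  also have "\<dots> \<le> (\<Sum>k=r..l. fact k * w k * real (clique_count n k G))"
    using rl w by (intro member_le_sum) (auto simp: weight_vector_def)
  finally show ?thesis using r by (simp add: mc_mass_def)
qed

lemma mc_mass_le_1:
  assumes w: "weight_vector l w"
  shows "mc_mass l w n G \<le> 1"
proof -
  have "- w (min_index l w) * real (clique_count n (min_index l w) G) \<le> 0"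
    using min_index[OF w] by (simp add: mult_nonneg_nonneg)
  then show ?thesis
    using mc_mass_le[OF w refl, of n G] by (meson exp_le_one_iff order_trans)
qed

lemma mc_mass_pos: "mc_mass l w n G > 0"
  by (simp add: mc_mass_def)

text \<open>The subgraphs of a balanced complete \<open>q\<close>-partite graph contain no
  \<open>K_k\<close> with \<open>k > q\<close>, so each has mass exactly 1, whatever the weights
  are.\<close>

lemma mc_Z_ge_partite:
  assumes w: "weight_vector l w" and q: "q = min_index l w - 1"
  shows "mc_Z l w n \<ge> exp (ln 2 * ((1 - 1 / real q) / 2 * real n ^ 2 - real n))"
proof -
  have r: "min_index l w \<ge> 3" using min_index[OF w] by auto
  then have "q \<ge> 1" using q by simp
  then obtain p where p: "p ` {1..n} \<subseteq> {1..q}" and c: "real (card (cross n p)) \<ge> (1 - 1 / real q) / 2 * real n ^ 2 - real n"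
    using balanced_coloring by blast
  have sub: "cross n p \<subseteq> all_edges n" unfolding cross_def by (rule edge_set_subset) simp
  have mass: "mc_mass l w n G = 1" if "G \<in> Pow (cross n p)" for G
  proof -
    have "clique_count n k G = 0" if "k \<in> {min_index l w..l}" for k
      using \<open>G \<in> Pow (cross n p)\<close> that q r by (intro clique_count_partite[OF p]) auto
    then show ?thesis unfolding mc_mass_def by (subst sum.neutral) auto
  qed
  have "exp (ln 2 * ((1 - 1 / real q) / 2 * real n ^ 2 - real n)) \<le> exp (ln 2 * real (card (cross n p)))"
    using c by simp
  also have "\<dots> = 2 ^ card (cross n p)" by (simp add: exp_of_nat2_mult)
  also have "\<dots> = (\<Sum>G\<in>Pow (cross n p). mc_mass l w n G)"
    using finite_subset[OF sub finite_all_edges] by (simp add: mass card_Pow)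
  also have "\<dots> \<le> mc_Z l w n"
    unfolding mc_Z_def by (rule sum_mono2) (use sub in \<open>auto simp: finite_graphs graphs_eq[of n] finite_all_edges intro: less_imp_le mc_mass_pos\<close>)
  finally show ?thesis .
qed

lemma mc_Z_pos: "mc_Z l w n > 0"
  unfolding mc_Z_def by (rule sum_pos) (auto simp: mc_mass_pos graphs_eq finite_all_edges)

section \<open>Counting graphs with few cliques\<close>

text \<open>Absorbs the exp(O(n)) factors of union bounds into a small part of the exponential
  rate.\<close>

lemma linear_le_quadratic:
  fixes b C :: real
  assumes "b > 0" "C \<ge> 0"
  obtains N where "N \<ge> 1" "\<And>n. n \<ge> N \<Longrightarrow> C * (real n + 1) \<le> b * real n ^ 2"
proof -
  define N where "N = nat \<lceil>2 * C / b\<rceil> + 1"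
  show thesis
  proof (rule that[of N])
    fix n assume n: "n \<ge> N"
    then have n1: "real n \<ge> 1" by (simp add: N_def)
    have "2 * C / b \<le> real n" using n unfolding N_def by linarith
    then have "2 * C \<le> b * real n" using assms by (simp add: field_simps)
    then have "2 * C * real n \<le> b * real n * real n" by (rule mult_right_mono) simp
    moreover have "C * (real n + 1) \<le> C * (2 * real n)" using n1 assms by (intro mult_left_mono) auto
    ultimately show "C * (real n + 1) \<le> b * real n ^ 2" by (simp add: power2_eq_square algebra_simps)
  qed (simp add: N_def)
qed

lemma arcs_eq_sum:
  "finite B \<Longrightarrow> real (arcs E A B) = (\<Sum>u\<in>A. \<Sum>v\<in>B. of_bool (E u v))"
  by (simp add: arcs_def nbrs_def Int_def)

lemma arcs_mono:
  assumes "finite A" "finite B" "\<And>u v. u \<in> A \<Longrightarrow> v \<in> B \<Longrightarrow> E u v \<Longrightarrow> D u v"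
  shows "arcs E A B \<le> arcs D A B"
  unfolding arcs_def nbrs_def using assms by (intro sum_mono card_mono) auto

lemma hom_sum_of_bool:
  assumes "finite V"
  shows "hom_sum r V (\<lambda>_ x y. of_bool (E x y)) = real (card (cliques E r V))"
proof -
  have "(\<Prod>p\<in>index_pairs r. of_bool (E (x (fst p)) (x (snd p)))) = (of_bool (\<forall>i<r. \<forall>j<i. E (x i) (x j)) :: real)" for x
  proof (cases "\<forall>i<r. \<forall>j<i. E (x i) (x j)")
    case True
    then show ?thesis by (auto simp: index_pairs_def intro!: prod.neutral)
  next
    case False
    then obtain i j where "i < r" "j < i" "\<not> E (x i) (x j)" by blast
    then have "\<exists>p\<in>index_pairs r. (of_bool (E (x (fst p)) (x (snd p))) :: real) = 0"
      by (intro bexI[of _ "(i, j)"]) (auto simp: index_pairs_def)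
    then have "(\<Prod>p\<in>index_pairs r. of_bool (E (x (fst p)) (x (snd p)))) = (0 :: real)"
      by (rule prod_zero[OF finite_index_pairs])
    moreover have "of_bool (\<forall>i<r. \<forall>j<i. E (x i) (x j)) = (0 :: real)" using False by simp
    ultimately show ?thesis by (simp only:)
  qed
  then have "hom_sum r V (\<lambda>_ x y. of_bool (E x y)) = (\<Sum>x\<in>PiE {..<r} (\<lambda>_. V). of_bool (\<forall>i<r. \<forall>j<i. E (x i) (x j)))"
    by (simp add: hom_sum_def)
  also have "\<dots> = real (card (cliques E r V))"
    using finite_PiE[of "{..<r}" "\<lambda>_. V"] assms by (simp add: cliques_def Int_def)
  finally show ?thesis .
qed

text \<open>Every clique of the thresholded graph contributes at least a factor
  \<open>\<gamma>\<close> per edge of \<open>K_r\<close>.\<close>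

lemma hom_sum_threshold_ge:
  assumes "finite V" "\<gamma> > 0" "\<And>x y. 0 \<le> g x y"
  shows "\<gamma> ^ card (index_pairs r) * real (card (cliques (\<lambda>x y. \<gamma> \<le> g x y) r V)) \<le> hom_sum r V (\<lambda>_. g)"
proof -
  let ?C = "cliques (\<lambda>x y. \<gamma> \<le> g x y) r V"
  have fin: "finite (PiE {..<r} (\<lambda>_. V))" using assms(1) by (intro finite_PiE) auto
  have "\<gamma> ^ card (index_pairs r) * real (card ?C) = (\<Sum>x\<in>?C. \<Prod>p\<in>index_pairs r. \<gamma>)" by simp
  also have "\<dots> \<le> (\<Sum>x\<in>?C. \<Prod>p\<in>index_pairs r. g (x (fst p)) (x (snd p)))"
    using assms by (intro sum_mono prod_mono) (auto simp: cliques_def index_pairs_def)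
  also have "\<dots> \<le> hom_sum r V (\<lambda>_. g)"
    unfolding hom_sum_def using fin assms
    by (intro sum_mono2) (auto simp: cliques_def intro!: prod_nonneg)
  finally show ?thesis .
qed

text \<open>Colourings are extensional functions, so that only \<open>q ^ n\<close> of them enter
  the union bounds over \<open>p\<close>.\<close>

definition almost_partite :: "nat \<Rightarrow> nat \<Rightarrow> real \<Rightarrow> (nat \<Rightarrow> nat) \<Rightarrow> graph \<Rightarrow> bool" where
  "almost_partite n q \<kappa> p G \<longleftrightarrow> p \<in> PiE {1..n} (\<lambda>_. {1..q}) \<and>
     imbalance n q p \<le> \<kappa> * real n ^ 2 \<and>
     inner_arcs n q p (adj G) \<le> \<kappa> * real n ^ 2"

definition few_cliques :: "nat \<Rightarrow> nat \<Rightarrow> real \<Rightarrow> graph \<Rightarrow> bool" where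
  "few_cliques n r \<delta> G \<longleftrightarrow> real (card (cliques (adj G) r {1..n})) \<le> \<delta> * real n ^ r"

text \<open>A graph cut-close to an approximant \<open>g\<close> lies, up to few edges, in the graph
  \<open>{g \<ge> \<gamma>}\<close>, which inherits having few cliques. By stability such a container is either too
  sparse to have many subgraphs, or makes all its subgraphs almost \<open>q\<close>-partite.\<close>

lemma card_contained_graphs:
  fixes g :: "nat \<Rightarrow> nat \<Rightarrow> real"
  assumes n: "n \<ge> 1" and q: "q \<ge> 1" and kappa: "\<kappa> > 0"
    and small: "\<And>(P :: nat set set) M. finite P \<Longrightarrow> real (card P) \<le> M \<Longrightarrow>
       real (card {B. B \<subseteq> P \<and> real (card B) \<le> \<gamma> * M}) \<le> exp (h * M)"
    and stab: "\<And>n A (E :: nat \<Rightarrow> nat \<Rightarrow> bool). finite A \<Longrightarrow> real (card A) \<le> n \<Longrightarrow> (\<forall>x y. E x y = E y x) \<Longrightarrow>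
      real (card (cliques E (Suc q) A)) \<le> \<delta>\<^sub>0 * n ^ Suc q \<Longrightarrow>
      (\<exists>p. p ` A \<subseteq> {1..q} \<and>
       real (arcs E A A) + (\<Sum>i=1..q. real (arcs E {v\<in>A. p v = i} {v\<in>A. p v = i})) \<le>
         real (card A) ^ 2 - (\<Sum>i=1..q. real (card {v\<in>A. p v = i}) ^ 2) + \<kappa> / 4 * n ^ 2)"
    and gam: "0 < \<gamma>" "\<gamma> \<le> \<kappa> / 4"
    and del: "\<delta> + real (Suc q) ^ 2 * (2 * \<eta>) \<le> \<gamma> ^ card (index_pairs (Suc q)) * \<delta>\<^sub>0"
    and g: "\<And>x y. 0 \<le> g x y \<and> g x y \<le> 1" "\<And>x y. g x y = g y x"
  shows "real (card {G \<in> graphs n. few_cliques n (Suc q) \<delta> G \<and> \<not> (\<exists>p. almost_partite n q \<kappa> p G) \<and>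
      cut_close {1..n} (2 * \<eta>) (\<lambda>x y. of_bool (adj G x y)) g \<and>
      (\<Sum>x\<in>{1..n}. \<Sum>y\<in>{1..n}. of_bool (adj G x y) * below \<gamma> g x y) \<le> 2 * \<gamma> * real n ^ 2})
    \<le> exp ((ln 2 * (1 - 1 / real q - \<kappa> / 4) / 2 + h) * real n ^ 2)"
  (is "real (card ?F) \<le> _")
proof (cases "?F = {}")
  case True
  show ?thesis unfolding True by simp
next
  case False
  define V where "V = {1..n}"
  have V: "finite V" "V \<noteq> {}" "card V = n" using n by (auto simp: V_def)
  define H where "H x y = (\<gamma> \<le> g x y)" for x y
  have Hsym: "H x y = H y x" for x y using g(2)[of x y] by (simp add: H_def)
  define PH where "PH = edge_set H V"
  have lost: "real (arcs (\<lambda>u v. u \<noteq> v \<and> adj G u v \<and> \<not> H u v) V V) \<le> 2 * \<gamma> * real n ^ 2" if "G \<in> ?F" for G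
  proof -
    have "real (arcs (\<lambda>u v. u \<noteq> v \<and> adj G u v \<and> \<not> H u v) V V) \<le> real (arcs (\<lambda>u v. adj G u v \<and> \<not> H u v) V V)"
      using V by (intro of_nat_mono arcs_mono) auto
    also have "\<dots> = (\<Sum>x\<in>V. \<Sum>y\<in>V. of_bool (adj G x y) * below \<gamma> g x y)"
      unfolding arcs_eq_sum[OF V(1)] by (intro sum.cong refl) (auto simp: below_def H_def)
    also have "\<dots> \<le> 2 * \<gamma> * real n ^ 2" using that by (simp add: V_def)
    finally show ?thesis .
  qed
  \<comment> \<open>One member of the family suffices: its few cliques bound the weighted count of
    \<open>g\<close>, hence the cliques of \<open>H\<close>, and \<open>H\<close> is the container
    of all members.\<close>
  obtain G where G: "G \<in> ?F" using False by blast
  have noloop: "{v} \<notin> G" for v using adj_imp_neq[of G n v v] G by auto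
  have "\<bar>hom_sum (Suc q) V (\<lambda>_ x y. of_bool (adj G x y)) - hom_sum (Suc q) V (\<lambda>_. g)\<bar> \<le>
      real (Suc q) ^ 2 * (2 * \<eta>) * real (card V) ^ Suc q"
    by (rule hom_sum_cut_le) (use V g G in \<open>auto simp: cut_close_def V_def\<close>)
  moreover have "hom_sum (Suc q) V (\<lambda>_ x y. of_bool (adj G x y)) \<le> \<delta> * real n ^ Suc q"
    unfolding hom_sum_of_bool[OF V(1)] using G by (simp add: few_cliques_def V_def)
  ultimately have "hom_sum (Suc q) V (\<lambda>_. g) \<le> (\<delta> + real (Suc q) ^ 2 * (2 * \<eta>)) * real n ^ Suc q"
    unfolding V(3) by (simp only: distrib_right)
  also have "\<dots> \<le> \<gamma> ^ card (index_pairs (Suc q)) * \<delta>\<^sub>0 * real n ^ Suc q"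
    by (rule mult_right_mono[OF del]) simp
  finally have "\<gamma> ^ card (index_pairs (Suc q)) * real (card (cliques H (Suc q) V)) \<le>
      \<gamma> ^ card (index_pairs (Suc q)) * (\<delta>\<^sub>0 * real n ^ Suc q)"
    unfolding H_def mult.assoc
    by (rule order_trans[OF hom_sum_threshold_ge[OF V(1) gam(1)], rotated]) (simp add: g(1))
  then have fewH: "real (card (cliques H (Suc q) V)) \<le> \<delta>\<^sub>0 * real n ^ Suc q"
    using gam by (simp add: mult_le_cancel_left_pos)
  obtain p0 where p0: "p0 ` V \<subseteq> {1..q}" and p0b:
      "real (arcs H V V) + (\<Sum>i=1..q. real (arcs H {v\<in>V. p0 v = i} {v\<in>V. p0 v = i})) \<le>
         real (card V) ^ 2 - (\<Sum>i=1..q. real (card {v\<in>V. p0 v = i}) ^ 2) + \<kappa> / 4 * real n ^ 2"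
    using stab[OF V(1) _ _ fewH] V Hsym by auto
  \<comment> \<open>A denser \<open>H\<close> would be almost \<open>q\<close>-partite, and so would
    \<open>G\<close>, which has few edges outside \<open>H\<close>.\<close>
  have sparse: "real (arcs H V V) \<le> (1 - 1 / real q - \<kappa> / 4) * real n ^ 2"
  proof (rule ccontr)
    assume dense: "\<not> ?thesis"
    define p where "p = restrict p0 V"
    have p: "p \<in> PiE {1..n} (\<lambda>_. {1..q})" using p0 by (auto simp: p_def V_def)
    have pim: "p ` {1..n} \<subseteq> {1..q}" using p by auto
    have cls: "{v\<in>V. p0 v = i} = color_class n p i" for i by (auto simp: p_def V_def color_class_def)
    have "real (arcs H V V) + inner_arcs n q p H \<le>
       real n ^ 2 - (real n ^ 2 / real q + imbalance n q p) + \<kappa> / 4 * real n ^ 2"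
      using p0b unfolding cls sum_sq_color_class[OF pim q] V(3) .
    \<comment> \<open>The main terms of the stability bound and of the assumed density cancel; the
      two error terms \<open>\<kappa> / 4\<close> remain.\<close>
    then have both: "inner_arcs n q p H +
        imbalance n q p \<le> \<kappa> / 2 * real n ^ 2"
      using dense by (simp add: algebra_simps)
    have pos: "0 \<le> inner_arcs n q p H"
        "0 \<le> imbalance n q p"
      by (intro sum_nonneg; simp)+
    have kn: "0 \<le> \<kappa> * real n ^ 2" using kappa by simp
    have "inner_arcs n q p (adj G) \<le> \<kappa> * real n ^ 2"
    proof -
      let ?D = "\<lambda>u v. u \<noteq> v \<and> adj G u v \<and> \<not> H u v"
      \<comment> \<open>An arc inside a class either lies in \<open>H\<close> or is lost. Letting
        the second end of lost arcs range over all of \<open>V\<close> makes their sum over the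
        classes exact.\<close>
      have "real (arcs (adj G) (color_class n p i) (color_class n p i)) \<le>
          real (arcs H (color_class n p i) (color_class n p i)) + real (arcs ?D (color_class n p i) V)" for i
      proof -
        have "real (arcs (adj G) (color_class n p i) (color_class n p i)) \<le>
          real (arcs H (color_class n p i) (color_class n p i)) + real (arcs ?D (color_class n p i) (color_class n p i))"
          unfolding arcs_eq_sum[OF finite_color_class] sum.distrib[symmetric]
          by (intro sum_mono) (auto simp: noloop)
        moreover have "arcs ?D (color_class n p i) (color_class n p i) \<le> arcs ?D (color_class n p i) V"
          unfolding arcs_def nbrs_def using V by (intro sum_mono card_mono) (auto simp: color_class_def V_def)
        ultimately show ?thesis by linarith
      qed
      then have "inner_arcs n q p (adj G) \<le>
        (\<Sum>i=1..q. real (arcs H (color_class n p i) (color_class n p i)) + real (arcs ?D (color_class n p i) V))"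
        by (intro sum_mono)
      also have "\<dots> = inner_arcs n q p H + (\<Sum>i=1..q. real (arcs ?D (color_class n p i) V))"
        by (rule sum.distrib)
      also have "(\<Sum>i=1..q. real (arcs ?D (color_class n p i) V)) = real (arcs ?D V V)"
      proof -
        have "V = (\<Union>i\<in>{1..q}. color_class n p i)" using pim by (auto simp: color_class_def V_def)
        then have "arcs ?D V V = (\<Sum>u\<in>(\<Union>i\<in>{1..q}. color_class n p i). nbrs ?D V u)" by (simp add: arcs_def)
        also have "\<dots> = (\<Sum>i=1..q. \<Sum>u\<in>color_class n p i. nbrs ?D V u)"
          by (rule sum.UNION_disjoint) (auto simp: color_class_def)
        finally show ?thesis by (simp add: arcs_def)
      qed
      finally show ?thesis using lost[OF G] both pos(2) gam(2)
          mult_right_mono[OF gam(2), of "real n ^ 2"] by (simp add: algebra_simps)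
    qed
    moreover have "imbalance n q p \<le> \<kappa> * real n ^ 2"
      using both pos(1) kn by linarith
    ultimately have "almost_partite n q \<kappa> p G" using p by (simp add: almost_partite_def)
    then show False using G by blast
  qed
  have finPH: "finite PH" using V by (simp add: PH_def finite_edge_set)
  have "2 * card PH \<le> arcs H V V"
    using card_edge_set[OF V(1), of H] Hsym arcs_mono[OF V(1) V(1), of "\<lambda>u v. u \<noteq> v \<and> H u v" H] by (simp add: PH_def)
  then have cPH: "real (card PH) \<le> (1 - 1 / real q - \<kappa> / 4) / 2 * real n ^ 2"
    using sparse by simp
  let ?Y = "{B. B \<subseteq> all_edges n \<and> real (card B) \<le> \<gamma> * real n ^ 2}"
  \<comment> \<open>A member is determined by its part inside \<open>PH\<close>, which is arbitrary,
    and its part outside, which is small.\<close>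
  have "card ?F \<le> card (Pow PH) * card ?Y"
  proof (rule card_le_split[where P = PH])
    fix K assume K: "K \<in> ?F"
    then have Kg: "K \<in> graphs n" by simp
    have "K - PH = edge_set (\<lambda>u v. adj K u v \<and> \<not> H u v) V"
    proof (intro equalityI subsetI)
      fix e assume e: "e \<in> K - PH"
      then have "e \<subseteq> V" "card e = 2" using Kg by (auto simp: graphs_eq all_edges_def V_def)
      then obtain u v where uv: "e = {u, v}" "u \<noteq> v" "u \<in> V" "v \<in> V" by (auto simp: card_2_iff)
      then have "\<not> H u v" using e edge_set_mem[of H u V v] Hsym by (auto simp: PH_def)
      then show "e \<in> edge_set (\<lambda>u v. adj K u v \<and> \<not> H u v) V" using uv e by (auto simp: edge_set_def)
    next
      fix e assume "e \<in> edge_set (\<lambda>u v. adj K u v \<and> \<not> H u v) V"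
      then obtain u v where uv: "e = {u, v}" "u \<noteq> v" "u \<in> V" "v \<in> V" "adj K u v" "\<not> H u v" by (auto simp: edge_set_def)
      then show "e \<in> K - PH" using edge_set_mem[of H u V v] Hsym by (auto simp: PH_def)
    qed
    moreover have "2 * card (edge_set (\<lambda>u v. adj K u v \<and> \<not> H u v) V) = arcs (\<lambda>u v. u \<noteq> v \<and> adj K u v \<and> \<not> H u v) V V"
      by (rule card_edge_set[OF V(1)]) (use Hsym adj_sym[of _ _ K] in auto)
    ultimately have "real (card (K - PH)) \<le> \<gamma> * real n ^ 2" using lost[OF K] by simp
    then show "K \<inter> PH \<in> Pow PH \<and> K - PH \<in> ?Y" using Kg by (auto simp: graphs_eq)
  next
    show "finite ?Y" by (rule finite_subset[of _ "Pow (all_edges n)"]) (auto simp: finite_all_edges)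
  qed (use finPH in auto)
  then have "real (card ?F) \<le> real (card (Pow PH) * card ?Y)" by (rule of_nat_mono)
  also have "\<dots> = real (card (Pow PH)) * real (card ?Y)" by (rule of_nat_mult)
  also have "real (card (Pow PH)) * real (card ?Y) \<le> exp (ln 2 * ((1 - 1 / real q - \<kappa> / 4) / 2 * real n ^ 2)) * exp (h * real n ^ 2)"
  proof (intro mult_mono)
    have "real (card (Pow PH)) = exp (ln 2 * real (card PH))"
      using finPH by (simp add: card_Pow exp_of_nat2_mult)
    then show "real (card (Pow PH)) \<le> exp (ln 2 * ((1 - 1 / real q - \<kappa> / 4) / 2 * real n ^ 2))"
      using cPH by simp
    show "real (card ?Y) \<le> exp (h * real n ^ 2)"
      by (rule small[OF finite_all_edges card_all_edges])
  qed auto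
  finally show ?thesis by (simp add: exp_add[symmetric] algebra_simps)
qed

text \<open>Growth rate, in units of \<open>n ^ 2\<close>, of the logarithm of the number of
  subgraphs of the balanced complete \<open>q\<close>-partite graph; it is the limit of the free
  energy.\<close>

definition rate :: "nat \<Rightarrow> real" where
  "rate q = ln 2 * ((1 - 1 / real q) / 2)"

lemma card_UN_le_real:
  assumes "finite I" "\<And>i. i \<in> I \<Longrightarrow> real (card (F i)) \<le> b" "real (card I) \<le> m" "0 \<le> b"
  shows "real (card (\<Union>i\<in>I. F i)) \<le> m * b"
proof -
  have "real (card (\<Union>i\<in>I. F i)) \<le> real (\<Sum>i\<in>I. card (F i))"
    by (rule of_nat_mono[OF card_UN_le[OF assms(1)]])
  also have "\<dots> = (\<Sum>i\<in>I. real (card (F i)))" by (rule of_nat_sum)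
  also have "\<dots> \<le> real (card I) * b" using assms(2) by (rule sum_bounded_above)
  also have "\<dots> \<le> m * b" using assms(3,4) by (rule mult_right_mono)
  finally show ?thesis .
qed

lemma count_few_cliques:
  assumes q: "q \<ge> 1" and kappa: "\<kappa> > 0"
  obtains \<delta> c N where "\<delta> > 0" "c > 0" "\<And>n. n \<ge> N \<Longrightarrow>
    real (card {G \<in> graphs n. few_cliques n (Suc q) \<delta> G \<and> \<not> (\<exists>p. almost_partite n q \<kappa> p G)}) \<le>
      exp ((rate q - c) * real n ^ 2)"
proof -
  \<comment> \<open>Sparsity of a container saves \<open>ln 2 * \<kappa> / 8 = 2 * h\<close>; the
    few edges outside it cost \<open>h\<close> and the choice of the approximant
    \<open>h / 2\<close>, which leaves \<open>h / 2\<close>.\<close>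
  define h where "h = ln 2 * \<kappa> / 16"
  have h: "h > 0" using kappa by (simp add: h_def)
  obtain \<gamma>\<^sub>0 where g0: "\<gamma>\<^sub>0 > 0" and small0: "\<And>(P :: nat set set) M. finite P \<Longrightarrow> real (card P) \<le> M \<Longrightarrow>
       real (card {B. B \<subseteq> P \<and> real (card B) \<le> \<gamma>\<^sub>0 * M}) \<le> exp (h * M)"
    using small_subsets_rate[OF h, where 'a = "nat set"] by blast
  define \<gamma> where "\<gamma> = min \<gamma>\<^sub>0 (\<kappa> / 4)"
  have gam: "0 < \<gamma>" "\<gamma> \<le> \<kappa> / 4" "\<gamma> \<le> \<gamma>\<^sub>0" using g0 kappa by (auto simp: \<gamma>_def)
  have small: "real (card {B. B \<subseteq> P \<and> real (card B) \<le> \<gamma> * M}) \<le> exp (h * M)"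
    if "finite P" "real (card P) \<le> M" for P :: "nat set set" and M
  proof -
    have "M \<ge> 0" using that by (meson of_nat_0_le_iff order_trans)
    then have "\<gamma> * M \<le> \<gamma>\<^sub>0 * M" by (rule mult_right_mono[OF gam(3)])
    then have "{B. B \<subseteq> P \<and> real (card B) \<le> \<gamma> * M} \<subseteq> {B. B \<subseteq> P \<and> real (card B) \<le> \<gamma>\<^sub>0 * M}" by auto
    then have "card {B. B \<subseteq> P \<and> real (card B) \<le> \<gamma> * M} \<le> card {B. B \<subseteq> P \<and> real (card B) \<le> \<gamma>\<^sub>0 * M}"
      by (rule card_mono[rotated]) (use that in auto)
    then show ?thesis using small0[OF that] by linarith
  qed
  have k4: "\<kappa> / 4 > 0" using kappa by simp
  obtain \<delta>\<^sub>0 where d0: "\<delta>\<^sub>0 > 0" and stab: "\<And>n A (E :: nat \<Rightarrow> nat \<Rightarrow> bool). finite A \<Longrightarrow> real (card A) \<le> n \<Longrightarrow> (\<forall>x y. E x y = E y x) \<Longrightarrow>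
      real (card (cliques E (Suc q) A)) \<le> \<delta>\<^sub>0 * n ^ Suc q \<Longrightarrow>
      (\<exists>p. p ` A \<subseteq> {1..q} \<and>
       real (arcs E A A) + (\<Sum>i=1..q. real (arcs E {v\<in>A. p v = i} {v\<in>A. p v = i})) \<le>
         real (card A) ^ 2 - (\<Sum>i=1..q. real (card {v\<in>A. p v = i}) ^ 2) + \<kappa> / 4 * n ^ 2)"
    using robust_stability[OF q k4, where 'a = nat] by auto
  define a where "a = \<gamma> ^ card (index_pairs (Suc q))"
  have a: "a > 0" using gam by (simp add: a_def)
  \<comment> \<open>The counting error \<open>(q + 1) ^ 2 * (2 * \<eta>)\<close> and the clique
    density \<open>\<delta>\<close> each use up to half of \<open>a * \<delta>\<^sub>0\<close>,
    where \<open>a\<close> is the factor lost by thresholding.\<close>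
  define \<eta> where "\<eta> = min \<gamma> (a * \<delta>\<^sub>0 / (4 * real (Suc q) ^ 2))"
  have eta: "0 < \<eta>" "\<eta> \<le> \<gamma>" using gam a d0 by (auto simp: \<eta>_def)
  define \<delta> where "\<delta> = a * \<delta>\<^sub>0 / 2"
  have delta: "\<delta> > 0" using a d0 by (simp add: \<delta>_def)
  have "\<eta> \<le> a * \<delta>\<^sub>0 / (4 * real (Suc q) ^ 2)" by (simp add: \<eta>_def)
  then have "real (Suc q) ^ 2 * (2 * \<eta>) \<le> a * \<delta>\<^sub>0 / 2"
    by (simp add: pos_le_divide_eq mult_ac)
  then have del: "\<delta> + real (Suc q) ^ 2 * (2 * \<eta>) \<le> a * \<delta>\<^sub>0" by (simp add: \<delta>_def)
  \<comment> \<open>The number of rounds does not depend on \<open>n\<close>, so the number of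
    approximants stays exponential in \<open>n\<close>.\<close>
  obtain t where t: "real t * \<eta>\<^sup>2 > 1"
    using reals_Archimedean3[of "\<eta>\<^sup>2"] eta by auto
  define C where "C = ln 4 * real t"
  have C: "C \<ge> 0" by (simp add: C_def)
  have h2: "h / 2 > 0" using h by simp
  obtain N where N: "N \<ge> 1" "\<And>n. n \<ge> N \<Longrightarrow> C * (real n + 1) \<le> h / 2 * real n ^ 2"
    using linear_le_quadratic[OF h2 C] by blast
  show thesis
  proof (rule that[OF delta h2])
    fix n assume n: "n \<ge> N"
    then have n1: "n \<ge> 1" using N by simp
    let ?good = "\<lambda>g G. cut_close {1..n} (2 * \<eta>) (\<lambda>x y. of_bool (adj G x y)) g \<and>
      (\<Sum>x\<in>{1..n}. \<Sum>y\<in>{1..n}. of_bool (adj G x y) * below \<gamma> g x y) \<le> 2 * \<gamma> * real n ^ 2"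
    let ?A = "approximants {1..n} \<gamma> \<eta> t"
    let ?F = "\<lambda>g. {G \<in> graphs n. few_cliques n (Suc q) \<delta> G \<and> \<not> (\<exists>p. almost_partite n q \<kappa> p G) \<and> ?good g G}"
    have "{G \<in> graphs n. few_cliques n (Suc q) \<delta> G \<and> \<not> (\<exists>p. almost_partite n q \<kappa> p G)} \<subseteq> (\<Union>g\<in>?A. ?F g)"
    proof
      fix G assume G: "G \<in> {G \<in> graphs n. few_cliques n (Suc q) \<delta> G \<and> \<not> (\<exists>p. almost_partite n q \<kappa> p G)}"
      have "\<exists>g\<in>?A. ?good g G"
      proof (rule weak_regularity[of "{1..n}" \<eta> \<gamma> t "\<lambda>x y. of_bool (adj G x y)", OF _ _ eta t])
        fix g assume "g \<in> ?A" "cut_close {1..n} (2 * \<eta>) (\<lambda>x y. of_bool (adj G x y)) g"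
          "(\<Sum>x\<in>{1..n}. \<Sum>y\<in>{1..n}. of_bool (adj G x y) * below \<gamma> g x y) \<le> 2 * \<gamma> * real (card {1..n}) ^ 2"
        then show ?thesis unfolding card_atLeastAtMost diff_Suc_1 by blast
      next
        show "of_bool (adj G x y) = (of_bool (adj G y x) :: real)" for x y
          by (subst adj_sym) (rule refl)
      qed (use n1 in auto)
      with G show "G \<in> (\<Union>g\<in>?A. ?F g)" by blast
    qed
    then have "real (card {G \<in> graphs n. few_cliques n (Suc q) \<delta> G \<and> \<not> (\<exists>p. almost_partite n q \<kappa> p G)}) \<le> real (card (\<Union>g\<in>?A. ?F g))"
      by (intro of_nat_mono card_mono) (auto simp: finite_graphs finite_approximants)
    also have "\<dots> \<le> exp (C * (real n + 1)) * exp ((ln 2 * (1 - 1 / real q - \<kappa> / 4) / 2 + h) * real n ^ 2)"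
    proof (rule card_UN_le_real)
      fix g assume g: "g \<in> ?A"
      show "real (card (?F g)) \<le> exp ((ln 2 * (1 - 1 / real q - \<kappa> / 4) / 2 + h) * real n ^ 2)"
        by (rule card_contained_graphs[OF n1 q kappa small stab gam(1,2) del[unfolded a_def]])
          (use approximants_range[OF g] approximants_sym[OF g] in auto)
    next
      have "real (card ?A) \<le> real (4 ^ (t * (n + 1)))"
        using card_approximants[of "{1..n}" \<gamma> \<eta> t] by (intro of_nat_mono) simp
      also have "\<dots> = exp (ln 4 * real (t * (n + 1)))" unfolding exp_of_nat2_mult by simp
      finally show "real (card ?A) \<le> exp (C * (real n + 1))" by (simp add: C_def algebra_simps)
    qed (auto simp: finite_approximants)
    also have "\<dots> \<le> exp (h / 2 * real n ^ 2) * exp ((ln 2 * (1 - 1 / real q - \<kappa> / 4) / 2 + h) * real n ^ 2)"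
      using N(2)[OF n] by (intro mult_right_mono) auto
    also have "\<dots> = exp ((rate q - h / 2) * real n ^ 2)"
    proof -
      have "h / 2 + (ln 2 * (1 - 1 / real q - \<kappa> / 4) / 2 + h) = rate q - h / 2"
        by (simp add: rate_def h_def field_simps)
      then show ?thesis unfolding exp_add[symmetric] distrib_right[symmetric] by (simp only:)
    qed
    finally show "real (card {G \<in> graphs n. few_cliques n (Suc q) \<delta> G \<and> \<not> (\<exists>p. almost_partite n q \<kappa> p G)}) \<le>
      exp ((rate q - h / 2) * real n ^ 2)" .
  qed
qed

text \<open>Deviations are tested on all subsets of two classes and not only on the classes
  themselves, because the cut distance tests arbitrary sets.\<close>

definition quasirandom :: "nat \<Rightarrow> nat \<Rightarrow> real \<Rightarrow> (nat \<Rightarrow> nat) \<Rightarrow> graph \<Rightarrow> bool" where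
  "quasirandom n q \<epsilon> p G \<longleftrightarrow>
    (\<forall>i\<in>{1..q}. \<forall>j\<in>{1..q}. i \<noteq> j \<longrightarrow> (\<forall>S\<subseteq>color_class n p i. \<forall>T\<subseteq>color_class n p j.
       \<bar>real (arcs (adj G) S T) - real (card S) * real (card T) / 2\<bar> \<le> \<epsilon> * real n ^ 2))"

text \<open>An almost partite graph is determined by its crossing and its inner edges; the latter
  are few and cost only \<open>exp (h * n ^ 2)\<close>. The condition \<open>R\<close> concerns
  crossing edges alone: it is trivial for the free energy and a large deviation for
  quasirandomness.\<close>

lemma card_cross_split:
  assumes p: "p \<in> PiE {1..n} (\<lambda>_. {1..q})" and q: "q \<ge> 1"
    and small: "real (card {B. B \<subseteq> all_edges n \<and> real (card B) \<le> \<kappa> * real n ^ 2}) \<le> exp (h * real n ^ 2)"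
    and X: "real (card {B. B \<subseteq> cross n p \<and> R B}) \<le> 2 ^ card (cross n p) * d" and d: "d \<ge> 0"
  shows "real (card {G \<in> graphs n. almost_partite n q \<kappa> p G \<and> R (G \<inter> cross n p)}) \<le>
    exp ((rate q + h) * real n ^ 2) * d"
proof -
  let ?X = "{B. B \<subseteq> cross n p \<and> R B}"
  let ?Y = "{B. B \<subseteq> all_edges n \<and> real (card B) \<le> \<kappa> * real n ^ 2}"
  have sub: "cross n p \<subseteq> all_edges n" unfolding cross_def by (rule edge_set_subset) simp
  have pim: "p ` {1..n} \<subseteq> {1..q}" using p by auto
  have "card {G \<in> graphs n. almost_partite n q \<kappa> p G \<and> R (G \<inter> cross n p)} \<le> card ?X * card ?Y"
  proof (rule card_le_split[where P = "cross n p"])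
    fix G assume "G \<in> {G \<in> graphs n. almost_partite n q \<kappa> p G \<and> R (G \<inter> cross n p)}"
    then have G: "G \<in> graphs n" "almost_partite n q \<kappa> p G" "R (G \<inter> cross n p)" by auto
    have "G - cross n p \<subseteq> (\<Union>i\<in>{1..q}. {e \<in> G. e \<subseteq> color_class n p i})"
    proof
      fix e assume e: "e \<in> G - cross n p"
      then have "e \<subseteq> {1..n}" "card e = 2" using G by (auto simp: graphs_eq all_edges_def)
      then obtain u v where uv: "e = {u, v}" "u \<noteq> v" "u \<in> {1..n}" "v \<in> {1..n}" by (auto simp: card_2_iff)
      then have "p u = p v" using e unfolding cross_def edge_set_def by blast
      then have "e \<subseteq> color_class n p (p u)" using uv by (auto simp: color_class_def)
      moreover have "p u \<in> {1..q}" using pim uv by blast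
      ultimately show "e \<in> (\<Union>i\<in>{1..q}. {e \<in> G. e \<subseteq> color_class n p i})" using e by blast
    qed
    moreover have fG: "finite G" using G(1) finite_all_edges finite_subset by (auto simp: graphs_eq)
    ultimately have "card (G - cross n p) \<le> card (\<Union>i\<in>{1..q}. {e \<in> G. e \<subseteq> color_class n p i})"
      by (intro card_mono) auto
    also have "\<dots> \<le> (\<Sum>i=1..q. edges_in G (color_class n p i))"
      unfolding edges_in_def by (rule card_UN_le) simp
    finally have "real (card (G - cross n p)) \<le> real (\<Sum>i=1..q. edges_in G (color_class n p i))"
      by (rule of_nat_mono)
    also have "\<dots> = (\<Sum>i=1..q. real (arcs (adj G) (color_class n p i) (color_class n p i)) / 2)"
      unfolding of_nat_sum by (intro sum.cong refl) (simp flip: edges_in_eq_arcs[OF G(1)])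
    also have "\<dots> \<le> inner_arcs n q p (adj G)"
      by (intro sum_mono) simp
    also have "\<dots> \<le> \<kappa> * real n ^ 2" using G(2) by (simp add: almost_partite_def)
    finally show "G \<inter> cross n p \<in> ?X \<and> G - cross n p \<in> ?Y" using G by (auto simp: graphs_eq)
  next
    show "finite ?X" by (rule finite_subset[of _ "Pow (all_edges n)"]) (use sub in \<open>auto simp: finite_all_edges\<close>)
    show "finite ?Y" by (rule finite_subset[of _ "Pow (all_edges n)"]) (auto simp: finite_all_edges)
  qed
  then have "real (card {G \<in> graphs n. almost_partite n q \<kappa> p G \<and> R (G \<inter> cross n p)}) \<le> real (card ?X * card ?Y)"
    by (rule of_nat_mono)
  also have "\<dots> = real (card ?X) * real (card ?Y)" by (rule of_nat_mult)
  also have "\<dots> \<le> (exp (rate q * real n ^ 2) * d) * exp (h * real n ^ 2)"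
  proof (intro mult_mono small)
    have "2 ^ card (cross n p) = exp (ln 2 * real (card (cross n p)))" unfolding exp_of_nat2_mult by simp
    also have "\<dots> \<le> exp (rate q * real n ^ 2)"
      using card_cross_le[OF pim q] by (simp add: rate_def mult.assoc)
    finally show "real (card ?X) \<le> exp (rate q * real n ^ 2) * d"
      using X d by (meson mult_right_mono order_trans)
  qed (use d in auto)
  finally show ?thesis by (simp add: distrib_right exp_add mult_ac)
qed

text \<open>Counts the dominant graphs in the upper bound for the free energy, by a union over the
  \<open>q ^ n\<close> colourings with trivial \<open>R\<close>.\<close>

lemma count_almost_partite:
  assumes q: "q \<ge> 1" and h: "h > 0"
  obtains \<kappa> N where "\<kappa> > 0" "\<And>n. n \<ge> N \<Longrightarrow>
    real (card {G \<in> graphs n. \<exists>p. almost_partite n q \<kappa> p G}) \<le> exp ((rate q + h) * real n ^ 2)"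
proof -
  have h2: "h / 2 > 0" using h by simp
  obtain \<kappa> where kappa: "\<kappa> > 0" and small: "\<And>(P :: nat set set) M. finite P \<Longrightarrow> real (card P) \<le> M \<Longrightarrow>
       real (card {B. B \<subseteq> P \<and> real (card B) \<le> \<kappa> * M}) \<le> exp (h / 2 * M)"
    using small_subsets_rate[OF h2, where 'a = "nat set"] by blast
  have C: "ln (real q) \<ge> 0" using q by simp
  obtain N where N: "N \<ge> 1" "\<And>n. n \<ge> N \<Longrightarrow> ln (real q) * (real n + 1) \<le> h / 2 * real n ^ 2"
    using linear_le_quadratic[OF h2 C] by blast
  show thesis
  proof (rule that[OF kappa])
    fix n assume n: "n \<ge> N"
    let ?P = "PiE {1..n} (\<lambda>_. {1..q})"
    let ?F = "\<lambda>p. {G \<in> graphs n. almost_partite n q \<kappa> p G \<and> True}"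
    have "{G \<in> graphs n. \<exists>p. almost_partite n q \<kappa> p G} = (\<Union>p\<in>?P. ?F p)"
      by (auto simp: almost_partite_def)
    also have "real (card (\<Union>p\<in>?P. ?F p)) \<le> exp (ln (real q) * (real n + 1)) * (exp ((rate q + h / 2) * real n ^ 2) * 1)"
    proof (rule card_UN_le_real)
      fix p assume p: "p \<in> ?P"
      have fin: "finite (cross n p)" by (simp add: cross_def finite_edge_set)
      show "real (card (?F p)) \<le> exp ((rate q + h / 2) * real n ^ 2) * 1"
      proof (rule card_cross_split[OF p q small[OF finite_all_edges card_all_edges]])
        have "{B. B \<subseteq> cross n p \<and> True} = Pow (cross n p)" by auto
        then show "real (card {B. B \<subseteq> cross n p \<and> True}) \<le> 2 ^ card (cross n p) * 1"
          using fin by (simp add: card_Pow)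
      qed simp
    next
      have "real (card ?P) = real q ^ n" by (simp add: card_PiE)
      also have "\<dots> \<le> real q ^ (n + 1)" using q by (intro power_increasing) auto
      also have "\<dots> = exp (ln (real q) * real (n + 1))" unfolding exp_of_nat2_mult using q by simp
      finally show "real (card ?P) \<le> exp (ln (real q) * (real n + 1))" by (simp add: add.commute)
    qed (auto intro!: finite_PiE)
    also have "\<dots> \<le> exp (h / 2 * real n ^ 2) * (exp ((rate q + h / 2) * real n ^ 2) * 1)"
      using N(2)[OF n] by (intro mult_right_mono) auto
    also have "\<dots> = exp ((rate q + h) * real n ^ 2)"
      unfolding mult_1_right exp_add[symmetric] by (simp add: field_simps)
    finally show "real (card {G \<in> graphs n. \<exists>p. almost_partite n q \<kappa> p G}) \<le> exp ((rate q + h) * real n ^ 2)" .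
  qed
qed

text \<open>Union bound over the colouring and the pair of sets on which quasirandomness fails. The
  claim covers every \<open>\<kappa> \<le> \<kappa>\<^sub>0\<close>, so that \<open>\<kappa>\<close>
  may later be reduced without affecting the rate.\<close>

lemma count_not_quasirandom:
  assumes q: "q \<ge> 1" and e: "0 < \<epsilon>" "\<epsilon> \<le> 1"
  obtains \<kappa>\<^sub>0 c where "\<kappa>\<^sub>0 > 0" "c > 0" "\<And>\<kappa>. \<kappa> \<le> \<kappa>\<^sub>0 \<Longrightarrow> \<exists>N. \<forall>n\<ge>N.
    real (card {G \<in> graphs n. \<exists>p. almost_partite n q \<kappa> p G \<and> \<not> quasirandom n q \<epsilon> p G}) \<le> exp ((rate q - c) * real n ^ 2)"
proof -
  \<comment> \<open>The deviation bound saves \<open>\<epsilon>\<^sup>2 = 4 * h\<close>; inner edges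
    and the union bound cost \<open>h\<close> each.\<close>
  define h where "h = \<epsilon>\<^sup>2 / 4"
  have h: "h > 0" using e by (simp add: h_def)
  obtain \<kappa>\<^sub>0 where kappa: "\<kappa>\<^sub>0 > 0" and small0: "\<And>(P :: nat set set) M. finite P \<Longrightarrow> real (card P) \<le> M \<Longrightarrow>
       real (card {B. B \<subseteq> P \<and> real (card B) \<le> \<kappa>\<^sub>0 * M}) \<le> exp (h * M)"
    using small_subsets_rate[OF h, where 'a = "nat set"] by blast
  \<comment> \<open>There are \<open>q ^ n\<close> colourings and \<open>4 ^ n\<close> pairs of
    sets, hence the base \<open>4 * q\<close>.\<close>
  define L where "L = ln (real (4 * q))"
  have eL: "exp L = real (4 * q)" using q by (simp add: L_def)
  have "L \<ge> 0" unfolding L_def by (rule ln_ge_zero) (use q in simp)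
  define C where "C = L + ln 2"
  have C: "C \<ge> 0" using \<open>L \<ge> 0\<close> by (simp add: C_def)
  obtain N where N: "N \<ge> 1" "\<And>n. n \<ge> N \<Longrightarrow> C * (real n + 1) \<le> h * real n ^ 2"
    using linear_le_quadratic[OF h C] by blast
  show thesis
  proof (rule that[OF kappa, of "2 * h"])
    show "2 * h > 0" using h by simp
    fix \<kappa> assume kk: "\<kappa> \<le> \<kappa>\<^sub>0"
    have "real (card {G \<in> graphs n. \<exists>p. almost_partite n q \<kappa> p G \<and> \<not> quasirandom n q \<epsilon> p G}) \<le> exp ((rate q - 2 * h) * real n ^ 2)"
      if n: "n \<ge> N" for n
    proof -
      have small: "real (card {B. B \<subseteq> all_edges n \<and> real (card B) \<le> \<kappa> * real n ^ 2}) \<le> exp (h * real n ^ 2)"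
      proof -
        have "\<kappa> * real n ^ 2 \<le> \<kappa>\<^sub>0 * real n ^ 2" by (rule mult_right_mono[OF kk]) simp
        then have "{B. B \<subseteq> all_edges n \<and> real (card B) \<le> \<kappa> * real n ^ 2} \<subseteq> {B. B \<subseteq> all_edges n \<and> real (card B) \<le> \<kappa>\<^sub>0 * real n ^ 2}" by auto
        then have "card {B. B \<subseteq> all_edges n \<and> real (card B) \<le> \<kappa> * real n ^ 2} \<le> card {B. B \<subseteq> all_edges n \<and> real (card B) \<le> \<kappa>\<^sub>0 * real n ^ 2}"
          by (rule card_mono[rotated]) (simp add: finite_all_edges)
        then show ?thesis using small0[OF finite_all_edges card_all_edges, of n] by linarith
      qed
      let ?V = "{1..n}"
      let ?P = "PiE ?V (\<lambda>_. {1..q})"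
      \<comment> \<open>The trivial conjunct gives \<open>Q\<close> the form in which
        \<open>card_disjoint_edges\<close> counts edges.\<close>
      define Q :: "nat set \<Rightarrow> nat set \<Rightarrow> nat set set" where "Q S T = {e. \<exists>a\<in>S. \<exists>b\<in>T. e = {a, b} \<and> True}" for S T
      let ?I = "{(p, S, T). p \<in> ?P \<and> S \<subseteq> ?V \<and> T \<subseteq> ?V \<and> S \<inter> T = {} \<and> Q S T \<subseteq> cross n p}"
      let ?R = "\<lambda>S T B. \<bar>real (card (B \<inter> Q S T)) - real (card (Q S T)) / 2\<bar> > \<epsilon> * real n ^ 2"
      let ?F = "\<lambda>(p, S, T). {G \<in> graphs n. almost_partite n q \<kappa> p G \<and> ?R S T (G \<inter> cross n p)}"
      have Isub: "?I \<subseteq> ?P \<times> Pow ?V \<times> Pow ?V" by auto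
      have finP: "finite ?P" by (intro finite_PiE) auto
      have finI: "finite ?I" by (rule finite_subset[OF Isub]) (use finP in auto)
      have cQ: "card (Q S T) = card S * card T" if "S \<inter> T = {}" "S \<subseteq> ?V" "T \<subseteq> ?V" for S T
      proof -
        have "{(u, v). u \<in> S \<and> v \<in> T \<and> True} = S \<times> T" by auto
        then show ?thesis unfolding Q_def card_disjoint_edges[OF that(1)] by (simp add: card_cartesian_product)
      qed
      have aQ: "arcs (adj G) S T = card (G \<inter> Q S T)" if "S \<inter> T = {}" "S \<subseteq> ?V" "T \<subseteq> ?V" for G S T
      proof -
        have fin: "finite S" "finite T" using that finite_subset by blast+
        have "G \<inter> Q S T = {e \<in> G. \<exists>a\<in>S. \<exists>b\<in>T. e = {a, b}}" by (auto simp: Q_def)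
        then show ?thesis using edges_between_eq_arcs[OF that(1) fin, of G] by (simp add: edges_between_def)
      qed
      have "{G \<in> graphs n. \<exists>p. almost_partite n q \<kappa> p G \<and> \<not> quasirandom n q \<epsilon> p G} \<subseteq> (\<Union>i\<in>?I. ?F i)"
      proof
        fix G assume "G \<in> {G \<in> graphs n. \<exists>p. almost_partite n q \<kappa> p G \<and> \<not> quasirandom n q \<epsilon> p G}"
        then obtain p where G: "G \<in> graphs n" "almost_partite n q \<kappa> p G" and nq: "\<not> quasirandom n q \<epsilon> p G" by blast
        obtain i j S T where ij: "i \<noteq> j" and ST: "S \<subseteq> color_class n p i" "T \<subseteq> color_class n p j"
          and "\<not> \<bar>real (arcs (adj G) S T) - real (card S) * real (card T) / 2\<bar> \<le> \<epsilon> * real n ^ 2"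
          using nq unfolding quasirandom_def by blast
        then have dev: "\<bar>real (arcs (adj G) S T) - real (card S) * real (card T) / 2\<bar> > \<epsilon> * real n ^ 2"
          by linarith
        have STV: "S \<subseteq> ?V" "T \<subseteq> ?V" "S \<inter> T = {}" using ST ij by (auto simp: color_class_def)
        have Qc: "Q S T \<subseteq> cross n p"
        proof
          fix e assume "e \<in> Q S T"
          then obtain a b where ab: "a \<in> S" "b \<in> T" "e = {a, b}" by (auto simp: Q_def)
          then have "a \<in> ?V" "b \<in> ?V" "p a = i" "p b = j" using ST by (auto simp: color_class_def)
          moreover from this have "a \<noteq> b" "p a \<noteq> p b" using ij by auto
          ultimately show "e \<in> cross n p" unfolding cross_def edge_set_def ab(3) by blast
        qed
        have "G \<inter> cross n p \<inter> Q S T = G \<inter> Q S T" using Qc by auto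
        then have "?R S T (G \<inter> cross n p)" using dev aQ[OF STV(3,1,2), of G] cQ[OF STV(3,1,2)] by simp
        then have "G \<in> ?F (p, S, T)" using G by simp
        moreover have "(p, S, T) \<in> ?I" using STV Qc G(2) by (auto simp: almost_partite_def)
        ultimately show "G \<in> (\<Union>i\<in>?I. ?F i)" by blast
      qed
      then have "real (card {G \<in> graphs n. \<exists>p. almost_partite n q \<kappa> p G \<and> \<not> quasirandom n q \<epsilon> p G}) \<le> real (card (\<Union>i\<in>?I. ?F i))"
        by (intro of_nat_mono card_mono finite_UN_I finI) (auto simp: finite_graphs)
      also have "\<dots> \<le> exp (L * (real n + 1)) * (exp ((rate q + h) * real n ^ 2) * (2 * exp (- \<epsilon>\<^sup>2 * real n ^ 2)))"
      proof (rule card_UN_le_real[OF finI])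
        fix i assume "i \<in> ?I"
        then obtain p S T where i: "i = (p, S, T)" and p: "p \<in> ?P" and ST: "S \<subseteq> ?V" "T \<subseteq> ?V" "S \<inter> T = {}" "Q S T \<subseteq> cross n p" by blast
        have fin: "finite (cross n p)" by (simp add: cross_def finite_edge_set)
        have "Q S T \<subseteq> all_edges n"
          using ST(4) edge_set_subset[of "{1..n}" n] unfolding cross_def by blast
        then have "real (card (Q S T)) \<le> real (card (all_edges n))"
          by (intro of_nat_mono card_mono finite_all_edges)
        then have M: "real (card (Q S T)) \<le> real n ^ 2" using card_all_edges[of n] by linarith
        show "real (card (?F i)) \<le> exp ((rate q + h) * real n ^ 2) * (2 * exp (- \<epsilon>\<^sup>2 * real n ^ 2))"
          unfolding i prod.case
        proof (rule card_cross_split[where R = "?R S T", OF p q small])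
          have "real (card {B. B \<subseteq> cross n p \<and> ?R S T B}) \<le> 2 * (2 ^ card (cross n p) * exp (- \<epsilon>\<^sup>2 * real n ^ 2))"
            by (rule card_deviating_subsets[OF fin ST(4) M]) (use e in auto)
          then show "real (card {B. B \<subseteq> cross n p \<and> ?R S T B}) \<le> 2 ^ card (cross n p) * (2 * exp (- \<epsilon>\<^sup>2 * real n ^ 2))"
            by (simp only: mult.left_commute)
        qed simp
      next
        have "real (card ?I) \<le> real (card (?P \<times> Pow ?V \<times> Pow ?V))"
          using finP by (intro of_nat_mono card_mono Isub) auto
        also have "\<dots> = real q ^ n * (2 ^ n * 2 ^ n)" by (simp add: card_cartesian_product card_PiE card_Pow)
        also have "\<dots> = (real q * (2 * 2)) ^ n" by (simp only: power_mult_distrib)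
        also have "\<dots> = real (4 * q) ^ n" by (simp add: mult.commute)
        also have "\<dots> \<le> real (4 * q) ^ (n + 1)" using q by (intro power_increasing) auto
        also have "\<dots> = exp (L * real (n + 1))" unfolding exp_of_nat2_mult eL ..
        finally show "real (card ?I) \<le> exp (L * (real n + 1))" by (simp add: add.commute)
      qed simp
      also have "\<dots> \<le> exp (h * real n ^ 2) * (exp ((rate q + h) * real n ^ 2) * exp (- \<epsilon>\<^sup>2 * real n ^ 2))"
      proof -
        have "exp (L * (real n + 1)) * 2 = exp (L * (real n + 1) + ln 2)"
          by (simp add: exp_add)
        also have "\<dots> \<le> exp (C * (real n + 1))" by (simp add: C_def algebra_simps)
        also have "\<dots> \<le> exp (h * real n ^ 2)" using N(2)[OF n] by simp
        finally have "exp (L * (real n + 1)) * 2 * (exp ((rate q + h) * real n ^ 2) * exp (- \<epsilon>\<^sup>2 * real n ^ 2))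
          \<le> exp (h * real n ^ 2) * (exp ((rate q + h) * real n ^ 2) * exp (- \<epsilon>\<^sup>2 * real n ^ 2))"
          by (rule mult_right_mono) simp
        then show ?thesis by (simp only: mult_ac)
      qed
      also have "\<dots> = exp ((rate q - 2 * h) * real n ^ 2)"
        unfolding exp_add[symmetric] by (simp add: h_def algebra_simps)
      finally show ?thesis .
    qed
    then show "\<exists>N. \<forall>n\<ge>N. real (card {G \<in> graphs n. \<exists>p. almost_partite n q \<kappa> p G \<and> \<not> quasirandom n q \<epsilon> p G}) \<le> exp ((rate q - 2 * h) * real n ^ 2)"
      by blast
  qed
qed

section \<open>Concentration and the free energy\<close>

text \<open>Since \<open>n ^ r\<close> with \<open>r \<ge> 3\<close> outgrows \<open>n ^ 2\<close>,
  any exponent \<open>b\<close>, even a negative one, is reached for large \<open>n\<close>. This is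
  the only place where the value of \<open>w r\<close> matters, and it influences \<open>N\<close>
  only.\<close>

lemma mass_many_cliques:
  fixes w\<^sub>0 \<delta> b :: real
  assumes w0: "w\<^sub>0 > 0" and delta: "\<delta> > 0" and r: "r \<ge> 3"
  shows "\<exists>N. \<forall>n l w. n \<ge> N \<and> weight_vector l w \<and> min_index l w = r \<and> w r = w\<^sub>0 \<longrightarrow>
    (\<Sum>G\<in>{G \<in> graphs n. \<not> few_cliques n r \<delta> G}. mc_mass l w n G) \<le> exp (b * real n ^ 2)"
proof -
  define K where "K = w\<^sub>0 * \<delta> / real (r ^ r)"
  have K: "K > 0" using w0 delta r by (simp add: K_def)
  define N where "N = nat \<lceil>\<bar>ln 2 - b\<bar> / K\<rceil> + 1"
  show ?thesis
  proof (intro exI[of _ N] allI impI)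
    fix n l w assume "n \<ge> N \<and> weight_vector l w \<and> min_index l w = r \<and> w r = w\<^sub>0"
    then have n: "n \<ge> N" and w: "weight_vector l w" "min_index l w = r" "w r = w\<^sub>0" by auto
    have n1: "real n \<ge> 1" using n by (simp add: N_def)
    have "\<bar>ln 2 - b\<bar> / K \<le> real n" using n unfolding N_def by linarith
    then have "ln 2 - b \<le> K * real n" using K by (simp add: pos_divide_le_eq mult.commute)
    then have "(ln 2 - b) * real n ^ 2 \<le> K * real n * real n ^ 2" by (rule mult_right_mono) simp
    also have "\<dots> = K * real n ^ 3" by (simp add: power2_eq_square power3_eq_cube)
    also have "\<dots> \<le> K * real n ^ r" using K n1 r by (intro mult_left_mono power_increasing) auto
    finally have main: "ln 2 * real n ^ 2 - K * real n ^ r \<le> b * real n ^ 2" by (simp add: algebra_simps)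
    let ?X = "{G \<in> graphs n. \<not> few_cliques n r \<delta> G}"
    have mass: "mc_mass l w n G \<le> exp (- K * real n ^ r)" if "G \<in> ?X" for G
    proof -
      have "real (card (cliques (adj G) r {1..n})) \<le> real (r ^ r * clique_count n r G)"
        using that by (intro of_nat_mono card_cliques_le_clique_count) simp
      then have "\<delta> * real n ^ r \<le> real (r ^ r) * real (clique_count n r G)"
        using that by (simp add: few_cliques_def)
      then have "\<delta> * real n ^ r / real (r ^ r) \<le> real (clique_count n r G)"
        using r by (simp add: pos_divide_le_eq mult.commute)
      then have "w\<^sub>0 * (\<delta> * real n ^ r / real (r ^ r)) \<le> w\<^sub>0 * real (clique_count n r G)"
        using w0 by (intro mult_left_mono) auto
      then have "- w r * real (clique_count n r G) \<le> - K * real n ^ r" using w(3) by (simp add: K_def)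
      then show ?thesis using mc_mass_le[OF w(1) w(2)[symmetric], of n G] by (meson exp_le_cancel_iff order_trans)
    qed
    have "(\<Sum>G\<in>?X. mc_mass l w n G) \<le> real (card ?X) * exp (- K * real n ^ r)"
      using mass by (rule sum_bounded_above)
    also have "\<dots> \<le> exp (ln 2 * real n ^ 2) * exp (- K * real n ^ r)"
    proof (rule mult_right_mono)
      have "real (card ?X) \<le> real (card (graphs n))"
        by (intro of_nat_mono card_mono finite_graphs) auto
      also have "\<dots> = exp (ln 2 * real (card (all_edges n)))"
        unfolding exp_of_nat2_mult by (simp add: graphs_eq card_Pow finite_all_edges)
      also have "\<dots> \<le> exp (ln 2 * real n ^ 2)" using card_all_edges[of n] by simp
      finally show "real (card ?X) \<le> exp (ln 2 * real n ^ 2)" .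
    qed simp
    also have "\<dots> \<le> exp (b * real n ^ 2)" using main by (simp add: exp_add[symmetric])
    finally show "(\<Sum>G\<in>?X. mc_mass l w n G) \<le> exp (b * real n ^ 2)" .
  qed
qed

lemma sum_mass_le_card:
  assumes "weight_vector l w"
  shows "(\<Sum>G\<in>X. mc_mass l w n G) \<le> real (card X)"
  using sum_bounded_above[of X "mc_mass l w n" 1] mc_mass_le_1[OF assms] by simp

lemma sum_mass_cover_3:
  assumes "X \<subseteq> A \<union> B \<union> C" "finite A" "finite B" "finite C"
  shows "(\<Sum>G\<in>X. mc_mass l w n G) \<le> (\<Sum>G\<in>A. mc_mass l w n G) + (\<Sum>G\<in>B. mc_mass l w n G) + (\<Sum>G\<in>C. mc_mass l w n G)"
proof -
  have nn: "0 \<le> mc_mass l w n G" for G by (rule less_imp_le[OF mc_mass_pos])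
  have "(\<Sum>G\<in>X. mc_mass l w n G) \<le> (\<Sum>G\<in>A \<union> B \<union> C. mc_mass l w n G)"
    using assms nn by (intro sum_mono2) auto
  also have "\<dots> \<le> (\<Sum>G\<in>A \<union> B. mc_mass l w n G) + (\<Sum>G\<in>C. mc_mass l w n G)"
    using assms nn by (subst sum.union_inter[symmetric]) (auto intro: sum_nonneg)
  also have "(\<Sum>G\<in>A \<union> B. mc_mass l w n G) \<le> (\<Sum>G\<in>A. mc_mass l w n G) + (\<Sum>G\<in>B. mc_mass l w n G)"
    using assms nn by (subst sum.union_inter[symmetric]) (auto intro: sum_nonneg)
  finally show ?thesis by simp
qed

text \<open>The combinatorial core common to the cut-distance and the partition statement; each
  follows from it for a suitably smaller \<open>\<epsilon>\<close>.\<close>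

definition structured :: "nat \<Rightarrow> nat \<Rightarrow> real \<Rightarrow> graph \<Rightarrow> bool" where
  "structured n q \<epsilon> G \<longleftrightarrow> (\<exists>p. p ` {1..n} \<subseteq> {1..q} \<and>
     (\<forall>i\<in>{1..q}. \<bar>real (card (color_class n p i)) - real n / real q\<bar> \<le> \<epsilon> * real n) \<and>
     inner_arcs n q p (adj G) \<le> \<epsilon> * real n ^ 2 \<and>
     quasirandom n q \<epsilon> p G)"

text \<open>The square in \<open>\<kappa> \<le> \<epsilon>\<^sup>2\<close> is due to
  \<open>imbalance\<close>, a sum of squares that must bound each class size separately.\<close>

lemma structured_if_almost_partite:
  assumes "almost_partite n q \<kappa> p G" "quasirandom n q \<epsilon> p G" and k: "\<kappa> \<le> \<epsilon>\<^sup>2" "0 < \<epsilon>" "\<epsilon> \<le> 1"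
  shows "structured n q \<epsilon> G"
  unfolding structured_def
proof (intro exI[of _ p] conjI ballI)
  show "p ` {1..n} \<subseteq> {1..q}" using assms(1) by (auto simp: almost_partite_def)
  show "quasirandom n q \<epsilon> p G" by fact
  have le: "\<kappa> \<le> \<epsilon>" using k power2_eq_square[of \<epsilon>] mult_left_le[of \<epsilon> \<epsilon>] by linarith
  have "inner_arcs n q p (adj G) \<le> \<kappa> * real n ^ 2"
    using assms(1) by (simp add: almost_partite_def)
  also have "\<dots> \<le> \<epsilon> * real n ^ 2" using le by (rule mult_right_mono) simp
  finally show "inner_arcs n q p (adj G) \<le> \<epsilon> * real n ^ 2" .
  fix i assume i: "i \<in> {1..q}"
  have "(real (card (color_class n p i)) - real n / real q) ^ 2 \<le> imbalance n q p"
    using i by (intro member_le_sum) auto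
  also have "\<dots> \<le> \<kappa> * real n ^ 2" using assms(1) by (simp add: almost_partite_def)
  also have "\<dots> \<le> \<epsilon>\<^sup>2 * real n ^ 2" using k(1) by (rule mult_right_mono) simp
  also have "\<dots> = (\<epsilon> * real n)\<^sup>2" by (simp add: power_mult_distrib)
  finally show "\<bar>real (card (color_class n p i)) - real n / real q\<bar> \<le> \<epsilon> * real n"
    using k(2) by (simp add: abs_le_square_iff[symmetric])
qed

text \<open>An unstructured graph has many cliques, or few cliques and no good colouring, or a good
  colouring along which it is not quasirandom. The order of quantifiers matters: \<open>c\<close> is
  fixed before \<open>w\<^sub>0\<close>, since only the first family involves
  \<open>w\<^sub>0\<close> and it can be beaten at any rate.\<close>

lemma prob_unstructured:
  assumes r: "r \<ge> 3" and e: "0 < \<epsilon>" "\<epsilon> \<le> 1"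
  shows "\<exists>c>0. \<forall>w\<^sub>0>0. \<exists>N. \<forall>n l w. n \<ge> N \<and> weight_vector l w \<and> min_index l w = r \<and> w r = w\<^sub>0 \<longrightarrow>
    mc_prob l w n {G \<in> graphs n. \<not> structured n (r - 1) \<epsilon> G} \<le> exp (- c * real n ^ 2)"
proof -
  define q where "q = r - 1"
  have q: "q \<ge> 1" "Suc q = r" using r by (auto simp: q_def)
  obtain \<kappa>\<^sub>0 c1 where k0: "\<kappa>\<^sub>0 > 0" "c1 > 0" and nq: "\<And>\<kappa>. \<kappa> \<le> \<kappa>\<^sub>0 \<Longrightarrow> \<exists>N. \<forall>n\<ge>N.
    real (card {G \<in> graphs n. \<exists>p. almost_partite n q \<kappa> p G \<and> \<not> quasirandom n q \<epsilon> p G}) \<le> exp ((rate q - c1) * real n ^ 2)"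
    using count_not_quasirandom[OF q(1) e] by blast
  define \<kappa> where "\<kappa> = min \<kappa>\<^sub>0 (\<epsilon>\<^sup>2)"
  have kap: "\<kappa> > 0" "\<kappa> \<le> \<epsilon>\<^sup>2" "\<kappa> \<le> \<kappa>\<^sub>0" using k0 e by (auto simp: \<kappa>_def)
  obtain N1 where N1: "\<And>n. n \<ge> N1 \<Longrightarrow> real (card {G \<in> graphs n. \<exists>p. almost_partite n q \<kappa> p G \<and> \<not> quasirandom n q \<epsilon> p G}) \<le> exp ((rate q - c1) * real n ^ 2)"
    using nq[OF kap(3)] by blast
  obtain \<delta> c2 N2 where d: "\<delta> > 0" "c2 > 0" and N2: "\<And>n. n \<ge> N2 \<Longrightarrow>
    real (card {G \<in> graphs n. few_cliques n (Suc q) \<delta> G \<and> \<not> (\<exists>p. almost_partite n q \<kappa> p G)}) \<le> exp ((rate q - c2) * real n ^ 2)"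
    using count_few_cliques[OF q(1) kap(1)] by blast
  define c where "c = min c1 c2"
  have c: "c > 0" "c \<le> c1" "c \<le> c2" using k0 d by (auto simp: c_def)
  \<comment> \<open>Half of the rate absorbs the factor 3 and the factor \<open>2 ^ n\<close> lost
    in the lower bound for \<open>mc_Z\<close>.\<close>
  have "mc_prob l w n {G \<in> graphs n. \<not> structured n (r - 1) \<epsilon> G} \<le> exp (- (c / 2) * real n ^ 2)"
    if n: "n \<ge> max (max N1 N2) (max N3 N4)" and w: "weight_vector l w" "min_index l w = r" "w r = w\<^sub>0"
      and N3: "\<And>n l w. n \<ge> N3 \<and> weight_vector l w \<and> min_index l w = r \<and> w r = w\<^sub>0 \<Longrightarrow>
        (\<Sum>G\<in>{G \<in> graphs n. \<not> few_cliques n r \<delta> G}. mc_mass l w n G) \<le> exp ((rate q - c) * real n ^ 2)"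
      and N4: "\<And>n. n \<ge> N4 \<Longrightarrow> (ln 3 + ln 2) * (real n + 1) \<le> c / 2 * real n ^ 2"
    for l w n N3 N4 w\<^sub>0
  proof -
    let ?X1 = "{G \<in> graphs n. \<not> few_cliques n r \<delta> G}"
    let ?X2 = "{G \<in> graphs n. few_cliques n (Suc q) \<delta> G \<and> \<not> (\<exists>p. almost_partite n q \<kappa> p G)}"
    let ?X3 = "{G \<in> graphs n. \<exists>p. almost_partite n q \<kappa> p G \<and> \<not> quasirandom n q \<epsilon> p G}"
    let ?B = "exp ((rate q - c) * real n ^ 2)"
    have up: "exp ((rate q - c') * real n ^ 2) \<le> ?B" if "c \<le> c'" for c'
      using that by (simp add: mult_right_mono)
    have "{G \<in> graphs n. \<not> structured n (r - 1) \<epsilon> G} \<subseteq> ?X1 \<union> ?X2 \<union> ?X3"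
    proof
      fix G assume "G \<in> {G \<in> graphs n. \<not> structured n (r - 1) \<epsilon> G}"
      then have G: "G \<in> graphs n" "\<not> structured n q \<epsilon> G" by (auto simp: q_def)
      then have "\<not> quasirandom n q \<epsilon> p G" if "almost_partite n q \<kappa> p G" for p
        using structured_if_almost_partite[OF that _ kap(2) e] by blast
      then show "G \<in> ?X1 \<union> ?X2 \<union> ?X3" using G(1) unfolding q(2) by blast
    qed
    then have "(\<Sum>G\<in>{G \<in> graphs n. \<not> structured n (r - 1) \<epsilon> G}. mc_mass l w n G) \<le>
      (\<Sum>G\<in>?X1. mc_mass l w n G) + (\<Sum>G\<in>?X2. mc_mass l w n G) + (\<Sum>G\<in>?X3. mc_mass l w n G)"
      by (rule sum_mass_cover_3) (simp_all add: finite_graphs)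
    also have "\<dots> \<le> ?B + ?B + ?B"
    proof (intro add_mono)
      show "(\<Sum>G\<in>?X1. mc_mass l w n G) \<le> ?B" using N3[of n l w] w n by simp
      have "(\<Sum>G\<in>?X2. mc_mass l w n G) \<le> exp ((rate q - c2) * real n ^ 2)"
        using N2[of n] n sum_mass_le_card[OF w(1), of n ?X2] by simp
      then show "(\<Sum>G\<in>?X2. mc_mass l w n G) \<le> ?B" using up[OF c(3)] by linarith
      have "(\<Sum>G\<in>?X3. mc_mass l w n G) \<le> exp ((rate q - c1) * real n ^ 2)"
        using N1[of n] n sum_mass_le_card[OF w(1), of n ?X3] by simp
      then show "(\<Sum>G\<in>?X3. mc_mass l w n G) \<le> ?B" using up[OF c(2)] by linarith
    qed
    also have "\<dots> = exp (ln 3) * ?B" by simp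
    finally have num: "(\<Sum>G\<in>{G \<in> graphs n. \<not> structured n (r - 1) \<epsilon> G}. mc_mass l w n G) \<le> exp (ln 3) * ?B" .
    have Z: "exp (rate q * real n ^ 2 - ln 2 * real n) \<le> mc_Z l w n"
      using mc_Z_ge_partite[OF w(1), of q n] w(2) q_def by (simp add: rate_def algebra_simps)
    have "mc_prob l w n {G \<in> graphs n. \<not> structured n (r - 1) \<epsilon> G} \<le> exp (ln 3) * ?B / exp (rate q * real n ^ 2 - ln 2 * real n)"
      unfolding mc_prob_def by (rule frac_le[OF _ num _ Z]) auto
    also have "\<dots> = exp (ln 3 + ln 2 * real n - c * real n ^ 2)"
      unfolding exp_add[symmetric] exp_diff[symmetric] by (simp add: algebra_simps)
    also have "\<dots> \<le> exp (- (c / 2) * real n ^ 2)"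
    proof -
      have "ln 3 + ln 2 * real n \<le> (ln 3 + ln 2) * (real n + 1)" by (simp add: algebra_simps)
      then show ?thesis using N4[of n] n by simp
    qed
    finally show ?thesis .
  qed
  note bound = this
  have half: "c / 2 > 0" "ln 3 + ln 2 \<ge> (0 :: real)" using c by simp_all
  obtain N4 where N4: "\<And>n. n \<ge> N4 \<Longrightarrow> (ln 3 + ln 2) * (real n + 1) \<le> c / 2 * real n ^ 2"
    using linear_le_quadratic[OF half] by blast
  show ?thesis
  proof (intro exI[of _ "c / 2"] conjI allI impI half(1))
    fix w\<^sub>0 :: real assume w0: "w\<^sub>0 > 0"
    obtain N3 where N3: "\<And>n l w. n \<ge> N3 \<and> weight_vector l w \<and> min_index l w = r \<and> w r = w\<^sub>0 \<Longrightarrow>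
        (\<Sum>G\<in>{G \<in> graphs n. \<not> few_cliques n r \<delta> G}. mc_mass l w n G) \<le> exp ((rate q - c) * real n ^ 2)"
      using mass_many_cliques[OF w0 d(1) r, of "rate q - c"] by blast
    show "\<exists>N. \<forall>n l w. n \<ge> N \<and> weight_vector l w \<and> min_index l w = r \<and> w r = w\<^sub>0 \<longrightarrow>
      mc_prob l w n {G \<in> graphs n. \<not> structured n (r - 1) \<epsilon> G} \<le> exp (- (c / 2) * real n ^ 2)"
      using bound[OF _ _ _ _ N3 N4] by blast
  qed
qed

text \<open>For the upper bound, graphs with many cliques can be pushed below any rate, those with
  few cliques and no good colouring are fewer than \<open>exp (rate q * n ^ 2)\<close>, and the
  almost partite ones exceed this number by at most \<open>exp (h * n ^ 2)\<close>.\<close>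

lemma free_energy_limit:
  assumes w: "weight_vector l w"
  shows "mc_free_energy l w \<longlonglongrightarrow> ln 2 / 2 * (1 - 1 / (real (min_index l w) - 1))"
proof -
  define r where "r = min_index l w"
  define q where "q = r - 1"
  have r: "r \<ge> 3" "w r > 0" using min_index[OF w] by (auto simp: r_def)
  have q: "q \<ge> 1" "Suc q = r" using r by (auto simp: q_def)
  have rate: "rate q = ln 2 / 2 * (1 - 1 / (real (min_index l w) - 1))"
    using r by (simp add: rate_def q_def r_def of_nat_diff)
  have "\<forall>\<^sub>F n in sequentially. dist (mc_free_energy l w n) (rate q) < e" if e: "e > 0" for e
  proof -
    define h where "h = e / 4"
    have h: "h > 0" using e by (simp add: h_def)
    obtain \<kappa> N1 where kap: "\<kappa> > 0" and N1: "\<And>n. n \<ge> N1 \<Longrightarrow>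
      real (card {G \<in> graphs n. \<exists>p. almost_partite n q \<kappa> p G}) \<le> exp ((rate q + h) * real n ^ 2)"
      using count_almost_partite[OF q(1) h] by blast
    obtain \<delta> c2 N2 where d: "\<delta> > 0" "c2 > 0" and N2: "\<And>n. n \<ge> N2 \<Longrightarrow>
      real (card {G \<in> graphs n. few_cliques n (Suc q) \<delta> G \<and> \<not> (\<exists>p. almost_partite n q \<kappa> p G)}) \<le> exp ((rate q - c2) * real n ^ 2)"
      using count_few_cliques[OF q(1) kap] by blast
    obtain N3 where N3: "\<And>n l w'. n \<ge> N3 \<and> weight_vector l w' \<and> min_index l w' = r \<and> w' r = w r \<Longrightarrow>
        (\<Sum>G\<in>{G \<in> graphs n. \<not> few_cliques n r \<delta> G}. mc_mass l w' n G) \<le> exp ((rate q + h) * real n ^ 2)"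
      using mass_many_cliques[OF r(2) d(1) r(1), of "rate q + h"] by blast
    have nn: "ln 3 + ln 2 \<ge> (0 :: real)" by simp
    obtain N4 where N4: "N4 \<ge> 1" "\<And>n. n \<ge> N4 \<Longrightarrow> (ln 3 + ln 2) * (real n + 1) \<le> h * real n ^ 2"
      using linear_le_quadratic[OF h nn] by blast
    have "dist (mc_free_energy l w n) (rate q) < e" if n: "n \<ge> max (max N1 N2) (max N3 N4)" for n
    proof -
      let ?X1 = "{G \<in> graphs n. \<not> few_cliques n r \<delta> G}"
      let ?X2 = "{G \<in> graphs n. few_cliques n (Suc q) \<delta> G \<and> \<not> (\<exists>p. almost_partite n q \<kappa> p G)}"
      let ?X3 = "{G \<in> graphs n. \<exists>p. almost_partite n q \<kappa> p G}"
      let ?B = "exp ((rate q + h) * real n ^ 2)"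
      have n0: "real n > 0" using n N4 by simp
      have "mc_Z l w n \<le> (\<Sum>G\<in>?X1. mc_mass l w n G) + (\<Sum>G\<in>?X2. mc_mass l w n G) + (\<Sum>G\<in>?X3. mc_mass l w n G)"
        unfolding mc_Z_def by (rule sum_mass_cover_3) (use q in \<open>auto simp: finite_graphs\<close>)
      also have "\<dots> \<le> ?B + ?B + ?B"
      proof (intro add_mono)
        show "(\<Sum>G\<in>?X1. mc_mass l w n G) \<le> ?B" using N3[of n l w] w n by (simp add: r_def)
        have "(\<Sum>G\<in>?X2. mc_mass l w n G) \<le> exp ((rate q - c2) * real n ^ 2)"
          using N2[of n] n sum_mass_le_card[OF w, of n ?X2] by simp
        also have "\<dots> \<le> ?B" using h d by (simp add: mult_right_mono)
        finally show "(\<Sum>G\<in>?X2. mc_mass l w n G) \<le> ?B" .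
        show "(\<Sum>G\<in>?X3. mc_mass l w n G) \<le> ?B"
          using N1[of n] n sum_mass_le_card[OF w, of n ?X3] by simp
      qed
      also have "\<dots> = exp (ln 3 + (rate q + h) * real n ^ 2)" by (simp add: exp_add)
      finally have "ln (mc_Z l w n) \<le> ln (exp (ln 3 + (rate q + h) * real n ^ 2))"
        using mc_Z_pos[of l w n] by (subst ln_le_cancel_iff) auto
      then have "ln (mc_Z l w n) \<le> ln 3 + (rate q + h) * real n ^ 2" by simp
      moreover have "ln 3 \<le> h * real n ^ 2"
      proof -
        have "ln 3 \<le> (ln 3 + ln 2) * (real n + 1)" by (simp add: algebra_simps)
        then show ?thesis using N4(2)[of n] n by simp
      qed
      ultimately have up: "ln (mc_Z l w n) \<le> (rate q + 2 * h) * real n ^ 2" by (simp add: algebra_simps)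
      have "exp (rate q * real n ^ 2 - ln 2 * real n) \<le> mc_Z l w n"
        using mc_Z_ge_partite[OF w, of q n] q_def r_def by (simp add: rate_def algebra_simps)
      then have "rate q * real n ^ 2 - ln 2 * real n \<le> ln (mc_Z l w n)"
        using mc_Z_pos[of l w n] by (simp add: ln_ge_iff)
      moreover have "ln 2 * real n \<le> h * real n ^ 2"
      proof -
        have "ln 2 * real n \<le> (ln 3 + ln 2) * (real n + 1)" by (simp add: algebra_simps)
        then show ?thesis using N4(2)[of n] n by simp
      qed
      ultimately have lo: "(rate q - h) * real n ^ 2 \<le> ln (mc_Z l w n)" by (simp add: algebra_simps)
      have "rate q - h \<le> mc_free_energy l w n" "mc_free_energy l w n \<le> rate q + 2 * h"
        unfolding mc_free_energy_def using lo up n0 by (simp_all add: pos_le_divide_eq pos_divide_le_eq)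
      then show ?thesis using e by (auto simp: dist_real_def h_def abs_le_iff abs_less_iff)
    qed
    then show ?thesis unfolding eventually_sequentially by blast
  qed
  then show ?thesis unfolding rate[symmetric] by (rule tendstoI)
qed

section \<open>Step functions and the cut norm of graphons\<close>

text \<open>Lebesgue measure on the plane is the completion of the Borel product measure, so
  products of Lebesgue sets need an argument: they are sandwiched between two Borel rectangles of
  the same finite measure.\<close>

lemma lebesgue_Times:
  fixes S T :: "real set"
  assumes S: "S \<in> sets lebesgue" "emeasure lebesgue S < \<infinity>" and T: "T \<in> sets lebesgue" "emeasure lebesgue T < \<infinity>"
  shows "S \<times> T \<in> sets lebesgue" and "emeasure lebesgue (S \<times> T) = emeasure lebesgue S * emeasure lebesgue T"
proof -
  have borel: "A \<times> B \<in> sets lborel \<and> emeasure lborel (A \<times> B) = emeasure lborel A * emeasure lborel B"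
    if "A \<in> sets lborel" "B \<in> sets lborel" for A B :: "real set"
  proof -
    have "A \<times> B \<in> sets (lborel \<Otimes>\<^sub>M lborel)" using that by (rule pair_measureI)
    moreover have "emeasure (lborel \<Otimes>\<^sub>M lborel) (A \<times> B) = emeasure lborel A * emeasure lborel B"
      using that by (rule lborel.emeasure_pair_measure_Times)
    ultimately show ?thesis unfolding lborel_prod by blast
  qed
  obtain U where U: "S \<subseteq> U" "U \<in> sets lborel" "U - S \<in> null_sets lebesgue" "emeasure lebesgue S = emeasure lborel U"
    by (rule completion_upper[OF S(1)])
  obtain V where V: "T \<subseteq> V" "V \<in> sets lborel" "V - T \<in> null_sets lebesgue" "emeasure lebesgue T = emeasure lborel V"
    by (rule completion_upper[OF T(1)])
  define L where "L = main_part lborel S"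
  define M where "M = main_part lborel T"
  have L: "L \<subseteq> S" "L \<in> sets lborel" "emeasure lebesgue S = emeasure lborel L"
    unfolding L_def using main_part_null_part_Un[OF S(1)] main_part_sets[OF S(1)] emeasure_completion[OF S(1)] by blast+
  have M: "M \<subseteq> T" "M \<in> sets lborel" "emeasure lebesgue T = emeasure lborel M"
    unfolding M_def using main_part_null_part_Un[OF T(1)] main_part_sets[OF T(1)] emeasure_completion[OF T(1)] by blast+
  have LM: "emeasure lebesgue (L \<times> M) = emeasure lebesgue S * emeasure lebesgue T" "L \<times> M \<in> sets lebesgue"
    using borel[OF L(2) M(2)] L(3) M(3) by auto
  have UV: "emeasure lebesgue (U \<times> V) = emeasure lebesgue S * emeasure lebesgue T" "U \<times> V \<in> sets lebesgue"
    using borel[OF U(2) V(2)] U(4) V(4) by auto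
  show ST: "S \<times> T \<in> sets lebesgue"
  proof (rule completion.complete_sets_sandwich[OF LM(2) UV(2)])
    show "emeasure lebesgue (L \<times> M) < \<infinity>" unfolding LM(1) using S(2) T(2) by (simp add: ennreal_mult_less_top)
  qed (use L M U V LM UV in auto)
  have "emeasure lebesgue (L \<times> M) \<le> emeasure lebesgue (S \<times> T)"
    using ST L M by (intro emeasure_mono) auto
  moreover have "emeasure lebesgue (S \<times> T) \<le> emeasure lebesgue (U \<times> V)"
    using UV U V by (intro emeasure_mono) auto
  ultimately show "emeasure lebesgue (S \<times> T) = emeasure lebesgue S * emeasure lebesgue T"
    using LM UV by simp
qed

lemma unit_lebesgue_sets:
  assumes "S \<in> sets unit_lebesgue"
  shows "S \<subseteq> {0..1}" "S \<in> sets lebesgue"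
  using assms by (auto simp: sets_restrict_space)

lemma emeasure_unit_finite:
  assumes "S \<subseteq> {0..1 :: real}"
  shows "emeasure lebesgue S < \<infinity>"
proof -
  have "emeasure lebesgue S \<le> emeasure lebesgue {0..1 :: real}" using assms by (intro emeasure_mono) auto
  also have "\<dots> < \<infinity>" by simp
  finally show ?thesis .
qed

lemma measure_unit_Times:
  fixes S T :: "real set"
  assumes "S \<in> sets lebesgue" "S \<subseteq> {0..1}" "T \<in> sets lebesgue" "T \<subseteq> {0..1}"
  shows "S \<times> T \<in> lmeasurable" "measure lebesgue (S \<times> T) = measure lebesgue S * measure lebesgue T"
proof -
  note fin = emeasure_unit_finite[OF assms(2)] emeasure_unit_finite[OF assms(4)]
  note lt = lebesgue_Times[OF assms(1) fin(1) assms(3) fin(2)]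
  show "S \<times> T \<in> lmeasurable"
    using lt fin by (intro fmeasurableI) (auto simp: ennreal_mult_less_top)
  show "measure lebesgue (S \<times> T) = measure lebesgue S * measure lebesgue T"
    by (simp add: measure_def lt(2) enn2real_mult)
qed

section \<open>Cells and step functions\<close>

definition cell_index :: "nat \<Rightarrow> real \<Rightarrow> nat" where
  "cell_index N x = min N (nat \<lfloor>x * real N\<rfloor> + 1)"

lemma cell_index_range: "N \<ge> 1 \<Longrightarrow> cell_index N x \<in> {1..N}"
  by (auto simp: cell_index_def)

lemma cell_iff_index:
  assumes N: "N \<ge> 1" and x: "x \<in> {0..1}" and i: "i \<in> {1..N}"
  shows "x \<in> cell N i \<longleftrightarrow> cell_index N x = i"
proof -
  have Np: "real N > 0" using N by simp
  have xN: "0 \<le> x * real N" "x * real N \<le> real N" using x by (auto simp: mult_left_le_one_le)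
  show ?thesis
  proof (cases "i < N")
    case True
    have "x \<in> cell N i \<longleftrightarrow> real i - 1 \<le> x * real N \<and> x * real N < real i"
      using True Np by (simp add: cell_def field_simps)
    also have "\<dots> \<longleftrightarrow> nat \<lfloor>x * real N\<rfloor> = i - 1"
      using i xN(1) by (auto simp: of_nat_diff) linarith+
    also have "\<dots> \<longleftrightarrow> cell_index N x = i" using i True by (auto simp: cell_index_def)
    finally show ?thesis .
  next
    case False
    then have iN: "i = N" using i by simp
    have "x \<in> cell N i \<longleftrightarrow> real N - 1 \<le> x * real N"
      using iN Np x by (simp add: cell_def field_simps)
    also have "\<dots> \<longleftrightarrow> N \<le> nat \<lfloor>x * real N\<rfloor> + 1"
      using xN(1) N by linarith
    also have "\<dots> \<longleftrightarrow> cell_index N x = i" using iN by (auto simp: cell_index_def)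
    finally show ?thesis .
  qed
qed

lemma cell_subset:
  assumes "i \<in> {1..N}"
  shows "cell N i \<subseteq> {0..1}"
proof -
  have "real i - 1 \<ge> 0" "real i \<le> real N" "real N > 0" using assms by auto
  then have lo: "0 \<le> (real i - 1) / real N" "0 \<le> (real N - 1) / real N" and "real i / real N \<le> 1" by simp_all
  then have "x \<le> 1" if "x < real i / real N" for x using that by linarith
  with lo show ?thesis by (auto simp: cell_def split: if_splits)
qed

lemma cell_borel [measurable]: "cell N i \<in> sets borel"
  by (simp add: cell_def)

lemma measure_cell: "i \<in> {1..N} \<Longrightarrow> measure lebesgue (cell N i) = 1 / real N"
  by (auto simp: cell_def divide_simps)

text \<open>The \<open>n * q\<close> cells refine the \<open>n\<close> cells. The \<open>min\<close>
  in \<open>cell_index\<close> puts the point 1 into the last cell at both levels; this is the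
  second case of the proof.\<close>

lemma cell_index_refine:
  assumes "n \<ge> 1" "q \<ge> 1" "x \<in> {0..1}"
  shows "cell_index n x = (cell_index (n * q) x - 1) div q + 1"
proof -
  have "\<lfloor>x * real n\<rfloor> = \<lfloor>(x * real (n * q)) / real_of_int (int q)\<rfloor>"
    using assms by simp
  also have "\<dots> = \<lfloor>x * real (n * q)\<rfloor> div int q" by (rule floor_divide_real_eq_div) simp
  finally have "nat \<lfloor>x * real n\<rfloor> = nat \<lfloor>x * real (n * q)\<rfloor> div q"
    using assms by (simp add: nat_div_distrib)
  moreover have "(min (n * q) (m + 1) - 1) div q + 1 = min n (m div q + 1)" for m
  proof (cases "m + 1 \<le> n * q")
    case True
    then have "m div q < n" using assms by (simp add: less_mult_imp_div_less)
    then show ?thesis using True by simp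
  next
    case False
    then have "n \<le> m div q" using assms by (simp add: less_eq_div_iff_mult_less_eq)
    moreover have "(n * q - 1) div q = n - 1"
    proof -
      have "n * q - 1 = (q - 1) + (n - 1) * q" using assms by (cases n) auto
      also have "\<dots> div q = (n - 1) + (q - 1) div q" by (rule div_mult_self1) (use assms in simp)
      finally show ?thesis using assms by simp
    qed
    ultimately show ?thesis using False assms by simp
  qed
  ultimately show ?thesis by (simp add: cell_index_def)
qed

text \<open>As a sum of indicators the function is visibly measurable; its pointwise value on the
  square is recovered by \<open>step_fun_eq\<close>.\<close>

definition step_fun :: "nat \<Rightarrow> (nat \<Rightarrow> nat \<Rightarrow> real) \<Rightarrow> real \<times> real \<Rightarrow> real" where
  "step_fun N d p = (\<Sum>s\<in>{1..N}. \<Sum>t\<in>{1..N}. d s t * indicator (cell N s \<times> cell N t) p)"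

lemma step_fun_eq:
  assumes N: "N \<ge> 1" and xy: "x \<in> {0..1}" "y \<in> {0..1}"
  shows "step_fun N d (x, y) = d (cell_index N x) (cell_index N y)"
proof -
  have pick: "(\<Sum>t\<in>{1..N}. of_bool (t = k) * g t) = g k" if "k \<in> {1..N}" for k and g :: "nat \<Rightarrow> real"
  proof -
    have "(\<Sum>t\<in>{1..N}. of_bool (t = k) * g t) = (\<Sum>t\<in>{1..N}. if t = k then g t else 0)"
      by (intro sum.cong) auto
    also have "\<dots> = g k" by (subst sum.delta) (use that in auto)
    finally show ?thesis .
  qed
  have "indicator (cell N s \<times> cell N t) (x, y) = (of_bool (s = cell_index N x) * of_bool (t = cell_index N y) :: real)"
    if "s \<in> {1..N}" "t \<in> {1..N}" for s t
    using cell_iff_index[OF N xy(1) that(1)] cell_iff_index[OF N xy(2) that(2)] by (auto simp: indicator_def)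
  then have "step_fun N d (x, y) = (\<Sum>s\<in>{1..N}. \<Sum>t\<in>{1..N}. d s t * (of_bool (s = cell_index N x) * of_bool (t = cell_index N y)))"
    unfolding step_fun_def by (intro sum.cong refl) simp
  also have "\<dots> = (\<Sum>s\<in>{1..N}. of_bool (s = cell_index N x) * (\<Sum>t\<in>{1..N}. of_bool (t = cell_index N y) * d s t))"
    by (simp only: sum_distrib_left mult_ac)
  also have "\<dots> = d (cell_index N x) (cell_index N y)"
    by (simp only: pick[OF cell_index_range[OF N]])
  finally show ?thesis .
qed

lemma step_fun_borel [measurable]: "step_fun N d \<in> borel_measurable borel"
proof -
  have "cell N s \<times> cell N t \<in> sets borel" for s t
    by (rule borel_Times) (rule cell_borel)+
  then show ?thesis unfolding step_fun_def[abs_def] by measurable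
qed

text \<open>\<open>U\<close> has to agree with a step function on the square only, so the lemma
  applies to the difference of an empirical graphon and a step function.\<close>

lemma integral_step_fun:
  assumes N: "N \<ge> 1" and S: "S \<in> sets unit_lebesgue" and T: "T \<in> sets unit_lebesgue"
    and U: "\<And>x y. x \<in> {0..1} \<Longrightarrow> y \<in> {0..1} \<Longrightarrow> U (x, y) = d (cell_index N x) (cell_index N y)"
  shows "(LINT p:S \<times> T|lebesgue. U p) =
    (\<Sum>s\<in>{1..N}. \<Sum>t\<in>{1..N}. measure lebesgue (S \<inter> cell N s) * measure lebesgue (T \<inter> cell N t) * d s t)"
proof -
  note S' = unit_lebesgue_sets[OF S] and T' = unit_lebesgue_sets[OF T]
  have pw: "indicator (S \<times> T) p *\<^sub>R U p = (\<Sum>s\<in>{1..N}. \<Sum>t\<in>{1..N}. d s t * indicator ((S \<inter> cell N s) \<times> (T \<inter> cell N t)) p)" for p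
  proof (cases "p \<in> S \<times> T")
    case True
    then obtain x y where p: "p = (x, y)" "x \<in> S" "y \<in> T" by auto
    then have xy: "x \<in> {0..1}" "y \<in> {0..1}" using S' T' by auto
    have "U p = step_fun N d p" using U[OF xy] step_fun_eq[OF N xy, of d] p by simp
    then show ?thesis using True by (simp add: step_fun_def indicator_def p)
  next
    case False
    then have "indicator ((S \<inter> cell N s) \<times> (T \<inter> cell N t)) p = (0 :: real)" for s t by (auto simp: indicator_def)
    then show ?thesis using False by simp
  qed
  have cm: "(S \<inter> cell N s) \<times> (T \<inter> cell N t) \<in> lmeasurable"
    "measure lebesgue ((S \<inter> cell N s) \<times> (T \<inter> cell N t)) = measure lebesgue (S \<inter> cell N s) * measure lebesgue (T \<inter> cell N t)" for s t
  proof -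
    have "cell N i \<in> sets lebesgue" for i using cell_borel[of N i] by auto
    then have "S \<inter> cell N s \<in> sets lebesgue" "T \<inter> cell N t \<in> sets lebesgue" using S' T' by auto
    then show "(S \<inter> cell N s) \<times> (T \<inter> cell N t) \<in> lmeasurable"
      "measure lebesgue ((S \<inter> cell N s) \<times> (T \<inter> cell N t)) = measure lebesgue (S \<inter> cell N s) * measure lebesgue (T \<inter> cell N t)"
      using S' T' by (intro measure_unit_Times; auto)+
  qed
  have int: "integrable lebesgue (\<lambda>p. d s t * indicator ((S \<inter> cell N s) \<times> (T \<inter> cell N t)) p)"
    "(\<integral>p. d s t * indicator ((S \<inter> cell N s) \<times> (T \<inter> cell N t)) p \<partial>lebesgue) =
      d s t * measure lebesgue ((S \<inter> cell N s) \<times> (T \<inter> cell N t))" for s t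
  proof -
    let ?C = "(S \<inter> cell N s) \<times> (T \<inter> cell N t)"
    have "has_bochner_integral lebesgue (indicator ?C :: _ \<Rightarrow> real) (measure lebesgue ?C)"
      using cm(1)[of s t] by (intro has_bochner_integral_real_indicator) (auto simp: fmeasurable_def)
    then have "has_bochner_integral lebesgue (\<lambda>p. d s t * indicator ?C p) (d s t * measure lebesgue ?C)"
      by (rule has_bochner_integral_mult_right)
    then show "integrable lebesgue (\<lambda>p. d s t * indicator ?C p)"
      "(\<integral>p. d s t * indicator ?C p \<partial>lebesgue) = d s t * measure lebesgue ?C"
      by (auto simp: has_bochner_integral_iff)
  qed
  have "(LINT p:S \<times> T|lebesgue. U p) = (\<integral>p. (\<Sum>s\<in>{1..N}. \<Sum>t\<in>{1..N}. d s t * indicator ((S \<inter> cell N s) \<times> (T \<inter> cell N t)) p) \<partial>lebesgue)"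
    unfolding set_lebesgue_integral_def pw ..
  also have "\<dots> = (\<Sum>s\<in>{1..N}. \<Sum>t\<in>{1..N}. d s t * measure lebesgue ((S \<inter> cell N s) \<times> (T \<inter> cell N t)))"
    by (simp only: Bochner_Integration.integral_sum Bochner_Integration.integrable_sum int)
  finally show ?thesis unfolding cm(2) by (simp add: mult_ac)
qed

section \<open>Bounds for the cut norm and the cut distance\<close>

lemma cut_norm_bdd:
  fixes U :: "real \<times> real \<Rightarrow> real"
  assumes "\<And>p. p \<in> unit_square \<Longrightarrow> \<bar>U p\<bar> \<le> 1"
  shows "bdd_above ((\<lambda>(S, T). \<bar>LINT p:S \<times> T|lebesgue. U p\<bar>) ` (sets unit_lebesgue \<times> sets unit_lebesgue))"
proof (rule bdd_aboveI2)
  fix ST assume "ST \<in> sets unit_lebesgue \<times> sets unit_lebesgue"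
  then obtain S T where ST: "ST = (S, T)" and m: "S \<in> sets unit_lebesgue" "T \<in> sets unit_lebesgue"
    by blast
  note sub = unit_lebesgue_sets(1)[OF m(1)] unit_lebesgue_sets(1)[OF m(2)]
  have sq: "unit_square \<in> lmeasurable" "measure lebesgue unit_square = 1"
    using measure_unit_Times[of "{0..1}" "{0..1}"] by auto
  have "\<bar>LINT p:S \<times> T|lebesgue. U p\<bar> \<le> (\<integral>p. \<bar>indicator (S \<times> T) p *\<^sub>R U p\<bar> \<partial>lebesgue)"
    unfolding set_lebesgue_integral_def
    using integral_norm_bound[of lebesgue "\<lambda>p. indicator (S \<times> T) p *\<^sub>R U p"] by (simp only: real_norm_def)
  also have "\<dots> \<le> (\<integral>p. indicator unit_square p \<partial>lebesgue)"
  proof (rule integral_mono')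
    show "integrable lebesgue (indicator unit_square :: _ \<Rightarrow> real)"
      by (rule integrable_real_indicator) (use sq in \<open>auto simp: fmeasurable_def\<close>)
    show "\<bar>indicator (S \<times> T) p *\<^sub>R U p\<bar> \<le> indicator unit_square p" for p
      using assms[of p] sub by (auto simp: indicator_def)
  qed simp
  also have "\<dots> = 1" using sq by simp
  finally show "(case ST of (S, T) \<Rightarrow> \<bar>LINT p:S \<times> T|lebesgue. U p\<bar>) \<le> 1" by (simp add: ST)
qed

lemma cut_norm_nonneg:
  assumes "\<And>p. p \<in> unit_square \<Longrightarrow> \<bar>U p\<bar> \<le> 1"
  shows "0 \<le> cut_norm U"
  unfolding cut_norm_def
  by (rule cSUP_upper2[where x = "({}, {})", OF cut_norm_bdd[OF assms]]) auto

lemma cut_norm_le: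
  assumes "\<And>S T. S \<in> sets unit_lebesgue \<Longrightarrow> T \<in> sets unit_lebesgue \<Longrightarrow> \<bar>LINT p:S \<times> T|lebesgue. U p\<bar> \<le> K"
  shows "cut_norm U \<le> K"
  unfolding cut_norm_def by (rule cSUP_least) (use assms in \<open>auto intro: sets.empty_sets\<close>)

lemma unit_automorphism_id: "unit_automorphism id"
proof -
  have "inv_into {0..1} id \<in> measurable unit_lebesgue unit_lebesgue \<longleftrightarrow> (id :: real \<Rightarrow> real) \<in> measurable unit_lebesgue unit_lebesgue"
    by (rule measurable_cong) (simp add: inv_into_f_f[of id, simplified])
  moreover have "distr unit_lebesgue unit_lebesgue id = unit_lebesgue"
    unfolding id_def by (rule distr_id)
  ultimately show ?thesis by (simp add: unit_automorphism_def)
qed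

text \<open>The identity is an admissible automorphism. Most of the work is to show that the cut
  norms and distances involved are nonnegative, since a real infimum is a lower bound only for sets
  bounded below.\<close>

lemma cut_dist_set_le_cut_norm:
  assumes W: "\<And>p. p \<in> unit_square \<Longrightarrow> 0 \<le> W p \<and> W p \<le> 1" and V: "V \<in> B_star q"
  shows "cut_dist_set W (B_star q) \<le> cut_norm (\<lambda>p. W p - V p)"
proof -
  have nn: "0 \<le> cut_norm (\<lambda>(x, y). W (x, y) - V' (\<phi> x, \<phi> y))" if V': "V' \<in> B_star q" and phi: "unit_automorphism \<phi>" for V' \<phi>
  proof (rule cut_norm_nonneg)
    fix p :: "real \<times> real" assume p: "p \<in> unit_square"
    have "\<phi> x \<in> {0..1}" if "x \<in> {0..1}" for x
      using phi that unfolding unit_automorphism_def bij_betw_def by blast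
    then have "(\<phi> (fst p), \<phi> (snd p)) \<in> unit_square" using p by (simp add: mem_Times_iff)
    moreover have "graphon V'" using V' by (simp only: B_star_def mem_Collect_eq)
    ultimately have "0 \<le> V' (\<phi> (fst p), \<phi> (snd p)) \<and> V' (\<phi> (fst p), \<phi> (snd p)) \<le> 1"
      unfolding graphon_def by blast
    then show "\<bar>case p of (x, y) \<Rightarrow> W (x, y) - V' (\<phi> x, \<phi> y)\<bar> \<le> 1"
      using W[OF p] by (cases p) auto
  qed
  have bdd: "bdd_below ((\<lambda>\<phi>. cut_norm (\<lambda>(x, y). W (x, y) - V' (\<phi> x, \<phi> y))) ` Collect unit_automorphism)" if "V' \<in> B_star q" for V'
    by (rule bdd_belowI2[where m = 0]) (use nn that in auto)
  have dnn: "0 \<le> cut_dist W V'" if "V' \<in> B_star q" for V'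
    unfolding cut_dist_def
    by (rule cINF_greatest) (use nn[OF that] unit_automorphism_id in auto)
  have "cut_dist_set W (B_star q) \<le> cut_dist W V"
    unfolding cut_dist_set_def by (rule cINF_lower[OF _ V], rule bdd_belowI2[where m = 0], rule dnn)
  also have "\<dots> \<le> cut_norm (\<lambda>(x, y). W (x, y) - V (id x, id y))"
    unfolding cut_dist_def by (rule cINF_lower[OF bdd[OF V]]) (rule CollectI, rule unit_automorphism_id)
  finally show ?thesis by (simp add: case_prod_unfold)
qed

section \<open>Distance to the balanced half-density graphons\<close>

text \<open>Move surplus elements from the large classes to the small ones, one at a time.\<close>

lemma rebalance:
  assumes X: "finite X" "card X = q * m" and c: "c ` X \<subseteq> {1..q}"
  shows "\<exists>c'. c' ` X \<subseteq> {1..q} \<and> (\<forall>i\<in>{1..q}. card {x\<in>X. c' x = i} = m) \<and>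
    card {x\<in>X. c x \<noteq> c' x} \<le> (\<Sum>i=1..q. card {x\<in>X. c x = i} - m)"
  using c
\<comment> \<open>Subtraction is truncated: the induction is on the total surplus of the classes
  above \<open>m\<close>.\<close>
proof (induction "\<Sum>i=1..q. card {x\<in>X. c x = i} - m" arbitrary: c rule: less_induct)
  case less
  have total: "(\<Sum>i=1..q. card {x\<in>X. c' x = i}) = q * m" if "c' ` X \<subseteq> {1..q}" for c' :: "'a \<Rightarrow> nat"
  proof -
    have "(\<Sum>i=1..q. card {x\<in>X. c' x = i}) = card (\<Union>i\<in>{1..q}. {x\<in>X. c' x = i})"
      by (rule card_UN_disjoint[symmetric]) (use X in auto)
    also have "(\<Union>i\<in>{1..q}. {x\<in>X. c' x = i}) = X" using that by auto
    finally show ?thesis using X by simp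
  qed
  show ?case
  proof (cases "\<exists>i\<in>{1..q}. card {x\<in>X. c x = i} > m")
    case False
    then have le: "card {x\<in>X. c x = i} \<le> m" if "i \<in> {1..q}" for i using that by force
    have "card {x\<in>X. c x = i} = m" if i: "i \<in> {1..q}" for i
    proof (rule ccontr)
      assume "card {x\<in>X. c x = i} \<noteq> m"
      then have "card {x\<in>X. c x = i} < m" using le[OF i] by linarith
      then have "(\<Sum>i=1..q. card {x\<in>X. c x = i}) < (\<Sum>i=1..q. m)"
        using le i by (intro sum_strict_mono_ex1) (auto intro!: bexI[of _ i])
      then show False using total[OF less.prems] by simp
    qed
    then show ?thesis using less.prems by (intro exI[of _ c]) auto
  next
    case True
    then obtain i where i: "i \<in> {1..q}" and big: "card {x\<in>X. c x = i} > m" by blast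
    \<comment> \<open>The average class size is \<open>m\<close>, so a class above it forces one
      below it.\<close>
    have "\<exists>j\<in>{1..q}. card {x\<in>X. c x = j} < m"
    proof (rule ccontr)
      assume "\<not> ?thesis"
      then have "(\<Sum>i=1..q. m) < (\<Sum>i=1..q. card {x\<in>X. c x = i})"
        using i big by (intro sum_strict_mono_ex1) (auto simp: not_less intro!: bexI[of _ i])
      then show False using total[OF less.prems] by simp
    qed
    then obtain j where j: "j \<in> {1..q}" and small: "card {x\<in>X. c x = j} < m" by blast
    have ij: "i \<noteq> j" using big small by auto
    obtain x where x: "x \<in> X" "c x = i"
      using big by (metis (mono_tags, lifting) Collect_empty_eq card.empty not_less_zero)
    define c1 where "c1 = c(x := j)"
    have c1: "c1 ` X \<subseteq> {1..q}" using less.prems j by (auto simp: c1_def)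
    have fin: "finite {y\<in>X. P y}" for P using X by simp
    have "{y\<in>X. c1 y = i} = {y\<in>X. c y = i} - {x}" using ij by (auto simp: c1_def)
    then have ci: "card {y\<in>X. c1 y = i} = card {y\<in>X. c y = i} - 1" using x by simp
    have "{y\<in>X. c1 y = j} = insert x {y\<in>X. c y = j}" using x by (auto simp: c1_def)
    then have cj: "card {y\<in>X. c1 y = j} = card {y\<in>X. c y = j} + 1" using x ij fin by simp
    have ck: "{y\<in>X. c1 y = k} = {y\<in>X. c y = k}" if "k \<noteq> i" "k \<noteq> j" for k
      using that x by (auto simp: c1_def)
    \<comment> \<open>Class \<open>j\<close> was below \<open>m\<close> and has no surplus even
      after gaining an element, so the total drops by exactly one.\<close>
    have dec: "(\<Sum>k=1..q. card {y\<in>X. c1 y = k} - m) + 1 = (\<Sum>k=1..q. card {y\<in>X. c y = k} - m)"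
    proof -
      have "(\<Sum>k\<in>{1..q} - {i}. card {y\<in>X. c1 y = k} - m) = (\<Sum>k\<in>{1..q} - {i}. card {y\<in>X. c y = k} - m)"
      proof (rule sum.cong[OF refl])
        fix k assume "k \<in> {1..q} - {i}"
        then show "card {y\<in>X. c1 y = k} - m = card {y\<in>X. c y = k} - m"
          using cj small ck by (cases "k = j") auto
      qed
      then show ?thesis using i big ci by (simp add: sum.remove[of _ i])
    qed
    obtain c' where c': "c' ` X \<subseteq> {1..q}" "\<forall>i\<in>{1..q}. card {x\<in>X. c' x = i} = m"
      "card {y\<in>X. c1 y \<noteq> c' y} \<le> (\<Sum>i=1..q. card {x\<in>X. c1 x = i} - m)"
      using less.hyps[OF _ c1] dec by auto
    have "{y\<in>X. c y \<noteq> c' y} \<subseteq> insert x {y\<in>X. c1 y \<noteq> c' y}" by (auto simp: c1_def)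
    then have "card {y\<in>X. c y \<noteq> c' y} \<le> card (insert x {y\<in>X. c1 y \<noteq> c' y})"
      by (intro card_mono) (use fin in auto)
    also have "\<dots> \<le> card {y\<in>X. c1 y \<noteq> c' y} + 1" using fin by (simp add: card_insert_if)
    finally have "card {y\<in>X. c y \<noteq> c' y} \<le> (\<Sum>i=1..q. card {x\<in>X. c x = i} - m)"
      using c'(3) dec by linarith
    then show ?thesis using c' by blast
  qed
qed

text \<open>The adjacency of \<open>G\<close> minus the ideal kernel of the colouring
  \<open>p\<close>.\<close>

definition deviation :: "graph \<Rightarrow> (nat \<Rightarrow> nat) \<Rightarrow> nat \<Rightarrow> nat \<Rightarrow> real" where
  "deviation G p u v = of_bool (adj G u v) - (if p u = p v then 0 else 1 / 2)"

text \<open>\<open>S\<close> and \<open>T\<close> are cut along the classes. Blocks between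
  different classes are controlled by quasirandomness; the kernel vanishes on diagonal blocks, which
  together contribute at most the inner arcs.\<close>

lemma deviation_cut:
  assumes p: "p ` {1..n} \<subseteq> {1..q}" and e: "\<epsilon> \<ge> 0"
    and inner: "inner_arcs n q p (adj G) \<le> \<epsilon> * real n ^ 2"
    and qr: "quasirandom n q \<epsilon> p G" and ST: "S \<subseteq> {1..n}" "T \<subseteq> {1..n}"
  shows "\<bar>\<Sum>u\<in>S. \<Sum>v\<in>T. deviation G p u v\<bar> \<le> (real q ^ 2 + 1) * (\<epsilon> * real n ^ 2)"
proof -
  define V where "V = color_class n p"
  have split: "(\<Sum>u\<in>S. f u) = (\<Sum>i=1..q. \<Sum>u\<in>S \<inter> V i. f u)" if "S \<subseteq> {1..n}" for f :: "nat \<Rightarrow> real" and S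
  proof -
    have "u \<in> (\<Union>i\<in>{1..q}. S \<inter> V i)" if u: "u \<in> S" for u
    proof
      have "u \<in> {1..n}" using u \<open>S \<subseteq> {1..n}\<close> by blast
      then show "p u \<in> {1..q}" "u \<in> S \<inter> V (p u)" using p u by (blast, simp add: V_def color_class_def)
    qed
    then have "S = (\<Union>i\<in>{1..q}. S \<inter> V i)" by blast
    then have "(\<Sum>u\<in>S. f u) = (\<Sum>u\<in>(\<Union>i\<in>{1..q}. S \<inter> V i). f u)" by simp
    also have "\<dots> = (\<Sum>i=1..q. \<Sum>u\<in>S \<inter> V i. f u)"
      by (rule sum.UNION_disjoint) (auto simp: V_def color_class_def)
    finally show ?thesis .
  qed
  define D where "D i j = (\<Sum>u\<in>S \<inter> V i. \<Sum>v\<in>T \<inter> V j. deviation G p u v)" for i j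
  have "(\<Sum>u\<in>S. \<Sum>v\<in>T. deviation G p u v) = (\<Sum>i=1..q. \<Sum>u\<in>S \<inter> V i. \<Sum>j=1..q. \<Sum>v\<in>T \<inter> V j. deviation G p u v)"
    by (simp only: split[OF ST(1)] split[OF ST(2)])
  also have "\<dots> = (\<Sum>i=1..q. \<Sum>j=1..q. D i j)"
    unfolding D_def by (intro sum.cong refl sum.swap)
  finally have eq: "(\<Sum>u\<in>S. \<Sum>v\<in>T. deviation G p u v) = (\<Sum>i=1..q. \<Sum>j=1..q. D i j)" .
  have finV: "finite (V i)" for i by (simp add: V_def)
  have Dij: "\<bar>D i j\<bar> \<le> (if i = j then real (arcs (adj G) (V i) (V i)) else 0) + \<epsilon> * real n ^ 2"
    if ij: "i \<in> {1..q}" "j \<in> {1..q}" for i j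
  proof (cases "i = j")
    case True
    have "D i j = (\<Sum>u\<in>S \<inter> V i. \<Sum>v\<in>T \<inter> V i. of_bool (adj G u v))"
      unfolding D_def True by (intro sum.cong refl) (auto simp: deviation_def V_def color_class_def)
    also have "\<dots> = real (arcs (adj G) (S \<inter> V i) (T \<inter> V i))"
      using arcs_eq_sum[of "T \<inter> V i" "adj G" "S \<inter> V i"] finV by simp
    finally have "\<bar>D i j\<bar> = real (arcs (adj G) (S \<inter> V i) (T \<inter> V i))" by simp
    also have "\<dots> \<le> real (arcs (adj G) (V i) (V i))"
    proof -
      have "arcs (adj G) (S \<inter> V i) (T \<inter> V i) \<le> (\<Sum>v\<in>S \<inter> V i. nbrs (adj G) (V i) v)"
        unfolding arcs_def nbrs_def using finV by (intro sum_mono card_mono) auto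
      also have "\<dots> \<le> arcs (adj G) (V i) (V i)"
        unfolding arcs_def using finV by (intro sum_mono2) auto
      finally show ?thesis by simp
    qed
    finally have "\<bar>D i j\<bar> \<le> real (arcs (adj G) (V i) (V i))" .
    moreover have "0 \<le> \<epsilon> * real n ^ 2" using e by simp
    ultimately show ?thesis using True by simp
  next
    case False
    have "D i j = (\<Sum>u\<in>S \<inter> V i. \<Sum>v\<in>T \<inter> V j. of_bool (adj G u v) - 1 / 2)"
      unfolding D_def using False by (intro sum.cong refl) (auto simp: deviation_def V_def color_class_def)
    also have "\<dots> = real (arcs (adj G) (S \<inter> V i) (T \<inter> V j)) - real (card (S \<inter> V i)) * real (card (T \<inter> V j)) / 2"
      using arcs_eq_sum[of "T \<inter> V j" "adj G" "S \<inter> V i"] finV by (simp only: sum_subtractf) simp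
    finally show ?thesis using qr False ij unfolding quasirandom_def V_def by simp
  qed
  have "\<bar>\<Sum>i=1..q. \<Sum>j=1..q. D i j\<bar> \<le> (\<Sum>i=1..q. \<Sum>j=1..q. \<bar>D i j\<bar>)"
    by (rule order_trans[OF sum_abs sum_mono[OF sum_abs]])
  also have "\<dots> \<le> (\<Sum>i=1..q. \<Sum>j=1..q. (if i = j then real (arcs (adj G) (V i) (V i)) else 0) + \<epsilon> * real n ^ 2)"
    by (intro sum_mono Dij)
  also have "\<dots> = (\<Sum>i=1..q. real (arcs (adj G) (V i) (V i))) + real q ^ 2 * (\<epsilon> * real n ^ 2)"
    by (simp add: sum.distrib power2_eq_square)
  also have "\<dots> \<le> (real q ^ 2 + 1) * (\<epsilon> * real n ^ 2)"
    using inner by (simp add: V_def distrib_right)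
  finally show ?thesis unfolding eq .
qed

text \<open>As \<open>q\<close> need not divide \<open>n\<close>, each of the \<open>n\<close> cells is split into \<open>q\<close> subcells;
  \<open>parent\<close> maps a subcell to its cell.\<close>

definition parent :: "nat \<Rightarrow> nat \<Rightarrow> nat" where
  "parent q s = (s - 1) div q + 1"

lemma parent_range: "q \<ge> 1 \<Longrightarrow> s \<in> {1..n * q} \<Longrightarrow> parent q s \<in> {1..n}"
proof -
  assume "q \<ge> 1" "s \<in> {1..n * q}"
  then have "(s - 1) div q < n" by (intro less_mult_imp_div_less) auto
  then show ?thesis by (simp add: parent_def)
qed

lemma card_parent_fiber:
  assumes q: "q \<ge> 1" and u: "u \<in> {1..n}"
  shows "card {s\<in>{1..n * q}. parent q s = u} = q"
proof -
  have "{s\<in>{1..n * q}. parent q s = u} = {(u - 1) * q + 1..(u - 1) * q + q}"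
  proof (intro equalityI subsetI)
    fix s assume "s \<in> {s\<in>{1..n * q}. parent q s = u}"
    then have s: "s \<ge> 1" "(s - 1) div q = u - 1" by (auto simp: parent_def)
    have "(s - 1) div q * q \<le> s - 1" by simp
    moreover have "s - 1 < (s - 1) div q * q + q" using dividend_less_div_times[of q "s - 1"] q by linarith
    ultimately have "(u - 1) * q \<le> s - 1" "s - 1 < (u - 1) * q + q" unfolding s(2) by auto
    with s(1) have "(u - 1) * q + 1 \<le> s" "s \<le> (u - 1) * q + q" by linarith+
    then show "s \<in> {(u - 1) * q + 1..(u - 1) * q + q}" by simp
  next
    fix s assume s: "s \<in> {(u - 1) * q + 1..(u - 1) * q + q}"
    then have "(s - 1) div q = u - 1"
      by (intro div_nat_eqI) (auto simp: mult.commute)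
    moreover have "(u - 1) * q + q \<le> n * q"
    proof -
      have "(u - 1) * q + q = u * q" using u by (cases u) auto
      also have "\<dots> \<le> n * q" using u by (intro mult_right_mono) auto
      finally show ?thesis .
    qed
    ultimately show "s \<in> {s\<in>{1..n * q}. parent q s = u}" using s u by (auto simp: parent_def)
  qed
  then show ?thesis by simp
qed

text \<open>A set of subcells contains a fraction \<open>a S u\<close> of the \<open>q\<close>
  subcells of cell \<open>u\<close>. The sum is therefore a bilinear form with weights in the unit
  interval, to which bounds for sets of cells extend.\<close>

lemma parent_cut:
  fixes F :: "nat \<Rightarrow> nat \<Rightarrow> real"
  assumes q: "q \<ge> 1" and S: "S \<subseteq> {1..n * q}" and T: "T \<subseteq> {1..n * q}"
    and F: "\<And>S T. S \<subseteq> {1..n} \<Longrightarrow> T \<subseteq> {1..n} \<Longrightarrow> \<bar>\<Sum>u\<in>S. \<Sum>v\<in>T. F u v\<bar> \<le> K"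
  shows "\<bar>\<Sum>s\<in>S. \<Sum>t\<in>T. F (parent q s) (parent q t)\<bar> \<le> real q ^ 2 * K"
proof -
  define a where "a S u = real (card {s\<in>S. parent q s = u}) / real q" for S u
  have grp: "(\<Sum>s\<in>S. f (parent q s)) = (\<Sum>u\<in>{1..n}. real q * a S u * f u)" if S: "S \<subseteq> {1..n * q}" for S and f :: "nat \<Rightarrow> real"
  proof -
    have fin: "finite S" using S finite_subset by blast
    have "(\<Sum>s\<in>S. f (parent q s)) = (\<Sum>u\<in>{1..n}. \<Sum>s\<in>{s\<in>S. parent q s = u}. f (parent q s))"
    proof (rule sum.group[symmetric])
      show "parent q ` S \<subseteq> {1..n}" using S parent_range[OF q] by blast
    qed (use fin in auto)
    also have "\<dots> = (\<Sum>u\<in>{1..n}. real q * a S u * f u)"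
      using q by (intro sum.cong) (auto simp: a_def)
    finally show ?thesis .
  qed
  have a01: "0 \<le> a S u \<and> a S u \<le> 1" if S: "S \<subseteq> {1..n * q}" and u: "u \<in> {1..n}" for S u
  proof -
    have "card {s\<in>S. parent q s = u} \<le> card {s\<in>{1..n * q}. parent q s = u}"
      using S by (intro card_mono) auto
    then show ?thesis using card_parent_fiber[OF q u] q by (simp add: a_def)
  qed
  have "(\<Sum>s\<in>S. \<Sum>t\<in>T. F (parent q s) (parent q t)) =
      (\<Sum>s\<in>S. \<Sum>v\<in>{1..n}. real q * a T v * F (parent q s) v)"
    by (intro sum.cong refl grp[OF T])
  also have "\<dots> = (\<Sum>u\<in>{1..n}. real q * a S u * (\<Sum>v\<in>{1..n}. real q * a T v * F u v))"
    by (rule grp[OF S])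
  also have "\<dots> = real q ^ 2 * (\<Sum>u\<in>{1..n}. \<Sum>v\<in>{1..n}. a S u * a T v * F u v)"
    by (simp add: sum_distrib_left power2_eq_square mult_ac)
  finally have "\<bar>\<Sum>s\<in>S. \<Sum>t\<in>T. F (parent q s) (parent q t)\<bar> =
      real q ^ 2 * \<bar>\<Sum>u\<in>{1..n}. \<Sum>v\<in>{1..n}. a S u * a T v * F u v\<bar>"
    by (simp add: abs_mult)
  also have "\<dots> \<le> real q ^ 2 * K"
    by (intro mult_left_mono bilinear_abs_le F a01 S T) auto
  finally show ?thesis .
qed

lemma empirical_graphon_eq:
  assumes n: "n \<ge> 1" and xy: "x \<in> {0..1}" "y \<in> {0..1}"
  shows "empirical_graphon n G (x, y) = of_bool (adj G (cell_index n x) (cell_index n y))"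
proof -
  have "(\<exists>i\<in>{1..n}. \<exists>j\<in>{1..n}. x \<in> cell n i \<and> y \<in> cell n j \<and> {i, j} \<in> G) \<longleftrightarrow> adj G (cell_index n x) (cell_index n y)"
    using cell_iff_index[OF n xy(1)] cell_iff_index[OF n xy(2)] cell_index_range[OF n] by metis
  then show ?thesis by (simp only: empirical_graphon_def prod.case of_bool_def)
qed

text \<open>Class \<open>A i\<close> is the union of the \<open>n\<close> cells of colour
  \<open>i\<close>, each of length \<open>1 / (n * q)\<close>, hence of measure exactly
  \<open>1 / q\<close>.\<close>

lemma step_fun_in_B_star:
  assumes n: "n \<ge> 1" and q: "q \<ge> 1" and c: "c ` {1..n * q} \<subseteq> {1..q}" "\<forall>i\<in>{1..q}. card {s\<in>{1..n * q}. c s = i} = n"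
  shows "step_fun (n * q) (\<lambda>s t. if c s = c t then 0 else 1 / 2) \<in> B_star q"
proof -
  define N where "N = n * q"
  have N: "N \<ge> 1" using n q by (simp add: N_def)
  define w :: "nat \<Rightarrow> nat \<Rightarrow> real" where "w s t = (if c s = c t then 0 else 1 / 2)" for s t
  define W where "W = step_fun N w"
  have Weq: "W (x, y) = w (cell_index N x) (cell_index N y)" if "x \<in> {0..1}" "y \<in> {0..1}" for x y
    unfolding W_def by (rule step_fun_eq[OF N that])
  define A where "A i = {x\<in>{0..1}. c (cell_index N x) = i}" for i
  have Aeq: "A i = (\<Union>s\<in>{s\<in>{1..N}. c s = i}. cell N s)" for i
  proof (intro equalityI subsetI)
    fix x assume "x \<in> A i"
    then have "x \<in> {0..1}" "c (cell_index N x) = i" by (auto simp: A_def)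
    moreover from this have "x \<in> cell N (cell_index N x)"
      using cell_iff_index[OF N _ cell_index_range[OF N]] by blast
    ultimately show "x \<in> (\<Union>s\<in>{s\<in>{1..N}. c s = i}. cell N s)" using cell_index_range[OF N, of x] by blast
  next
    fix x assume "x \<in> (\<Union>s\<in>{s\<in>{1..N}. c s = i}. cell N s)"
    then obtain s where s: "s \<in> {1..N}" "c s = i" "x \<in> cell N s" by blast
    then have x: "x \<in> {0..1}" using cell_subset[OF s(1)] by blast
    then have "cell_index N x = s" using cell_iff_index[OF N x s(1)] s by blast
    then show "x \<in> A i" using x s by (simp add: A_def)
  qed
  have ae: "AE p in lebesgue_on (A i \<times> A j). W p = (if i = j then 0 else 1 / 2)" for i j
  proof (rule AE_I2)
    fix p assume "p \<in> space (lebesgue_on (A i \<times> A j))"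
    then have "p \<in> A i \<times> A j" by (simp add: space_restrict_space)
    then show "W p = (if i = j then 0 else 1 / 2)" by (auto simp: A_def Weq w_def)
  qed
  have "graphon W"
    unfolding graphon_def
  proof (intro conjI ballI)
    have "W \<in> borel_measurable lborel" unfolding W_def using step_fun_borel by simp
    then show "W \<in> borel_measurable (lebesgue_on unit_square)"
      by (intro measurable_restrict_space1 measurable_completion)
    fix p :: "real \<times> real" assume "p \<in> unit_square"
    then have "W p = w (cell_index N (fst p)) (cell_index N (snd p))" using Weq[of "fst p" "snd p"] by auto
    then show "0 \<le> W p" "W p \<le> 1" by (auto simp: w_def)
  next
    show "AE p in lebesgue_on unit_square. W (fst p, snd p) = W (snd p, fst p)"
      by (rule AE_I2) (auto simp: Weq w_def)
  qed
  moreover have "(\<Union>i\<in>{1..q}. A i) = {0..1}"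
  proof -
    have "c (cell_index N x) \<in> {1..q}" for x using c(1) cell_index_range[OF N, of x] unfolding N_def by blast
    then show ?thesis by (auto simp: A_def)
  qed
  moreover have "disjoint_family_on A {1..q}" by (auto simp: disjoint_family_on_def A_def)
  moreover have "A i \<in> sets lebesgue \<and> measure lebesgue (A i) = 1 / real q" if i: "i \<in> {1..q}" for i
  proof
    have cm: "cell N s \<in> sets lebesgue" for s using cell_borel[of N s] by auto
    show "A i \<in> sets lebesgue" unfolding Aeq using cm by (intro sets.finite_UN) auto
    have "measure lebesgue (A i) = (\<Sum>s\<in>{s\<in>{1..N}. c s = i}. measure lebesgue (cell N s))"
      unfolding Aeq
    proof (rule measure_finite_Union)
      show "disjoint_family_on (cell N) {s\<in>{1..N}. c s = i}"
        unfolding disjoint_family_on_def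
      proof (intro ballI impI)
        fix s t assume st: "s \<in> {s\<in>{1..N}. c s = i}" "t \<in> {s\<in>{1..N}. c s = i}" "s \<noteq> t"
        show "cell N s \<inter> cell N t = {}"
        proof (rule ccontr)
          assume "cell N s \<inter> cell N t \<noteq> {}"
          then obtain x where x: "x \<in> cell N s" "x \<in> cell N t" by blast
          then have "x \<in> {0..1}" using cell_subset[of s N] st by blast
          then have "s = t" using cell_iff_index[OF N, of x s] cell_iff_index[OF N, of x t] st x by blast
          then show False using st by simp
        qed
      qed
      show "emeasure lebesgue (cell N s) \<noteq> \<infinity>" if "s \<in> {s\<in>{1..N}. c s = i}" for s
        using emeasure_unit_finite[OF cell_subset[of s N]] that by auto
    qed (use cm in auto)
    also have "\<dots> = (\<Sum>s\<in>{s\<in>{1..N}. c s = i}. 1 / real N)"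
      by (intro sum.cong refl measure_cell) auto
    also have "\<dots> = real n * (1 / real N)" using c(2) i by (simp add: N_def)
    also have "\<dots> = 1 / real q" using n by (simp add: N_def)
    finally show "measure lebesgue (A i) = 1 / real q" .
  qed
  moreover have "\<forall>i\<in>{1..q}. AE p in lebesgue_on (A i \<times> A i). W p = 0"
  proof
    show "AE p in lebesgue_on (A i \<times> A i). W p = 0" for i using ae[of i i] by simp
  qed
  moreover have "\<forall>i\<in>{1..q}. \<forall>j\<in>{1..q}. i \<noteq> j \<longrightarrow> (AE p in lebesgue_on (A i \<times> A j). W p = 1 / 2)"
  proof (intro ballI impI)
    show "AE p in lebesgue_on (A i \<times> A j). W p = 1 / 2" if "i \<noteq> j" for i j using ae[of i j] that by simp
  qed
  ultimately have "W \<in> B_star q" unfolding B_star_def by blast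
  then show ?thesis unfolding W_def w_def[abs_def] N_def .
qed

text \<open>Two comparisons on subcells: \<open>G\<close> with the kernel of its colouring, and this
  kernel with that of the rebalanced colouring \<open>c'\<close>, whose step function lies in
  \<open>B_star q\<close>. The two kernels differ only in rows and columns of recoloured
  subcells.\<close>

lemma cut_dist_B_star_le:
  assumes n: "n \<ge> 1" and q: "q \<ge> 1" and e: "\<epsilon> \<ge> 0" and str: "structured n q \<epsilon> G"
  shows "cut_dist_set (empirical_graphon n G) (B_star q) \<le> 3 * real q ^ 2 * \<epsilon>"
proof -
  obtain p where p: "p ` {1..n} \<subseteq> {1..q}"
    and size: "\<And>i. i \<in> {1..q} \<Longrightarrow> \<bar>real (card (color_class n p i)) - real n / real q\<bar> \<le> \<epsilon> * real n"
    and inner: "inner_arcs n q p (adj G) \<le> \<epsilon> * real n ^ 2"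
    and qr: "quasirandom n q \<epsilon> p G"
    using str unfolding structured_def by blast
  define N where "N = n * q"
  have N: "N \<ge> 1" using n q by (simp add: N_def)
  define c where "c s = p (parent q s)" for s
  have parN: "parent q s \<in> {1..n}" if "s \<in> {1..N}" for s using parent_range[OF q, of s n] that by (simp add: N_def)
  have cim: "c ` {1..N} \<subseteq> {1..q}" using parN p by (auto simp: c_def)
  have ccard: "card {s\<in>{1..N}. c s = i} = q * card (color_class n p i)" for i
  proof -
    have "{s\<in>{1..N}. c s = i} = (\<Union>u\<in>color_class n p i. {s\<in>{1..N}. parent q s = u})"
      using parN by (auto simp: c_def color_class_def)
    also have "card \<dots> = (\<Sum>u\<in>color_class n p i. card {s\<in>{1..N}. parent q s = u})"
      by (rule card_UN_disjoint) auto
    also have "\<dots> = (\<Sum>u\<in>color_class n p i. q)"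
      unfolding N_def by (intro sum.cong refl card_parent_fiber[OF q]) (auto simp: color_class_def)
    finally show ?thesis by (simp add: mult.commute)
  qed
  have "finite {1..N}" "card {1..N} = q * n" by (auto simp: N_def)
  from rebalance[OF this cim] obtain c' where c': "c' ` {1..N} \<subseteq> {1..q}" "\<forall>i\<in>{1..q}. card {s\<in>{1..N}. c' s = i} = n"
    and badc: "card {s\<in>{1..N}. c s \<noteq> c' s} \<le> (\<Sum>i=1..q. q * card (color_class n p i) - n)"
    unfolding ccard by blast
  define Bad where "Bad = {s\<in>{1..N}. c s \<noteq> c' s}"
  \<comment> \<open>Each of the \<open>q\<close> classes has a surplus of at most
    \<open>q * \<epsilon> * n\<close> subcells.\<close>
  have Bad: "real (card Bad) \<le> real q * (real q * (\<epsilon> * real n))"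
  proof -
    have "real (q * card (color_class n p i) - n) \<le> real q * (\<epsilon> * real n)" if i: "i \<in> {1..q}" for i
    proof (cases "q * card (color_class n p i) \<ge> n")
      case True
      have "real (q * card (color_class n p i) - n) = real q * (real (card (color_class n p i)) - real n / real q)"
        using True q by (simp add: of_nat_diff right_diff_distrib)
      also have "\<dots> \<le> real q * (\<epsilon> * real n)" using size[OF i] by (intro mult_left_mono) auto
      finally show ?thesis .
    next
      case False
      then show ?thesis using e by simp
    qed
    then have "(\<Sum>i=1..q. real (q * card (color_class n p i) - n)) \<le> (\<Sum>i=1..q. real q * (\<epsilon> * real n))" by (intro sum_mono)
    moreover have "real (card Bad) \<le> real (\<Sum>i=1..q. q * card (color_class n p i) - n)"
      unfolding Bad_def by (rule of_nat_mono[OF badc])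
    ultimately show ?thesis by simp
  qed
  define w :: "nat \<Rightarrow> nat \<Rightarrow> real" where "w s t = (if c' s = c' t then 0 else 1 / 2)" for s t
  have W: "step_fun N w \<in> B_star q"
    using step_fun_in_B_star[OF n q, of c'] c' unfolding N_def w_def[abs_def] by blast
  define d where "d s t = of_bool (adj G (parent q s) (parent q t)) - w s t" for s t
  have disc: "\<bar>\<Sum>s\<in>S. \<Sum>t\<in>T. d s t\<bar> \<le> 3 * real q ^ 2 * \<epsilon> * real N ^ 2" if ST: "S \<subseteq> {1..N}" "T \<subseteq> {1..N}" for S T
  proof -
    define e2 where "e2 s t = (if c s = c t then 0 else 1 / 2) - w s t" for s t
    have fin: "finite S" "finite T" using ST finite_subset by blast+
    have dsplit: "d s t = deviation G p (parent q s) (parent q t) + e2 s t" for s t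
      by (simp add: d_def deviation_def e2_def c_def)
    have 1: "\<bar>\<Sum>s\<in>S. \<Sum>t\<in>T. deviation G p (parent q s) (parent q t)\<bar> \<le> real q ^ 2 * ((real q ^ 2 + 1) * (\<epsilon> * real n ^ 2))"
      using ST unfolding N_def by (intro parent_cut[OF q] deviation_cut[OF p e inner qr])
    have "\<bar>\<Sum>s\<in>S. \<Sum>t\<in>T. e2 s t\<bar> \<le> (\<Sum>s\<in>S. \<Sum>t\<in>T. \<bar>e2 s t\<bar>)"
      by (rule order_trans[OF sum_abs sum_mono[OF sum_abs]])
    \<comment> \<open>\<open>e2\<close> has absolute value at most 1/2 and vanishes unless its row
      or its column is recoloured.\<close>
    also have "\<dots> \<le> (\<Sum>s\<in>S. \<Sum>t\<in>T. of_bool (s \<in> Bad) / 2 + of_bool (t \<in> Bad) / 2)"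
      using ST by (intro sum_mono) (auto simp: e2_def w_def Bad_def)
    also have "\<dots> \<le> (\<Sum>s\<in>{1..N}. \<Sum>t\<in>{1..N}. of_bool (s \<in> Bad) / 2 + of_bool (t \<in> Bad) / 2)"
    proof -
      have "(\<Sum>s\<in>S. \<Sum>t\<in>T. of_bool (s \<in> Bad) / 2 + of_bool (t \<in> Bad) / 2) \<le>
          (\<Sum>s\<in>S. \<Sum>t\<in>{1..N}. of_bool (s \<in> Bad) / 2 + of_bool (t \<in> Bad) / (2 :: real))"
        using ST by (intro sum_mono sum_mono2) auto
      also have "\<dots> \<le> (\<Sum>s\<in>{1..N}. \<Sum>t\<in>{1..N}. of_bool (s \<in> Bad) / 2 + of_bool (t \<in> Bad) / 2)"
        using ST by (intro sum_mono2 sum_nonneg) auto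
      finally show ?thesis .
    qed
    also have "\<dots> = real N * real (card Bad)"
    proof -
      have "(\<Sum>s\<in>{1..N}. of_bool (s \<in> Bad)) = real (card Bad)"
      proof -
        have "{1..N} \<inter> Bad = Bad" by (auto simp: Bad_def)
        then show ?thesis by simp
      qed
      then show ?thesis by (simp only: sum.distrib sum_divide_distrib[symmetric] sum_constant card_atLeastAtMost sum_distrib_left[symmetric]) simp
    qed
    also have "\<dots> \<le> real N * (real q * (real q * (\<epsilon> * real n)))" using Bad by (intro mult_left_mono) auto
    finally have 2: "\<bar>\<Sum>s\<in>S. \<Sum>t\<in>T. e2 s t\<bar> \<le> real N * (real q * (real q * (\<epsilon> * real n)))" .
    have "(\<Sum>s\<in>S. \<Sum>t\<in>T. d s t) = (\<Sum>s\<in>S. \<Sum>t\<in>T. deviation G p (parent q s) (parent q t)) + (\<Sum>s\<in>S. \<Sum>t\<in>T. e2 s t)"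
      by (simp add: dsplit sum.distrib)
    then have "\<bar>\<Sum>s\<in>S. \<Sum>t\<in>T. d s t\<bar> \<le> real q ^ 2 * ((real q ^ 2 + 1) * (\<epsilon> * real n ^ 2)) + real N * (real q * (real q * (\<epsilon> * real n)))"
      using 1 2 by linarith
    also have "\<dots> = (real q ^ 4 + real q ^ 2 + real q ^ 3) * (\<epsilon> * real n ^ 2)"
      by (simp add: N_def power2_eq_square power3_eq_cube power4_eq_xxxx algebra_simps)
    \<comment> \<open>The powers are rounded up to \<open>q ^ 4\<close>; normalising by
      \<open>N ^ 2 = (n * q) ^ 2\<close> leaves the factor \<open>q ^ 2\<close> of the
      claim.\<close>
    also have "\<dots> \<le> (3 * real q ^ 4) * (\<epsilon> * real n ^ 2)"
    proof (rule mult_right_mono)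
      have "real q ^ 2 \<le> real q ^ 4" "real q ^ 3 \<le> real q ^ 4" using q by (intro power_increasing; simp)+
      then show "real q ^ 4 + real q ^ 2 + real q ^ 3 \<le> 3 * real q ^ 4" by linarith
      show "0 \<le> \<epsilon> * real n ^ 2" using e by simp
    qed
    also have "\<dots> = 3 * real q ^ 2 * \<epsilon> * real N ^ 2"
      by (simp add: N_def power2_eq_square power4_eq_xxxx)
    finally show ?thesis .
  qed
  have emp01: "0 \<le> empirical_graphon n G p \<and> empirical_graphon n G p \<le> 1" for p
    by (auto simp: empirical_graphon_def split: prod.splits)
  have "cut_norm (\<lambda>p. empirical_graphon n G p - step_fun N w p) \<le> 3 * real q ^ 2 * \<epsilon>"
  proof (rule cut_norm_le)
    fix S T assume S: "S \<in> sets unit_lebesgue" and T: "T \<in> sets unit_lebesgue"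
    \<comment> \<open>The share of cell \<open>s\<close> occupied by \<open>S\<close>. These shares
      are weights in the unit interval, so the discrete bound \<open>disc\<close> controls the
      integral.\<close>
    define \<mu> where "\<mu> S s = real N * measure lebesgue (S \<inter> cell N s)" for S s
    have Np: "real N > 0" using N by simp
    have mu01: "0 \<le> \<mu> S s \<and> \<mu> S s \<le> 1" if S: "S \<in> sets unit_lebesgue" and s: "s \<in> {1..N}" for S s
    proof -
      have cm: "cell N s \<in> sets lebesgue" using cell_borel[of N s] by auto
      then have "cell N s \<in> lmeasurable"
        using emeasure_unit_finite[OF cell_subset[OF s]] by (intro fmeasurableI) auto
      then have "measure lebesgue (S \<inter> cell N s) \<le> measure lebesgue (cell N s)"
        using unit_lebesgue_sets[OF S] cm by (intro measure_mono_fmeasurable) auto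
      then show ?thesis using measure_cell[OF s] Np by (simp add: \<mu>_def field_simps)
    qed
    have "(LINT p:S \<times> T|lebesgue. empirical_graphon n G p - step_fun N w p) =
      (\<Sum>s\<in>{1..N}. \<Sum>t\<in>{1..N}. measure lebesgue (S \<inter> cell N s) * measure lebesgue (T \<inter> cell N t) * d s t)"
    proof (rule integral_step_fun[OF N S T])
      fix x y :: real assume xy: "x \<in> {0..1}" "y \<in> {0..1}"
      show "empirical_graphon n G (x, y) - step_fun N w (x, y) = d (cell_index N x) (cell_index N y)"
        unfolding empirical_graphon_eq[OF n xy] step_fun_eq[OF N xy] d_def parent_def
        using cell_index_refine[OF n q xy(1)] cell_index_refine[OF n q xy(2)] by (simp add: N_def)
    qed
    also have "\<dots> = (\<Sum>s\<in>{1..N}. \<Sum>t\<in>{1..N}. \<mu> S s * \<mu> T t * d s t) / real N ^ 2"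
      unfolding sum_divide_distrib using Np by (intro sum.cong refl) (simp add: \<mu>_def power2_eq_square)
    finally have "\<bar>LINT p:S \<times> T|lebesgue. empirical_graphon n G p - step_fun N w p\<bar> =
        \<bar>\<Sum>s\<in>{1..N}. \<Sum>t\<in>{1..N}. \<mu> S s * \<mu> T t * d s t\<bar> / real N ^ 2" by simp
    also have "\<dots> \<le> 3 * real q ^ 2 * \<epsilon> * real N ^ 2 / real N ^ 2"
      by (intro divide_right_mono bilinear_abs_le disc mu01 S T) auto
    also have "\<dots> = 3 * real q ^ 2 * \<epsilon>" using Np by simp
    finally show "\<bar>LINT p:S \<times> T|lebesgue. empirical_graphon n G p - step_fun N w p\<bar> \<le> 3 * real q ^ 2 * \<epsilon>" .
  qed
  moreover have "cut_dist_set (empirical_graphon n G) (B_star q) \<le> cut_norm (\<lambda>p. empirical_graphon n G p - step_fun N w p)"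
    using emp01 W by (rule cut_dist_set_le_cut_norm)
  ultimately show ?thesis by linarith
qed

section \<open>The limit theorem\<close>

lemma mc_prob_mono:
  assumes "A \<subseteq> B" "B \<subseteq> graphs n"
  shows "mc_prob l w n A \<le> mc_prob l w n B"
proof -
  have "finite B" using assms(2) finite_graphs finite_subset by blast
  then have "(\<Sum>G\<in>A. mc_mass l w n G) \<le> (\<Sum>G\<in>B. mc_mass l w n G)"
    using assms(1) by (intro sum_mono2) (auto intro: less_imp_le mc_mass_pos)
  then show ?thesis unfolding mc_prob_def using mc_Z_pos[of l w n] by (intro divide_right_mono) auto
qed

lemma mc_prob_nonneg: "0 \<le> mc_prob l w n A"
  unfolding mc_prob_def by (intro divide_nonneg_nonneg sum_nonneg less_imp_le[OF mc_mass_pos] less_imp_le[OF mc_Z_pos])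

lemma mc_prob_compl:
  "mc_prob l w n {G \<in> graphs n. P G} = 1 - mc_prob l w n {G \<in> graphs n. \<not> P G}"
proof -
  have "mc_Z l w n = (\<Sum>G\<in>{G \<in> graphs n. P G} \<union> {G \<in> graphs n. \<not> P G}. mc_mass l w n G)"
    unfolding mc_Z_def by (rule sum.cong) auto
  also have "\<dots> = (\<Sum>G\<in>{G \<in> graphs n. P G}. mc_mass l w n G) + (\<Sum>G\<in>{G \<in> graphs n. \<not> P G}. mc_mass l w n G)"
    by (rule sum.union_disjoint) (auto simp: finite_graphs)
  finally show ?thesis using mc_Z_pos[of l w n] by (simp add: mc_prob_def field_simps)
qed

text \<open>Skolemisation. The hypothesis fixes \<open>c\<close> before \<open>w\<^sub>0\<close> is
  given, and \<open>N\<close> before \<open>l\<close> and \<open>w\<close>; hence \<open>c\<close>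
  becomes a function of \<open>\<epsilon>\<close> and \<open>r\<close>, and \<open>N\<close> one of
  \<open>\<epsilon>\<close>, \<open>r\<close> and \<open>w r\<close>.\<close>

lemma choose_constants:
  fixes P :: "real \<Rightarrow> nat \<Rightarrow> nat \<Rightarrow> nat \<Rightarrow> (nat \<Rightarrow> real) \<Rightarrow> real \<Rightarrow> bool"
  assumes P: "\<And>\<epsilon> r. \<epsilon> > 0 \<Longrightarrow> r \<ge> 3 \<Longrightarrow> \<exists>c>0. \<forall>w\<^sub>0>0. \<exists>N. \<forall>n l w.
    n \<ge> N \<and> weight_vector l w \<and> min_index l w = r \<and> w r = w\<^sub>0 \<longrightarrow> P \<epsilon> r n l w c"
  shows "\<exists>(c :: real \<Rightarrow> nat \<Rightarrow> real) (N :: real \<Rightarrow> nat \<Rightarrow> real \<Rightarrow> nat). \<forall>\<epsilon>>0. \<forall>l w. weight_vector l w \<longrightarrow>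
    c \<epsilon> (min_index l w) > 0 \<and>
    (\<forall>n\<ge>N \<epsilon> (min_index l w) (w (min_index l w)). P \<epsilon> (min_index l w) n l w (c \<epsilon> (min_index l w)))"
proof -
  define K where "K \<epsilon> r w\<^sub>0 c N \<longleftrightarrow> (\<forall>n l w. n \<ge> N \<and> weight_vector l w \<and> min_index l w = r \<and> w r = w\<^sub>0 \<longrightarrow> P \<epsilon> r n l w c)"
    for \<epsilon> r w\<^sub>0 c N
  define c where "c \<epsilon> r = (SOME c. c > 0 \<and> (\<forall>w\<^sub>0>0. \<exists>N. K \<epsilon> r w\<^sub>0 c N))" for \<epsilon> r
  define N where "N \<epsilon> r w\<^sub>0 = (SOME N. K \<epsilon> r w\<^sub>0 (c \<epsilon> r) N)" for \<epsilon> r w\<^sub>0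
  have c: "c \<epsilon> r > 0 \<and> (\<forall>w\<^sub>0>0. \<exists>N. K \<epsilon> r w\<^sub>0 (c \<epsilon> r) N)" if "\<epsilon> > 0" "r \<ge> 3" for \<epsilon> r
    unfolding c_def by (rule someI_ex) (use P[OF that] in \<open>unfold K_def\<close>)
  have N: "K \<epsilon> r w\<^sub>0 (c \<epsilon> r) (N \<epsilon> r w\<^sub>0)" if "\<epsilon> > 0" "r \<ge> 3" "w\<^sub>0 > 0" for \<epsilon> r w\<^sub>0
    unfolding N_def by (rule someI_ex) (use c[OF that(1,2)] that(3) in blast)
  show ?thesis
  proof (rule exI[of _ c], rule exI[of _ N], intro allI impI)
    fix \<epsilon> :: real and l w assume e: "\<epsilon> > 0" and w: "weight_vector l w"
    have r: "min_index l w \<ge> 3" "w (min_index l w) > 0" using min_index[OF w] by auto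
    show "c \<epsilon> (min_index l w) > 0 \<and>
      (\<forall>n\<ge>N \<epsilon> (min_index l w) (w (min_index l w)). P \<epsilon> (min_index l w) n l w (c \<epsilon> (min_index l w)))"
      using c[OF e r(1)] N[OF e r] w unfolding K_def by blast
  qed
qed

text \<open>Any property that \<open>structured\<close> implies for large \<open>n\<close> inherits
  its exponential tail with the same \<open>c\<close>; only \<open>N\<close> has to grow to
  \<open>n\<^sub>0\<close>.\<close>

lemma structured_transfer:
  assumes e: "0 < \<epsilon>" "\<epsilon> \<le> 1" and r: "r \<ge> 3"
    and Q: "\<And>n G. n \<ge> n\<^sub>0 \<Longrightarrow> G \<in> graphs n \<Longrightarrow> structured n (r - 1) \<epsilon> G \<Longrightarrow> Q n G"
  shows "\<exists>c>0. \<forall>w\<^sub>0>0. \<exists>N. \<forall>n l w. n \<ge> N \<and> weight_vector l w \<and> min_index l w = r \<and> w r = w\<^sub>0 \<longrightarrow>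
    mc_prob l w n {G \<in> graphs n. \<not> Q n G} \<le> exp (- c * real n ^ 2)"
proof -
  obtain c where c: "c > 0" and N: "\<forall>w\<^sub>0>0. \<exists>N. \<forall>n l w. n \<ge> N \<and> weight_vector l w \<and> min_index l w = r \<and> w r = w\<^sub>0 \<longrightarrow>
    mc_prob l w n {G \<in> graphs n. \<not> structured n (r - 1) \<epsilon> G} \<le> exp (- c * real n ^ 2)"
    using prob_unstructured[OF r e] by blast
  show ?thesis
  proof (intro exI[of _ c] conjI allI impI c)
    fix w\<^sub>0 :: real assume "w\<^sub>0 > 0"
    then obtain N where N: "\<And>n l w. n \<ge> N \<and> weight_vector l w \<and> min_index l w = r \<and> w r = w\<^sub>0 \<Longrightarrow>
      mc_prob l w n {G \<in> graphs n. \<not> structured n (r - 1) \<epsilon> G} \<le> exp (- c * real n ^ 2)" using N by blast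
    show "\<exists>N. \<forall>n l w. n \<ge> N \<and> weight_vector l w \<and> min_index l w = r \<and> w r = w\<^sub>0 \<longrightarrow>
      mc_prob l w n {G \<in> graphs n. \<not> Q n G} \<le> exp (- c * real n ^ 2)"
    proof (intro exI[of _ "max N n\<^sub>0"] allI impI)
      fix n l w assume H: "n \<ge> max N n\<^sub>0 \<and> weight_vector l w \<and> min_index l w = r \<and> w r = w\<^sub>0"
      then have "mc_prob l w n {G \<in> graphs n. \<not> Q n G} \<le> mc_prob l w n {G \<in> graphs n. \<not> structured n (r - 1) \<epsilon> G}"
        using Q by (intro mc_prob_mono) auto
      also have "\<dots> \<le> exp (- c * real n ^ 2)" using N[of n l w] H by simp
      finally show "mc_prob l w n {G \<in> graphs n. \<not> Q n G} \<le> exp (- c * real n ^ 2)" .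
    qed
  qed
qed

lemma cut_dist_concentration:
  assumes e: "\<epsilon> > 0" and r: "r \<ge> 3"
  shows "\<exists>c>0. \<forall>w\<^sub>0>0. \<exists>N. \<forall>n l w. n \<ge> N \<and> weight_vector l w \<and> min_index l w = r \<and> w r = w\<^sub>0 \<longrightarrow>
    mc_prob l w n {G \<in> graphs n. cut_dist_set (empirical_graphon n G) (B_star (r - 1)) \<ge> \<epsilon>} \<le> exp (- c * real n ^ 2)"
proof -
  define q where "q = r - 1"
  have q: "q \<ge> 1" "real q > 0" using r by (auto simp: q_def)
  \<comment> \<open>This makes \<open>3 * q ^ 2 * \<epsilon>'\<close> at most
    \<open>\<epsilon> / 2\<close>, hence strictly below \<open>\<epsilon>\<close>; the bound 1 is
    the range of the deviation estimate.\<close>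
  define \<epsilon>' where "\<epsilon>' = min 1 (\<epsilon> / (6 * real q ^ 2))"
  have e': "0 < \<epsilon>'" "\<epsilon>' \<le> 1" using e q by (auto simp: \<epsilon>'_def)
  have "\<epsilon>' \<le> \<epsilon> / (6 * real q ^ 2)" by (simp add: \<epsilon>'_def)
  then have "3 * real q ^ 2 * \<epsilon>' \<le> \<epsilon> / 2" using q by (simp add: pos_le_divide_eq mult_ac)
  then have lt: "3 * real q ^ 2 * \<epsilon>' < \<epsilon>" using e by linarith
  have "cut_dist_set (empirical_graphon n G) (B_star (r - 1)) < \<epsilon>" if "n \<ge> 1" "structured n (r - 1) \<epsilon>' G" for n G
    using cut_dist_B_star_le[OF that(1) q(1) less_imp_le[OF e'(1)], of G] lt that(2) unfolding q_def by linarith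
  then show ?thesis
    using structured_transfer[OF e' r, where n\<^sub>0 = 1 and Q = "\<lambda>n G. cut_dist_set (empirical_graphon n G) (B_star (r - 1)) < \<epsilon>"]
    unfolding not_less by blast
qed

text \<open>Spelled exactly like the event in the theorem, so that the theorem can be folded with
  this definition.\<close>

definition near_turan :: "nat \<Rightarrow> nat \<Rightarrow> real \<Rightarrow> graph \<Rightarrow> bool" where
  "near_turan n q \<epsilon> G \<longleftrightarrow> (\<exists>V. vertex_partition n q V \<and>
     (\<forall>i\<in>{1..q}. \<bar>real (card (V i)) - real n / real q\<bar> \<le> \<epsilon> * real n) \<and>
     (\<forall>i\<in>{1..q}. \<forall>j\<in>{1..q}. i \<noteq> j \<longrightarrow>
        \<bar>real (edges_between G (V i) (V j)) / (real (card (V i)) * real (card (V j))) - 1 / 2\<bar> \<le> \<epsilon>) \<and>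
     real (\<Sum>i = 1..q. edges_in G (V i)) \<le> \<epsilon> * (real n)\<^sup>2 / (10 * real q) \<and>
     real (\<Sum>i = 1..q. edges_in G (V i)) / real (\<Sum>i = 1..q. card (V i) choose 2) \<le> \<epsilon> \<and>
     (let G' = delete_inner_edges q V G in
        partite n q G' \<and> edit_dist n G G' \<le> \<epsilon> / (10 * real q) \<and> \<epsilon> / (10 * real q) \<le> \<epsilon> / 2))"

text \<open>\<open>\<epsilon>' \<le> 1 / (2 * q)\<close> keeps every class at least
  \<open>n / (2 * q)\<close> large; with \<open>n \<ge> 4 * q\<close> it has two elements or more,
  so no denominator vanishes. The remaining errors are multiples of \<open>\<epsilon>'\<close> by at
  most \<open>10 * q ^ 2\<close>.\<close>

lemma near_turan_if_structured:
  assumes G: "G \<in> graphs n" and q: "q \<ge> 1" and n: "n \<ge> 4 * q" and e: "\<epsilon> > 0"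
    and e': "0 < \<epsilon>'" "\<epsilon>' \<le> 1 / (2 * real q)" "\<epsilon>' \<le> \<epsilon> / (10 * real q ^ 2)"
    and str: "structured n q \<epsilon>' G"
  shows "near_turan n q \<epsilon> G"
proof -
  obtain p where p: "p ` {1..n} \<subseteq> {1..q}"
    and size: "\<And>i. i \<in> {1..q} \<Longrightarrow> \<bar>real (card (color_class n p i)) - real n / real q\<bar> \<le> \<epsilon>' * real n"
    and inner: "inner_arcs n q p (adj G) \<le> \<epsilon>' * real n ^ 2"
    and qr: "quasirandom n q \<epsilon>' p G"
    using str unfolding structured_def by blast
  define V where "V = color_class n p"
  have q1: "real q \<ge> 1" using q by simp
  have qsq: "real q \<le> real q ^ 2" using q1 by (simp add: power2_eq_square)
  have n0: "real n > 0" using n q by simp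
  have e10: "10 * real q ^ 2 * \<epsilon>' \<le> \<epsilon>" using e'(3) q1 by (simp add: pos_le_divide_eq mult_ac)
  \<comment> \<open>Used with \<open>k\<close> equal to 1 for sizes, \<open>4 * q ^ 2\<close> for
    densities, \<open>10 * q\<close> for inner edges and \<open>8 * q ^ 2\<close> for their
    ratio.\<close>
  have lin: "k * \<epsilon>' \<le> \<epsilon>" if "k \<le> 10 * real q ^ 2" for k
    using mult_right_mono[OF that, of \<epsilon>'] e' e10 by linarith
  have big: "real (card (V i)) \<ge> real n / (2 * real q)" if "i \<in> {1..q}" for i
  proof -
    have "\<epsilon>' * real n \<le> 1 / (2 * real q) * real n" using e'(2) by (rule mult_right_mono) simp
    moreover have "real n / real q - 1 / (2 * real q) * real n = real n / (2 * real q)"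
      using q1 by (simp add: field_simps)
    ultimately show ?thesis using size[OF that] unfolding V_def by linarith
  qed
  have finV: "finite (V i)" for i by (simp add: V_def)
  have pos: "real (card (V i)) > 0" if "i \<in> {1..q}" for i
    using big[OF that] n0 q1 by (meson divide_pos_pos less_le_trans mult_pos_pos zero_less_numeral zero_less_one)
  have part: "vertex_partition n q V"
    unfolding vertex_partition_def
  proof (intro conjI ballI)
    show "(\<Union>i\<in>{1..q}. V i) = {1..n}" using p by (auto simp: V_def color_class_def)
    show "disjoint_family_on V {1..q}" by (auto simp: disjoint_family_on_def V_def color_class_def)
    show "V i \<noteq> {}" if "i \<in> {1..q}" for i using pos[OF that] by auto
  qed
  have sizes: "\<bar>real (card (V i)) - real n / real q\<bar> \<le> \<epsilon> * real n" if "i \<in> {1..q}" for i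
  proof -
    have "\<epsilon>' \<le> \<epsilon>" using lin[of 1] qsq q1 by simp
    then have "\<epsilon>' * real n \<le> \<epsilon> * real n" by (rule mult_right_mono) simp
    then show ?thesis using size[OF that] unfolding V_def by linarith
  qed
  have dens: "\<bar>real (edges_between G (V i) (V j)) / (real (card (V i)) * real (card (V j))) - 1 / 2\<bar> \<le> \<epsilon>"
    if ij: "i \<in> {1..q}" "j \<in> {1..q}" "i \<noteq> j" for i j
  proof -
    define a where "a = real (card (V i)) * real (card (V j))"
    have a: "a > 0" using pos ij by (simp add: a_def)
    have "V i \<inter> V j = {}" using ij by (auto simp: V_def color_class_def)
    then have eb: "edges_between G (V i) (V j) = arcs (adj G) (V i) (V j)"
      by (rule edges_between_eq_arcs[OF _ finV finV])
    have "\<bar>real (arcs (adj G) (V i) (V j)) - a / 2\<bar> \<le> \<epsilon>' * real n ^ 2"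
      using qr ij unfolding quasirandom_def V_def a_def by blast
    also have "\<dots> \<le> \<epsilon> * a"
    proof -
      have "real n / (2 * real q) * (real n / (2 * real q)) \<le> a"
        unfolding a_def using ij n0 q1 by (intro mult_mono big) auto
      then have "real n ^ 2 \<le> 4 * real q ^ 2 * a"
        using q1 by (simp add: field_simps power2_eq_square)
      then have "\<epsilon>' * real n ^ 2 \<le> (4 * real q ^ 2 * \<epsilon>') * a"
        using e' mult_left_mono[of "real n ^ 2" "4 * real q ^ 2 * a" \<epsilon>'] by (simp add: mult_ac)
      also have "\<dots> \<le> \<epsilon> * a" using lin[of "4 * real q ^ 2"] a by (intro mult_right_mono) auto
      finally show ?thesis .
    qed
    finally have "\<bar>real (arcs (adj G) (V i) (V j)) - a / 2\<bar> / a \<le> \<epsilon>"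
      using a by (simp add: pos_divide_le_eq)
    moreover have "\<bar>real (arcs (adj G) (V i) (V j)) - a / 2\<bar> / a = \<bar>(real (arcs (adj G) (V i) (V j)) - a / 2) / a\<bar>"
      using a by simp
    moreover have "(real (arcs (adj G) (V i) (V j)) - a / 2) / a = real (arcs (adj G) (V i) (V j)) / a - 1 / 2"
      using a by (simp add: field_simps)
    ultimately show ?thesis unfolding eb a_def by simp
  qed
  have "2 * real (\<Sum>i = 1..q. edges_in G (V i)) = (\<Sum>i=1..q. real (arcs (adj G) (V i) (V i)))"
    by (simp add: sum_distrib_left flip: edges_in_eq_arcs[OF G finV])
  then have E: "real (\<Sum>i = 1..q. edges_in G (V i)) \<le> \<epsilon>' * real n ^ 2 / 2"
    using inner unfolding V_def by linarith
  have inn: "real (\<Sum>i = 1..q. edges_in G (V i)) \<le> \<epsilon> * (real n)\<^sup>2 / (10 * real q)"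
  proof -
    have "(10 * real q) * \<epsilon>' \<le> \<epsilon>" using qsq by (intro lin) simp
    then have "(10 * real q * \<epsilon>') * real n ^ 2 \<le> \<epsilon> * real n ^ 2" by (rule mult_right_mono) simp
    then have "\<epsilon>' * real n ^ 2 \<le> \<epsilon> * real n ^ 2 / (10 * real q)"
      using q1 by (simp add: pos_le_divide_eq mult_ac)
    moreover have "0 \<le> \<epsilon>' * real n ^ 2" using e' by simp
    ultimately show ?thesis using E by linarith
  qed
  have ratio: "real (\<Sum>i = 1..q. edges_in G (V i)) / real (\<Sum>i = 1..q. card (V i) choose 2) \<le> \<epsilon>"
  proof -
    \<comment> \<open>One class alone bounds the denominator from below by a multiple of
      \<open>n ^ 2\<close>.\<close>
    define m where "m = card (V 1)"
    have one: "1 \<in> {1..q}" using q by simp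
    have m: "real m \<ge> real n / (2 * real q)" using big[OF one] by (simp add: m_def)
    have "real n / (2 * real q) \<ge> 2" using n q1 by (simp add: pos_le_divide_eq)
    then have m2: "real m \<ge> 2" using m by linarith
    have "real m * 2 \<le> real m * real m" using m2 by (intro mult_left_mono) auto
    then have "real m * (real m - 1) / 2 \<ge> real m * real m / 4" by (simp add: algebra_simps)
    moreover have "real (m choose 2) = real m * (real m - 1) / 2"
    proof -
      have "2 dvd m * (m - 1)" by (cases m) auto
      then have "real (m choose 2) = real (m * (m - 1)) / 2"
        unfolding choose_two by (simp only: real_of_nat_div of_nat_numeral)
      then show ?thesis using m2 by (simp add: of_nat_diff)
    qed
    ultimately have ch: "real (m choose 2) \<ge> real m * real m / 4" by simp
    have "real n / (2 * real q) * (real n / (2 * real q)) \<le> real m * real m"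
      using m n0 q1 by (intro mult_mono) auto
    then have "real n ^ 2 \<le> 4 * real q ^ 2 * (real m * real m)"
      using q1 by (simp add: field_simps power2_eq_square)
    then have n2: "real n ^ 2 \<le> 16 * real q ^ 2 * real (m choose 2)"
    proof -
      have "real m * real m \<le> 4 * real (m choose 2)" using ch by simp
      then have "4 * real q ^ 2 * (real m * real m) \<le> 4 * real q ^ 2 * (4 * real (m choose 2))"
        by (rule mult_left_mono) simp
      with \<open>real n ^ 2 \<le> 4 * real q ^ 2 * (real m * real m)\<close> show ?thesis by linarith
    qed
    have "m choose 2 \<le> (\<Sum>i = 1..q. card (V i) choose 2)"
      unfolding m_def by (rule member_le_sum[OF one]) auto
    then have D: "real (m choose 2) \<le> real (\<Sum>i = 1..q. card (V i) choose 2)" by (rule of_nat_mono)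
    have Dpos: "real (\<Sum>i = 1..q. card (V i) choose 2) > 0"
    proof -
      have "real m * real m / 4 > 0" using m2 by simp
      then show ?thesis using ch D by linarith
    qed
    have "real (\<Sum>i = 1..q. edges_in G (V i)) \<le> \<epsilon>' * real n ^ 2 / 2" by (rule E)
    also have "\<dots> \<le> \<epsilon>' * (16 * real q ^ 2 * real (m choose 2)) / 2"
      using n2 e' by (intro divide_right_mono mult_left_mono) auto
    also have "\<dots> = (8 * real q ^ 2 * \<epsilon>') * real (m choose 2)" by simp
    also have "\<dots> \<le> \<epsilon> * real (\<Sum>i = 1..q. card (V i) choose 2)"
      using lin[of "8 * real q ^ 2"] D e by (intro mult_mono) auto
    finally show ?thesis using Dpos by (simp only: pos_divide_le_eq)
  qed
  have partite: "partite n q (delete_inner_edges q V G)"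
    unfolding partite_def
  proof (intro exI[of _ p] conjI ballI impI notI)
    show "p ` {1..n} \<subseteq> {1..q}" by fact
    fix u v assume uv: "u \<in> {1..n}" "v \<in> {1..n}" "{u, v} \<in> delete_inner_edges q V G" "p u = p v"
    then have "{u, v} \<subseteq> V (p u)" by (auto simp: V_def color_class_def)
    moreover have "p u \<in> {1..q}" using p uv by blast
    ultimately show False using uv(3) unfolding delete_inner_edges_def by blast
  qed
  have edit: "edit_dist n G (delete_inner_edges q V G) \<le> \<epsilon> / (10 * real q)"
  proof -
    have fG: "finite G" using G finite_all_edges finite_subset by (auto simp: graphs_eq)
    have "(G - delete_inner_edges q V G) \<union> (delete_inner_edges q V G - G) = (\<Union>i\<in>{1..q}. {e \<in> G. e \<subseteq> V i})"
      by (auto simp: delete_inner_edges_def)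
    then have "card ((G - delete_inner_edges q V G) \<union> (delete_inner_edges q V G - G)) \<le> (\<Sum>i=1..q. edges_in G (V i))"
      unfolding edges_in_def by (simp only: card_UN_le finite_atLeastAtMost)
    then have "real (card ((G - delete_inner_edges q V G) \<union> (delete_inner_edges q V G - G))) \<le> \<epsilon> * (real n)\<^sup>2 / (10 * real q)"
      using inn of_nat_mono[where 'a = real] by (meson order_trans)
    then have "edit_dist n G (delete_inner_edges q V G) \<le> \<epsilon> * (real n)\<^sup>2 / (10 * real q) / (real n)\<^sup>2"
      unfolding edit_dist_def by (rule divide_right_mono) simp
    then show ?thesis using n0 by simp
  qed
  have "\<epsilon> / (10 * real q) \<le> \<epsilon> / 2" using e q1 by (intro divide_left_mono) auto
  then show ?thesis
    unfolding near_turan_def Let_def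
    using part sizes dens inn ratio partite edit by blast
qed

lemma near_turan_concentration:
  assumes e: "\<epsilon> > 0" and r: "r \<ge> 3"
  shows "\<exists>c>0. \<forall>w\<^sub>0>0. \<exists>N. \<forall>n l w. n \<ge> N \<and> weight_vector l w \<and> min_index l w = r \<and> w r = w\<^sub>0 \<longrightarrow>
    mc_prob l w n {G \<in> graphs n. near_turan n (r - 1) \<epsilon> G} \<ge> 1 - exp (- c * real n ^ 2)"
proof -
  define q where "q = r - 1"
  have q: "q \<ge> 1" "real q \<ge> 1" using r by (auto simp: q_def)
  define \<epsilon>' where "\<epsilon>' = min (1 / (2 * real q)) (\<epsilon> / (10 * real q ^ 2))"
  have e': "0 < \<epsilon>'" "\<epsilon>' \<le> 1 / (2 * real q)" "\<epsilon>' \<le> \<epsilon> / (10 * real q ^ 2)" using e q by (auto simp: \<epsilon>'_def)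
  have "1 / (2 * real q) \<le> 1" using q by simp
  then have e1: "\<epsilon>' \<le> 1" using e' by linarith
  have compl: "1 - x \<le> mc_prob l w n {G \<in> graphs n. P G} \<longleftrightarrow> mc_prob l w n {G \<in> graphs n. \<not> P G} \<le> x" for l w n P x
    unfolding mc_prob_compl[of l w n P] by auto
  show ?thesis unfolding compl
    by (rule structured_transfer[OF e'(1) e1 r, where n\<^sub>0 = "4 * q"])
      (use near_turan_if_structured[OF _ q(1) _ e e'] in \<open>auto simp: q_def\<close>)
qed

lemma cut_dist_prob_tendsto_0:
  assumes w: "weight_vector l w" and e: "\<epsilon> > 0"
  shows "(\<lambda>n. mc_prob l w n {G \<in> graphs n. cut_dist_set (empirical_graphon n G) (B_star (min_index l w - 1)) \<ge> \<epsilon>}) \<longlonglongrightarrow> 0"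
proof -
  have r: "min_index l w \<ge> 3" "w (min_index l w) > 0" using min_index[OF w] by auto
  obtain c where c: "c > 0" and "\<forall>w\<^sub>0>0. \<exists>N. \<forall>n l' w'. n \<ge> N \<and> weight_vector l' w' \<and> min_index l' w' = min_index l w \<and> w' (min_index l w) = w\<^sub>0 \<longrightarrow>
    mc_prob l' w' n {G \<in> graphs n. cut_dist_set (empirical_graphon n G) (B_star (min_index l w - 1)) \<ge> \<epsilon>} \<le> exp (- c * real n ^ 2)"
    using cut_dist_concentration[OF e r(1)] by blast
  then obtain N where N: "\<And>n. n \<ge> N \<Longrightarrow>
    mc_prob l w n {G \<in> graphs n. cut_dist_set (empirical_graphon n G) (B_star (min_index l w - 1)) \<ge> \<epsilon>} \<le> exp (- c * real n ^ 2)"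
    using r(2) w by blast
  \<comment> \<open>Follows from \<open>1 + c * n ^ 2 \<le> exp (c * n ^ 2)\<close>; a bound of
    order \<open>1 / n\<close> is enough for the limit.\<close>
  have "exp (- c * real n ^ 2) \<le> inverse c * inverse (real n)" if "n \<ge> 1" for n
  proof -
    have "c * real n * 1 \<le> c * real n * real n" using c that by (intro mult_left_mono) auto
    also have "\<dots> \<le> exp (c * real n ^ 2)"
      using exp_ge_add_one_self[of "c * real n ^ 2"] unfolding power2_eq_square mult.assoc by linarith
    finally have "inverse (exp (c * real n ^ 2)) \<le> inverse (c * real n)"
      using c that by (intro le_imp_inverse_le) auto
    then show ?thesis by (simp add: exp_minus inverse_mult_distrib)
  qed
  then have ev: "\<forall>\<^sub>F n in sequentially. mc_prob l w n {G \<in> graphs n. cut_dist_set (empirical_graphon n G) (B_star (min_index l w - 1)) \<ge> \<epsilon>} \<le> inverse c * inverse (real n)"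
    using N unfolding eventually_sequentially by (intro exI[of _ "max N 1"]) (meson max.boundedE order_trans)
  have lim: "(\<lambda>n. inverse c * inverse (real n)) \<longlonglongrightarrow> 0"
    by (rule tendsto_mult_right_zero) (rule lim_inverse_n)
  show ?thesis
    by (rule tendsto_sandwich[OF _ ev tendsto_const lim]) (simp add: mc_prob_nonneg)
qed

theorem theorem6p7:
  shows
    "(\<forall>l w. weight_vector l w \<longrightarrow>
        (mc_free_energy l w \<longlonglongrightarrow> ln 2 / 2 * (1 - 1 / (real (min_index l w) - 1))))
     \<and>
     (\<exists>(c :: real \<Rightarrow> nat \<Rightarrow> real) (N :: real \<Rightarrow> nat \<Rightarrow> real \<Rightarrow> nat).
        \<forall>\<epsilon> > 0. \<forall>l w. weight_vector l w \<longrightarrow>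
          (let r = min_index l w; q = r - 1 in
             c \<epsilon> r > 0 \<and>
             (\<forall>n \<ge> N \<epsilon> r (w r).
                mc_prob l w n
                  {G \<in> graphs n. cut_dist_set (empirical_graphon n G) (B_star q) \<ge> \<epsilon>}
                \<le> exp (- c \<epsilon> r * (real n)\<^sup>2))))
     \<and>
     (\<exists>(c :: real \<Rightarrow> nat \<Rightarrow> real) (N :: real \<Rightarrow> nat \<Rightarrow> real \<Rightarrow> nat).
        \<forall>\<epsilon> > 0. \<forall>l w. weight_vector l w \<longrightarrow>
          (let r = min_index l w; q = r - 1 in
             c \<epsilon> r > 0 \<and>
             (\<forall>n \<ge> N \<epsilon> r (w r).
                mc_prob l w n
                  {G \<in> graphs n. \<exists>V. vertex_partition n q V \<and>
                     (\<forall>i\<in>{1..q}. \<bar>real (card (V i)) - real n / real q\<bar> \<le> \<epsilon> * real n) \<and>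
                     (\<forall>i\<in>{1..q}. \<forall>j\<in>{1..q}. i \<noteq> j \<longrightarrow>
                        \<bar>real (edges_between G (V i) (V j))
                           / (real (card (V i)) * real (card (V j))) - 1 / 2\<bar> \<le> \<epsilon>) \<and>
                     real (\<Sum>i = 1..q. edges_in G (V i)) \<le> \<epsilon> * (real n)\<^sup>2 / (10 * real q) \<and>
                     real (\<Sum>i = 1..q. edges_in G (V i))
                       / real (\<Sum>i = 1..q. card (V i) choose 2) \<le> \<epsilon> \<and>
                     (let G' = delete_inner_edges q V G in
                        partite n q G' \<and>
                        edit_dist n G G' \<le> \<epsilon> / (10 * real q) \<and>
                        \<epsilon> / (10 * real q) \<le> \<epsilon> / 2)}
                \<ge> 1 - exp (- c \<epsilon> r * (real n)\<^sup>2))))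
     \<and>
     (\<forall>l w l' w'. weight_vector l w \<and> weight_vector l' w' \<and> min_index l w = min_index l' w' \<longrightarrow>
        lim (mc_free_energy l w) = lim (mc_free_energy l' w') \<and>
        (let F = B_star (min_index l w - 1) in
           (\<forall>\<epsilon> > 0.
              (\<lambda>n. mc_prob l w n
                 {G \<in> graphs n. cut_dist_set (empirical_graphon n G) F \<ge> \<epsilon>}) \<longlonglongrightarrow> 0 \<and>
              (\<lambda>n. mc_prob l' w' n
                 {G \<in> graphs n. cut_dist_set (empirical_graphon n G) F \<ge> \<epsilon>}) \<longlonglongrightarrow> 0)))"
proof (intro conjI, goal_cases)
  case 1
  show ?case using free_energy_limit by blast
next
  case 2
  show ?case
    unfolding Let_def
    by (rule choose_constants[where P = "\<lambda>\<epsilon> r n l w c. mc_prob l w n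
      {G \<in> graphs n. cut_dist_set (empirical_graphon n G) (B_star (r - 1)) \<ge> \<epsilon>} \<le> exp (- c * (real n)\<^sup>2)"])
      (rule cut_dist_concentration)
next
  case 3
  show ?case
    \<comment> \<open>Folding comes first: \<open>near_turan_def\<close> contains a
      \<open>let\<close>, which no longer matches once \<open>Let_def\<close> is unfolded.\<close>
    unfolding near_turan_def[symmetric] unfolding Let_def
    by (rule choose_constants[where P = "\<lambda>\<epsilon> r n l w c. mc_prob l w n
      {G \<in> graphs n. near_turan n (r - 1) \<epsilon> G} \<ge> 1 - exp (- c * (real n)\<^sup>2)"])
      (rule near_turan_concentration)
next
  case 4
  show ?case
    unfolding Let_def
  proof (intro allI impI)
    fix l w l' w' assume "weight_vector l w \<and> weight_vector l' w' \<and> min_index l w = min_index l' w'"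
    then have w: "weight_vector l w" "weight_vector l' w'" and eq: "min_index l' w' = min_index l w" by auto
    show "lim (mc_free_energy l w) = lim (mc_free_energy l' w') \<and>
      (\<forall>\<epsilon> > 0.
        (\<lambda>n. mc_prob l w n {G \<in> graphs n. cut_dist_set (empirical_graphon n G) (B_star (min_index l w - 1)) \<ge> \<epsilon>}) \<longlonglongrightarrow> 0 \<and>
        (\<lambda>n. mc_prob l' w' n {G \<in> graphs n. cut_dist_set (empirical_graphon n G) (B_star (min_index l w - 1)) \<ge> \<epsilon>}) \<longlonglongrightarrow> 0)"
      using limI[OF free_energy_limit[OF w(1)]] limI[OF free_energy_limit[OF w(2)]]
        cut_dist_prob_tendsto_0[OF w(1)] cut_dist_prob_tendsto_0[OF w(2)] unfolding eq by simp
  qed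
qed

end
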